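(* Let $n\ge1$. There is a well-defined $\mathbb Z[A,A^{-1}]$-linear function $Tr:VH_n\to\mathcal M$, $Tr(x)=Trace(k(x))$, on the virtual Hecke algebra, where $k$ is the algebra map to $GraphCat([n],[n])$ sending $P_i$ to the double-$Y$ graph and $v_i$ to the virtual crossing of strands $i,i+1$. It satisfies $Tr(XY)=Tr(YX)$ for all $X,Y\in VH_n$, and for every virtual braid $b\in VB_n$ with closure $\bar b$, $$[[\bar b]]=Tr(h(b))=Trace(k(h(b))).$$
   Context: Graphs and $\mathcal M$. Let $\mathcal S$ be the collection of finite oriented trivalent bipartite graphs (up to isomorphism; multiple edges, disjoint unions and vertexless circle components allowed) with all edges oriented from one part to the other, so that each vertex is a source or a sink. A bigon is a pair of distinct vertices joined by (at least) two edges, with a chosen pair of such edges; a quadrilateral is a 4-cycle with distinct vertices. $\mathcal T=\{t_1,t_2,\dots\}$ is the set of connected graphs in $\mathcal S$ (having vertices) with neither bigons nor quadrilaterals, and $\mathcal M=\mathbb Z[A,A^{-1}][t_1,t_2,\dots]$ (products are disjoint unions). The reduction relations are: circle $=A^6+1+A^{-6}$; resolving a bigon (delete its two vertices and the two chosen edges, glue the two external edge-ends) costs the factor $A^3+A^{-3}$; a quadrilateral $v_1v_2v_3v_4$ with external ends $e_i$ at $v_i$ equals the sum of the graph with the quadrilateral deleted and $e_1$ glued to $e_2$, $e_3$ to $e_4$, and the one with $e_2$ glued to $e_3$, $e_4$ to $e_1$. Each $\Gamma\in\mathcal S$ reduces to a unique element $f(\Gamma)\in\mathcal M$. Bracket.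 At a classical crossing of an oriented virtual link diagram with incoming ends $i_1,i_2$ and outgoing ends $o_1,o_2$ ($i_k$ opposite $o_k$), the oriented local state joins $i_1$ to $o_2$ and $i_2$ to $o_1$; the unoriented one has a sink $x$ receiving $i_1,i_2$, a source $y$ emitting $o_1,o_2$, and an edge from $y$ to $x$. $[[K]]=\sum_s w(K_s)f(K_s)$, over all choices $s$ of local states, $K_s$ being the abstract resulting graph, with $w(K_s)$ the product over crossings of sign $\varepsilon$ of $A^{2\varepsilon}$ (oriented) or $-A^{-\varepsilon}$ (unoriented). $GraphCat$. Objects are $[0],[1],[2],\dots$; morphisms $[m]\to[n]$ are $\mathbb Z[A,A^{-1}]$-linear combinations of oriented graphs (vertices trivalent sources or sinks, plus $m$ lower and $n$ upper free ends; virtual crossings of a planar picture are ignored) modulo the reduction relations above; composition glues upper ends to lower ends. Here all strands in $GraphCat([n],[n])$ at the free ends are oriented upward. $Trace(G)=[[\bar G]]\in\mathcal M$ is the reduction $f(\bar G)$, extended linearly, of the closure $\bar G$ obtained by joining the $j$-th upper end to the $j$-th lower end, $j=1,\dots,n$. Virtual Hecke algebra. $VB_n$ is the virtual braid group, with braid generators $\sigma_i$ and virtual generators $v_i$ ($1\le i\le n-1$), $v_i$ being a virtual crossing of strands $i,i+1$; the closure of a virtual braid is an oriented virtual link, and the sign convention is that $\sigma_i$ is a positive crossing. $VH_n$ is the quotient of $\mathbb Z[A,A^{-1}][VB_n]$ in which the elements $P_i$ defined by $\sigma_i=A^2I-A^{-1}P_i$ satisfy $P_i^2=(A^3+A^{-3})P_i$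 and $v_iP_i=P_iv_i=P_i$; then $\sigma_i^{-1}=A^{-2}I-AP_i$ and $P_iP_{i+1}P_i-P_i=P_{i+1}P_iP_{i+1}-P_{i+1}$. $h:VB_n\to VH_n$ is the natural map. The double-$Y$ graph $P_i$ consists of vertical strands except at positions $i,i+1$, where the two lower ends enter a sink $x$, the two upper ends leave a source $y$, and there is an edge from $y$ to $x$. *)

theory Defs
  imports
    "HOL-Library.Multiset"
    "HOL-Library.Poly_Mapping"
    "HOL-Algebra.QuotRing"
begin

section \<open>Coefficients and linear combinations\<close>

text \<open>The group algebra of the integers over the integers is the ring of Laurent polynomials
  in \<open>A\<close>; the multiplication of \<^theory>\<open>HOL-Library.Poly_Mapping\<close> is convolution.\<close>

type_synonym laurent = "int \<Rightarrow>\<^sub>0 int"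

definition Apow :: "int \<Rightarrow> laurent" where
  "Apow k = Poly_Mapping.single k 1"

definition lscale :: "laurent \<Rightarrow> ('a \<Rightarrow>\<^sub>0 laurent) \<Rightarrow> ('a \<Rightarrow>\<^sub>0 laurent)" where
  "lscale c x = Poly_Mapping.map ((*) c) x"

definition lin_ext :: "('a \<Rightarrow> ('b \<Rightarrow>\<^sub>0 laurent)) \<Rightarrow> ('a \<Rightarrow>\<^sub>0 laurent) \<Rightarrow> ('b \<Rightarrow>\<^sub>0 laurent)" where
  "lin_ext g x = (\<Sum>a\<in>Poly_Mapping.keys x. lscale (Poly_Mapping.lookup x a) (g a))"

definition bilin_ext ::
    "('a \<Rightarrow> 'a \<Rightarrow> 'a) \<Rightarrow> ('a \<Rightarrow>\<^sub>0 laurent) \<Rightarrow> ('a \<Rightarrow>\<^sub>0 laurent) \<Rightarrow> ('a \<Rightarrow>\<^sub>0 laurent)" where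
  "bilin_ext m x y = (\<Sum>a\<in>Poly_Mapping.keys x. \<Sum>b\<in>Poly_Mapping.keys y.
     Poly_Mapping.single (m a b) (Poly_Mapping.lookup x a * Poly_Mapping.lookup y b))"

section \<open>Oriented graphs\<close>

text \<open>A finite oriented multigraph is its multiset of edges, an edge being the pair of its tail and
  its head. The vertices of the mathematical graph are the trivalent nodes (sources and sinks). A
  node with one incoming and one outgoing edge is not a vertex but a marked point in the interior of
  an edge, which the relation \<open>smooth\<close> below forgets. Hence a vertexless circle is a loop at
  such a point, and an outgoing end \<open>v\<close> is glued to an incoming end \<open>u\<close> by
  adding the edge \<open>(v, u)\<close> or by identifying \<open>v\<close> with \<open>u\<close>; if
  both belong to the same edge this correctly produces a circle.\<close>

type_synonym 'v dgraph = "('v \<times> 'v) multiset"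

definition outdeg :: "'v dgraph \<Rightarrow> 'v \<Rightarrow> nat" where
  "outdeg G v = size (filter_mset (\<lambda>e. fst e = v) G)"

definition indeg :: "'v dgraph \<Rightarrow> 'v \<Rightarrow> nat" where
  "indeg G v = size (filter_mset (\<lambda>e. snd e = v) G)"

definition nodes :: "'v dgraph \<Rightarrow> 'v set" where
  "nodes G = fst ` set_mset G \<union> snd ` set_mset G"

lemma outdeg_simps:
  "outdeg {#} v = 0" "outdeg (G+H) v = outdeg G v + outdeg H v"
  "outdeg (add_mset e G) v = (if fst e = v then 1 else 0) + outdeg G v"
  "indeg {#} v = 0" "indeg (G+H) v = indeg G v + indeg H v"
  "indeg (add_mset e G) v = (if snd e = v then 1 else 0) + indeg G v"
  by (auto simp: outdeg_def indeg_def)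

lemma outdeg_sum:
  "outdeg (sum F S) v = (\<Sum>k\<in>S. outdeg (F k) v)"
  "indeg (sum F S) v = (\<Sum>k\<in>S. indeg (F k) v)"
  by (induction S rule: infinite_finite_induct) (auto simp: outdeg_simps)

lemma deg_image:
  assumes "finite J"
  shows "outdeg (image_mset e (mset_set J)) v = card {j\<in>J. fst (e j) = v}"
    and "indeg (image_mset e (mset_set J)) v = card {j\<in>J. snd (e j) = v}"
  using assms by (simp_all add: outdeg_def indeg_def filter_mset_image_mset comp_def filter_mset_mset_set)

lemma nodes_deg: "v \<in> nodes G \<longleftrightarrow> outdeg G v \<noteq> 0 \<or> indeg G v \<noteq> 0"
  unfolding nodes_def outdeg_def indeg_def by (auto simp: filter_mset_eq_conv image_iff)

definition is_source :: "'v dgraph \<Rightarrow> 'v \<Rightarrow> bool" where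
  "is_source G v \<longleftrightarrow> outdeg G v = 3 \<and> indeg G v = 0"

definition is_sink :: "'v dgraph \<Rightarrow> 'v \<Rightarrow> bool" where
  "is_sink G v \<longleftrightarrow> outdeg G v = 0 \<and> indeg G v = 3"

definition is_point :: "'v dgraph \<Rightarrow> 'v \<Rightarrow> bool" where
  "is_point G v \<longleftrightarrow> outdeg G v = 1 \<and> indeg G v = 1"

definition rename :: "('v \<Rightarrow> 'w) \<Rightarrow> 'v dgraph \<Rightarrow> 'w dgraph" where
  "rename \<phi> G = image_mset (map_prod \<phi> \<phi>) G"

definition graph_iso :: "'v dgraph \<Rightarrow> 'w dgraph \<Rightarrow> bool" where
  "graph_iso G H \<longleftrightarrow> (\<exists>\<phi>. inj_on \<phi> (nodes G) \<and> H = rename \<phi> G)"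

definition connected_graph :: "'v dgraph \<Rightarrow> bool" where
  "connected_graph G \<longleftrightarrow>
     (\<forall>a\<in>nodes G. \<forall>b\<in>nodes G. (a, b) \<in> (set_mset G \<union> (set_mset G)\<inverse>)\<^sup>*)"

definition has_bigon :: "'v dgraph \<Rightarrow> bool" where
  "has_bigon G \<longleftrightarrow> (\<exists>u v. u \<noteq> v \<and> count G (u, v) \<ge> 2)"

definition has_quadrilateral :: "'v dgraph \<Rightarrow> bool" where
  "has_quadrilateral G \<longleftrightarrow> (\<exists>v1 v2 v3 v4. distinct [v1, v2, v3, v4] \<and>
     (v1, v2) \<in># G \<and> (v3, v2) \<in># G \<and> (v3, v4) \<in># G \<and> (v1, v4) \<in># G)"

definition irreducible_web :: "'v dgraph \<Rightarrow> bool" where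
  "irreducible_web G \<longleftrightarrow> G \<noteq> {#} \<and> (\<forall>v\<in>nodes G. is_source G v \<or> is_sink G v) \<and>
     connected_graph G \<and> \<not> has_bigon G \<and> \<not> has_quadrilateral G"

text \<open>The smallest irreducible graph is the Heawood graph.\<close>

definition heawood :: "nat dgraph" where
  "heawood = {#(0,7),(0,8),(0,10), (1,8),(1,9),(1,11), (2,9),(2,10),(2,12), (3,10),(3,11),(3,13),
     (4,11),(4,12),(4,7), (5,12),(5,13),(5,8), (6,13),(6,7),(6,9)#}"

lemma irreducible_web_heawood: "irreducible_web heawood"
proof -
  define es :: "(nat \<times> nat) list" where
    "es = [(0,7),(0,8),(0,10), (1,8),(1,9),(1,11), (2,9),(2,10),(2,12), (3,10),(3,11),(3,13),
       (4,11),(4,12),(4,7), (5,12),(5,13),(5,8), (6,13),(6,7),(6,9)]"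
  have mset_es: "heawood = mset es"
    by (simp add: heawood_def es_def)
  have set_es: "set_mset heawood = set es"
    unfolding mset_es by (rule set_mset_mset)
  have nodes: "nodes heawood = {0,1,2,3,4,5,6,7,8,9,10,11,12,13}"
    unfolding nodes_def set_es es_def by auto
  have deg: "\<forall>v\<in>nodes heawood. is_source heawood v \<or> is_sink heawood v"
    unfolding nodes by (simp add: is_source_def is_sink_def outdeg_def indeg_def heawood_def)
  have "distinct es"
    by (simp add: es_def)
  then have "count heawood e \<le> 1" for e
    unfolding mset_es by (cases e) (simp add: distinct_count_atmost_1)
  then have bigon: "\<not> has_bigon heawood"
    unfolding has_bigon_def by (metis Suc_1 not_less_eq_eq One_nat_def)
  have "\<forall>(a, b)\<in>set es. \<forall>(a', d)\<in>set es. a' = a \<longrightarrow> d \<noteq> b \<longrightarrow>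
      (\<forall>(c, b')\<in>set es. b' = b \<longrightarrow> c \<noteq> a \<longrightarrow> (c, d) \<notin> set es)"
    unfolding es_def by simp
  then have quad: "\<not> has_quadrilateral heawood"
    unfolding has_quadrilateral_def set_es by fastforce
  define R where "R = set es \<union> (set es)\<inverse>"
  have fwd: "(a, y) \<in> R\<^sup>*" if "(a, x) \<in> R\<^sup>*" "(x, y) \<in> set es" for a x y
    using that unfolding R_def by (meson UnI1 rtrancl.rtrancl_into_rtrancl)
  have bwd: "(a, y) \<in> R\<^sup>*" if "(a, x) \<in> R\<^sup>*" "(y, x) \<in> set es" for a x y
    using that unfolding R_def by (meson UnI2 converseI rtrancl.rtrancl_into_rtrancl)
  have r0: "(0, 0) \<in> R\<^sup>*" by simp
  have r7: "(0, 7) \<in> R\<^sup>*" by (rule fwd[OF r0]) (simp add: es_def)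
  have r8: "(0, 8) \<in> R\<^sup>*" by (rule fwd[OF r0]) (simp add: es_def)
  have r10: "(0, 10) \<in> R\<^sup>*" by (rule fwd[OF r0]) (simp add: es_def)
  have r4: "(0, 4) \<in> R\<^sup>*" by (rule bwd[OF r7]) (simp add: es_def)
  have r6: "(0, 6) \<in> R\<^sup>*" by (rule bwd[OF r7]) (simp add: es_def)
  have r1: "(0, 1) \<in> R\<^sup>*" by (rule bwd[OF r8]) (simp add: es_def)
  have r5: "(0, 5) \<in> R\<^sup>*" by (rule bwd[OF r8]) (simp add: es_def)
  have r2: "(0, 2) \<in> R\<^sup>*" by (rule bwd[OF r10]) (simp add: es_def)
  have r3: "(0, 3) \<in> R\<^sup>*" by (rule bwd[OF r10]) (simp add: es_def)
  have r9: "(0, 9) \<in> R\<^sup>*" by (rule fwd[OF r1]) (simp add: es_def)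
  have r11: "(0, 11) \<in> R\<^sup>*" by (rule fwd[OF r1]) (simp add: es_def)
  have r12: "(0, 12) \<in> R\<^sup>*" by (rule fwd[OF r2]) (simp add: es_def)
  have r13: "(0, 13) \<in> R\<^sup>*" by (rule fwd[OF r3]) (simp add: es_def)
  have reach: "(0, v) \<in> R\<^sup>*" if "v \<in> nodes heawood" for v
    using that r0 r1 r2 r3 r4 r5 r6 r7 r8 r9 r10 r11 r12 r13 unfolding nodes by auto
  have "sym (R\<^sup>*)"
    unfolding R_def by (intro sym_rtrancl sym_Un_converse)
  then have "connected_graph heawood"
    using reach unfolding connected_graph_def set_es R_def[symmetric]
    by (meson rtrancl_trans symD)
  then show ?thesis
    using deg bigon quad unfolding irreducible_web_def by (simp add: heawood_def)
qed

text \<open>The set \<open>\<T>\<close> of isomorphism classes of irreducible graphs.\<close>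

typedef tvar = "{{H :: nat dgraph. graph_iso G H} | G :: nat dgraph. irreducible_web G}"
  using irreducible_web_heawood by blast

type_synonym tpoly = "(tvar \<Rightarrow>\<^sub>0 nat) \<Rightarrow>\<^sub>0 laurent"

definition tvar_of :: "'v dgraph \<Rightarrow> tpoly" where
  "tvar_of G = Poly_Mapping.single (Poly_Mapping.single (Abs_tvar {H. graph_iso G H}) 1) 1"

section \<open>The reduction relations\<close>

inductive local_rel :: "'v dgraph \<Rightarrow> ('v dgraph \<Rightarrow>\<^sub>0 laurent) \<Rightarrow> bool" where
  smooth: "\<lbrakk>w \<notin> nodes G; w \<noteq> a; w \<noteq> b\<rbrakk> \<Longrightarrow>
    local_rel (G + {#(a, w), (w, b)#}) (Poly_Mapping.single (G + {#(a, b)#}) 1)"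
| circle: "w \<notin> nodes G \<Longrightarrow>
    local_rel (G + {#(w, w)#}) (Poly_Mapping.single G (Apow 6 + 1 + Apow (-6)))"
| bigon: "\<lbrakk>H = G + {#(u, v), (u, v)#}; is_source H u; is_sink H v\<rbrakk> \<Longrightarrow>
    local_rel H (Poly_Mapping.single (G + {#(v, u)#}) (Apow 3 + Apow (-3)))"
| quadrilateral: "\<lbrakk>H = G + {#(v1, v2), (v3, v2), (v3, v4), (v1, v4)#}; distinct [v1, v2, v3, v4];
      is_source H v1; is_sink H v2; is_source H v3; is_sink H v4\<rbrakk> \<Longrightarrow>
    local_rel H (Poly_Mapping.single (G + {#(v2, v1), (v4, v3)#}) 1 +
                 Poly_Mapping.single (G + {#(v2, v3), (v4, v1)#}) 1)"

inductive reduces_to :: "'v dgraph \<Rightarrow> tpoly \<Rightarrow> bool" where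
  empty: "reduces_to {#} 1"
| irreducible: "\<lbrakk>irreducible_web G; nodes G \<inter> nodes H = {}; reduces_to H p\<rbrakk> \<Longrightarrow>
    reduces_to (G + H) (tvar_of G * p)"
| relation: "\<lbrakk>local_rel G x; \<And>H. H \<in> Poly_Mapping.keys x \<Longrightarrow> reduces_to H (g H)\<rbrakk> \<Longrightarrow>
    reduces_to G (lin_ext g x)"

definition web_eval :: "'v dgraph \<Rightarrow> tpoly" where
  "web_eval G = (THE p. reduces_to G p)"

section \<open>Virtual link diagrams and the bracket\<close>

text \<open>A crossing \<open>c\<close> has incoming ends \<open>Inc c 1\<close> (left) and
  \<open>Inc c 2\<close> (right), seen along the direction of the strands, and outgoing ends
  \<open>Outg c 1\<close> (right) and \<open>Outg c 2\<close> (left), so that \<open>Inc c k\<close> is opposite to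
  \<open>Outg c k\<close>. The over-strand is then determined by the sign.
  The nodes \<open>Pt\<close> are marked points on the arcs, \<open>Sink\<close> and \<open>Source\<close>
  the two vertices of the unoriented local state.\<close>

datatype kind = Pos | Neg | Virt

datatype dnode = Inc nat nat | Outg nat nat | Pt nat nat | Sink nat | Source nat

text \<open>The crossings of a diagram are numbered from 0; its arcs lead from outgoing to incoming ends
  of crossings, possibly through marked points. Planarity plays no role: arcs of the abstract diagram
  that meet in the plane meet in virtual crossings.\<close>

record vdiagram =
  kinds :: "kind list"
  arcs :: "dnode dgraph"

definition virtual_diagram :: "vdiagram \<Rightarrow> bool" where
  "virtual_diagram D \<longleftrightarrow>
     nodes (arcs D) \<subseteq> (\<Union>c<length (kinds D). {Inc c 1, Inc c 2, Outg c 1, Outg c 2}) \<union>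
       {Pt a b | a b. True} \<and>
     (\<forall>c<length (kinds D). \<forall>k\<in>{1, 2}.
        outdeg (arcs D) (Inc c k) = 0 \<and> indeg (arcs D) (Inc c k) = 1 \<and>
        outdeg (arcs D) (Outg c k) = 1 \<and> indeg (arcs D) (Outg c k) = 0) \<and>
     (\<forall>a b. Pt a b \<in> nodes (arcs D) \<longrightarrow> is_point (arcs D) (Pt a b))"

definition oriented_state :: "nat \<Rightarrow> dnode dgraph" where
  "oriented_state c = {#(Inc c 1, Outg c 2), (Inc c 2, Outg c 1)#}"

definition unoriented_state :: "nat \<Rightarrow> dnode dgraph" where
  "unoriented_state c = {#(Inc c 1, Sink c), (Inc c 2, Sink c),
     (Source c, Outg c 1), (Source c, Outg c 2), (Source c, Sink c)#}"

definition virtual_state :: "nat \<Rightarrow> dnode dgraph" where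
  "virtual_state c = {#(Inc c 1, Outg c 1), (Inc c 2, Outg c 2)#}"

definition classical :: "vdiagram \<Rightarrow> nat set" where
  "classical D = {c. c < length (kinds D) \<and> kinds D ! c \<noteq> Virt}"

text \<open>A choice of local states is given by the set \<open>U\<close> of classical crossings at which
  the unoriented one is chosen.\<close>

definition state_graph :: "vdiagram \<Rightarrow> nat set \<Rightarrow> dnode dgraph" where
  "state_graph D U = arcs D + (\<Sum>c<length (kinds D).
     if kinds D ! c = Virt then virtual_state c
     else if c \<in> U then unoriented_state c else oriented_state c)"

definition crossing_sign :: "kind \<Rightarrow> int" where
  "crossing_sign \<kappa> = (case \<kappa> of Pos \<Rightarrow> 1 | Neg \<Rightarrow> -1 | Virt \<Rightarrow> 0)"

definition state_weight :: "vdiagram \<Rightarrow> nat set \<Rightarrow> laurent" where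
  "state_weight D U = (\<Prod>c\<in>classical D.
     if c \<in> U then - Apow (- crossing_sign (kinds D ! c))
     else Apow (2 * crossing_sign (kinds D ! c)))"

definition bracket :: "vdiagram \<Rightarrow> tpoly" where
  "bracket D = (\<Sum>U\<in>Pow (classical D). lscale (state_weight D U) (web_eval (state_graph D U)))"

section \<open>Virtual braids and their closures\<close>

text \<open>The letters \<open>(Pos, i)\<close>, \<open>(Neg, i)\<close>, \<open>(Virt, i)\<close> stand for
  \<open>\<sigma>\<^sub>i\<close>, its inverse and \<open>v\<^sub>i\<close>.\<close>

type_synonym bword = "(kind \<times> nat) list"

definition bwords :: "nat \<Rightarrow> bword set" where
  "bwords n = {w. \<forall>l\<in>set w. 1 \<le> snd l \<and> snd l < n}"

inductive vb_relator :: "bword \<Rightarrow> bword \<Rightarrow> bool" where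
  "vb_relator [(Pos, i), (Neg, i)] []"
| "vb_relator [(Neg, i), (Pos, i)] []"
| "vb_relator [(Virt, i), (Virt, i)] []"
| "vb_relator [(Pos, i), (Pos, i+1), (Pos, i)] [(Pos, i+1), (Pos, i), (Pos, i+1)]"
| "vb_relator [(Virt, i), (Virt, i+1), (Virt, i)] [(Virt, i+1), (Virt, i), (Virt, i+1)]"
| "vb_relator [(Virt, i), (Virt, i+1), (Pos, i)] [(Pos, i+1), (Virt, i), (Virt, i+1)]"
| "i + 1 < j \<or> j + 1 < i \<Longrightarrow> vb_relator [(\<kappa>, i), (\<kappa>', j)] [(\<kappa>', j), (\<kappa>, i)]"

inductive_set vb_eq :: "nat \<Rightarrow> (bword \<times> bword) set" for n where
  refl: "w \<in> bwords n \<Longrightarrow> (w, w) \<in> vb_eq n"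
| sym: "(w, w') \<in> vb_eq n \<Longrightarrow> (w', w) \<in> vb_eq n"
| trans: "\<lbrakk>(w, w') \<in> vb_eq n; (w', w'') \<in> vb_eq n\<rbrakk> \<Longrightarrow> (w, w'') \<in> vb_eq n"
| step: "\<lbrakk>vb_relator l r; u @ l @ v \<in> bwords n; u @ r @ v \<in> bwords n\<rbrakk> \<Longrightarrow>
    (u @ l @ v, u @ r @ v) \<in> vb_eq n"

definition vb_class :: "nat \<Rightarrow> bword \<Rightarrow> bword set" where
  "vb_class n w = vb_eq n `` {w}"

definition VB :: "nat \<Rightarrow> bword set monoid" where
  "VB n = \<lparr>carrier = bwords n // vb_eq n,
           mult = (\<lambda>X Y. \<Union>u\<in>X. \<Union>v\<in>Y. vb_class n (u @ v)),
           one = vb_class n []\<rparr>"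

text \<open>Braids are drawn upwards and the product \<open>xy\<close> has \<open>x\<close> above
  \<open>y\<close>. The letter number \<open>k\<close> of a word (counted from 0) occupies the layer between the
  level \<open>k + 1\<close> (below) and the level \<open>k\<close> (above); \<open>Pt k j\<close> is the point of
  strand position \<open>j\<close> on level \<open>k\<close>.\<close>

definition layer :: "nat \<Rightarrow> nat \<Rightarrow> nat \<Rightarrow> dnode dgraph" where
  "layer n k i =
     image_mset (\<lambda>j. (Pt (k+1) j, Pt k j)) (mset_set ({1..n} - {i, i+1})) +
     {#(Pt (k+1) i, Inc k 1), (Pt (k+1) (i+1), Inc k 2),
       (Outg k 1, Pt k (i+1)), (Outg k 2, Pt k i)#}"

definition braid_closure :: "nat \<Rightarrow> bword \<Rightarrow> vdiagram" where
  "braid_closure n w =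
     \<lparr>kinds = map fst w,
      arcs = (\<Sum>k<length w. layer n k (snd (w ! k))) +
             image_mset (\<lambda>j. (Pt 0 j, Pt (length w) j)) (mset_set {1..n})\<rparr>"

lemma card_singleton_filter: "card {j. P j \<and> j = b} = (if P b then 1 else 0)" "card {j. j = b \<and> P j} = (if P b then 1 else 0)"
proof -
  have "{j. P j \<and> j = b} = (if P b then {b} else {})" "{j. j = b \<and> P j} = (if P b then {b} else {})" by auto
  then show "card {j. P j \<and> j = b} = (if P b then 1 else 0)" "card {j. j = b \<and> P j} = (if P b then 1 else 0)" by auto
qed

lemma layer_deg: assumes "1 \<le> i" "i < n"
  shows "outdeg (layer n k i) v = (case v of Pt a b \<Rightarrow> if a = k+1 \<and> b\<in>{1..n} then 1 else 0
        | Outg c s \<Rightarrow> if c = k \<and> s\<in>{1,2} then 1 else 0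
        | _ \<Rightarrow> 0)"
    "indeg (layer n k i) v = (case v of Pt a b \<Rightarrow> if a = k \<and> b\<in>{1..n} then 1 else 0
        | Inc c s \<Rightarrow> if c = k \<and> s\<in>{1,2} then 1 else 0
        | _ \<Rightarrow> 0)"
  using assms unfolding layer_def
  by (auto simp: outdeg_simps deg_image card_singleton_filter split: dnode.splits)

lemma
  assumes w: "w \<in> bwords n"
  defines "G \<equiv> arcs (braid_closure n w)"
  shows outdeg_braid_closure: "outdeg G v = (case v of Pt a b \<Rightarrow> if a \<le> length w \<and> b\<in>{1..n} then 1 else 0
        | Outg c s \<Rightarrow> if c < length w \<and> s\<in>{1,2} then 1 else 0
        | _ \<Rightarrow> 0)"
    and indeg_braid_closure: "indeg G v = (case v of Pt a b \<Rightarrow> if a \<le> length w \<and> b\<in>{1..n} then 1 else 0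
        | Inc c s \<Rightarrow> if c < length w \<and> s\<in>{1,2} then 1 else 0
        | _ \<Rightarrow> 0)"
proof -
  have i: "1 \<le> snd (w!k)" "snd (w!k) < n" if "k < length w" for k
    using w that unfolding bwords_def by auto
  have ld': "(\<Sum>k<length w. outdeg (layer n k (snd (w ! k))) v) =
      (\<Sum>k<length w. (case v of Pt a b \<Rightarrow> if a = Suc k \<and> b\<in>{1..n} then 1 else 0
        | Outg c s \<Rightarrow> if c = k \<and> s\<in>{1,2} then 1 else 0
        | _ \<Rightarrow> 0))"
   "(\<Sum>k<length w. indeg (layer n k (snd (w ! k))) v) =
      (\<Sum>k<length w. (case v of Pt a b \<Rightarrow> if a = k \<and> b\<in>{1..n} then 1 else 0
        | Inc c s \<Rightarrow> if c = k \<and> s\<in>{1,2} then 1 else 0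
        | _ \<Rightarrow> 0))" for v
   by (rule sum.cong[OF HOL.refl], simp add: layer_deg i[simplified] cong: if_cong split: dnode.split)+
  have s: "(\<Sum>k<L. if a = Suc k \<and> P then 1 else (0::nat)) = (if 0<a \<and> a \<le> L \<and> P then 1 else 0)" for a P L
    by (induction L) auto
  have s': "(\<Sum>k<L. if a = k \<and> P then 1 else (0::nat)) = (if a < L \<and> P then 1 else 0)" for a L :: nat and P
    by (induction L) auto
  show "outdeg G v = (case v of Pt a b \<Rightarrow> if a \<le> length w \<and> b\<in>{1..n} then 1 else 0
        | Outg c s \<Rightarrow> if c < length w \<and> s\<in>{1,2} then 1 else 0
        | _ \<Rightarrow> 0)"
    unfolding G_def braid_closure_def
    by (cases v) (auto simp: outdeg_simps outdeg_sum ld' deg_image card_singleton_filter s s')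
  show "indeg G v = (case v of Pt a b \<Rightarrow> if a \<le> length w \<and> b\<in>{1..n} then 1 else 0
        | Inc c s \<Rightarrow> if c < length w \<and> s\<in>{1,2} then 1 else 0
        | _ \<Rightarrow> 0)"
    unfolding G_def braid_closure_def
    by (cases v) (auto simp: outdeg_simps outdeg_sum ld' deg_image card_singleton_filter s s')
qed

lemma virtual_diagram_braid_closure:
  assumes w: "w \<in> bwords n"
  shows "virtual_diagram (braid_closure n w)"
proof -
  have k: "length (kinds (braid_closure n w)) = length w" by (simp add: braid_closure_def)
  show ?thesis unfolding virtual_diagram_def k is_point_def
    by (auto simp: outdeg_braid_closure[OF w] indeg_braid_closure[OF w] nodes_deg split: dnode.splits if_splits)
qed

section \<open>The virtual Hecke algebra\<close>

definition group_algebra :: "('g, 'b) monoid_scheme \<Rightarrow> ('g \<Rightarrow>\<^sub>0 laurent) ring" where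
  "group_algebra G =
     \<lparr>carrier = {x. Poly_Mapping.keys x \<subseteq> carrier G},
      mult = bilin_ext (mult G),
      one = Poly_Mapping.single \<one>\<^bsub>G\<^esub> 1,
      zero = 0,
      add = (+)\<rparr>"

abbreviation ZVB :: "nat \<Rightarrow> (bword set \<Rightarrow>\<^sub>0 laurent) ring" where
  "ZVB n \<equiv> group_algebra (VB n)"

definition braid_elt :: "nat \<Rightarrow> bword \<Rightarrow> bword set \<Rightarrow>\<^sub>0 laurent" where
  "braid_elt n w = Poly_Mapping.single (vb_class n w) 1"

text \<open>The equation \<open>\<sigma>\<^sub>i = A\<^sup>2 I - A\<^sup>-\<^sup>1 P\<^sub>i\<close> solved for
  \<open>P\<^sub>i\<close>.\<close>

definition P_elt :: "nat \<Rightarrow> nat \<Rightarrow> bword set \<Rightarrow>\<^sub>0 laurent" where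
  "P_elt n i = lscale (Apow 3) (braid_elt n []) - lscale (Apow 1) (braid_elt n [(Pos, i)])"

definition hecke_relators :: "nat \<Rightarrow> (bword set \<Rightarrow>\<^sub>0 laurent) set" where
  "hecke_relators n = (\<Union>i\<in>{1..<n}.
     {P_elt n i \<otimes>\<^bsub>ZVB n\<^esub> P_elt n i - lscale (Apow 3 + Apow (-3)) (P_elt n i),
      braid_elt n [(Virt, i)] \<otimes>\<^bsub>ZVB n\<^esub> P_elt n i - P_elt n i,
      P_elt n i \<otimes>\<^bsub>ZVB n\<^esub> braid_elt n [(Virt, i)] - P_elt n i})"

definition hecke_ideal :: "nat \<Rightarrow> (bword set \<Rightarrow>\<^sub>0 laurent) set" where
  "hecke_ideal n = Idl\<^bsub>ZVB n\<^esub> (hecke_relators n)"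

definition VH :: "nat \<Rightarrow> (bword set \<Rightarrow>\<^sub>0 laurent) set ring" where
  "VH n = ZVB n Quot hecke_ideal n"

definition VH_proj :: "nat \<Rightarrow> (bword set \<Rightarrow>\<^sub>0 laurent) \<Rightarrow> (bword set \<Rightarrow>\<^sub>0 laurent) set" where
  "VH_proj n x = hecke_ideal n +>\<^bsub>ZVB n\<^esub> x"

definition VH_scale ::
    "nat \<Rightarrow> laurent \<Rightarrow> (bword set \<Rightarrow>\<^sub>0 laurent) set \<Rightarrow> (bword set \<Rightarrow>\<^sub>0 laurent) set" where
  "VH_scale n c X = (\<Union>x\<in>X. VH_proj n (lscale c x))"

text \<open>The natural map \<open>h\<close>.\<close>

definition VB_to_VH :: "nat \<Rightarrow> bword set \<Rightarrow> (bword set \<Rightarrow>\<^sub>0 laurent) set" where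
  "VB_to_VH n b = VH_proj n (Poly_Mapping.single b 1)"

section \<open>The graph category\<close>

text \<open>Only upward oriented free ends occur: a lower end is the tail, an upper end the head of its
  edge.\<close>

datatype node = Low nat | Up nat | Inner nat

definition open_graph :: "nat \<Rightarrow> nat \<Rightarrow> node dgraph \<Rightarrow> bool" where
  "open_graph m n G \<longleftrightarrow>
     (\<forall>j. if j \<in> {1..m} then outdeg G (Low j) = 1 \<and> indeg G (Low j) = 0 else Low j \<notin> nodes G) \<and>
     (\<forall>j. if j \<in> {1..n} then outdeg G (Up j) = 0 \<and> indeg G (Up j) = 1 else Up j \<notin> nodes G) \<and>
     (\<forall>k. Inner k \<in> nodes G \<longrightarrow>
        is_source G (Inner k) \<or> is_sink G (Inner k) \<or> is_point G (Inner k))"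

definition graph_combs :: "nat \<Rightarrow> nat \<Rightarrow> (node dgraph \<Rightarrow>\<^sub>0 laurent) set" where
  "graph_combs m n = {x. \<forall>G\<in>Poly_Mapping.keys x. open_graph m n G}"

definition graph_relators :: "nat \<Rightarrow> nat \<Rightarrow> (node dgraph \<Rightarrow>\<^sub>0 laurent) set" where
  "graph_relators m n =
     {Poly_Mapping.single G 1 - Poly_Mapping.single (rename \<phi> G) 1 | G \<phi>.
        open_graph m n G \<and> open_graph m n (rename \<phi> G) \<and> inj_on \<phi> (nodes G) \<and>
        (\<forall>j. \<phi> (Low j) = Low j \<and> \<phi> (Up j) = Up j)} \<union>
     {Poly_Mapping.single G 1 - x | G x. open_graph m n G \<and> local_rel G x}"

inductive_set graph_span :: "nat \<Rightarrow> nat \<Rightarrow> (node dgraph \<Rightarrow>\<^sub>0 laurent) set" for m n where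
  zero: "0 \<in> graph_span m n"
| add: "\<lbrakk>x \<in> graph_span m n; r \<in> graph_relators m n\<rbrakk> \<Longrightarrow> x + lscale c r \<in> graph_span m n"

definition graph_class ::
    "nat \<Rightarrow> nat \<Rightarrow> (node dgraph \<Rightarrow>\<^sub>0 laurent) \<Rightarrow> (node dgraph \<Rightarrow>\<^sub>0 laurent) set" where
  "graph_class m n x = {y. y - x \<in> graph_span m n}"

definition GraphCat :: "nat \<Rightarrow> nat \<Rightarrow> (node dgraph \<Rightarrow>\<^sub>0 laurent) set set" where
  "GraphCat m n = graph_class m n ` graph_combs m n"

definition GraphCat_scale ::
    "nat \<Rightarrow> nat \<Rightarrow> laurent \<Rightarrow> (node dgraph \<Rightarrow>\<^sub>0 laurent) set \<Rightarrow> (node dgraph \<Rightarrow>\<^sub>0 laurent) set" where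
  "GraphCat_scale m n c X = (\<Union>x\<in>X. graph_class m n (lscale c x))"

definition GraphCat_add ::
    "nat \<Rightarrow> nat \<Rightarrow> (node dgraph \<Rightarrow>\<^sub>0 laurent) set \<Rightarrow> (node dgraph \<Rightarrow>\<^sub>0 laurent) set
      \<Rightarrow> (node dgraph \<Rightarrow>\<^sub>0 laurent) set" where
  "GraphCat_add m n X Y = (\<Union>x\<in>X. \<Union>y\<in>Y. graph_class m n (x + y))"

text \<open>In the composite of \<open>G\<close> after \<open>H\<close>, the \<open>j\<close>-th upper end of \<open>H\<close> and the
  \<open>j\<close>-th lower end of \<open>G\<close> become the same marked point; the residues modulo 3 keep the inner nodes
  of \<open>H\<close>, those of \<open>G\<close> and these points apart.\<close>

fun in_lower :: "node \<Rightarrow> node" where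
  "in_lower (Low j) = Low j"
| "in_lower (Inner k) = Inner (3 * k)"
| "in_lower (Up j) = Inner (3 * j + 2)"

fun in_upper :: "node \<Rightarrow> node" where
  "in_upper (Low j) = Inner (3 * j + 2)"
| "in_upper (Inner k) = Inner (3 * k + 1)"
| "in_upper (Up j) = Up j"

definition graph_comp :: "node dgraph \<Rightarrow> node dgraph \<Rightarrow> node dgraph" where
  "graph_comp G H = rename in_upper G + rename in_lower H"

text \<open>\<open>GraphCat_comp m p\<close> composes a morphism into \<open>[p]\<close> after a morphism from \<open>[m]\<close>.\<close>

definition GraphCat_comp ::
    "nat \<Rightarrow> nat \<Rightarrow> (node dgraph \<Rightarrow>\<^sub>0 laurent) set \<Rightarrow> (node dgraph \<Rightarrow>\<^sub>0 laurent) set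
      \<Rightarrow> (node dgraph \<Rightarrow>\<^sub>0 laurent) set" where
  "GraphCat_comp m p X Y = (\<Union>x\<in>X. \<Union>y\<in>Y. graph_class m p (bilin_ext graph_comp x y))"

definition vertical :: "nat set \<Rightarrow> node dgraph" where
  "vertical J = image_mset (\<lambda>j. (Low j, Up j)) (mset_set J)"

definition GraphEnd :: "nat \<Rightarrow> (node dgraph \<Rightarrow>\<^sub>0 laurent) set ring" where
  "GraphEnd n =
     \<lparr>carrier = GraphCat n n,
      mult = GraphCat_comp n n,
      one = graph_class n n (Poly_Mapping.single (vertical {1..n}) 1),
      zero = graph_class n n 0,
      add = GraphCat_add n n\<rparr>"

definition double_Y :: "nat \<Rightarrow> nat \<Rightarrow> node dgraph" where
  "double_Y n i = vertical ({1..n} - {i, i+1}) +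
     {#(Low i, Inner 0), (Low (i+1), Inner 0), (Inner 1, Up i), (Inner 1, Up (i+1)),
       (Inner 1, Inner 0)#}"

definition virtual_crossing :: "nat \<Rightarrow> nat \<Rightarrow> node dgraph" where
  "virtual_crossing n i = vertical ({1..n} - {i, i+1}) +
     {#(Low i, Up (i+1)), (Low (i+1), Up i)#}"

lemma open_graph_generators:
  assumes "1 \<le> i" "i < n" shows "open_graph n n (double_Y n i)" "open_graph n n (virtual_crossing n i)"
  using assms unfolding open_graph_def double_Y_def virtual_crossing_def vertical_def nodes_deg
    is_source_def is_sink_def is_point_def
  by (auto simp: outdeg_simps deg_image card_singleton_filter)

lemma open_graph_identity: "open_graph n n (vertical {1..n})"
  unfolding open_graph_def vertical_def nodes_deg is_source_def is_sink_def is_point_def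
  by (auto simp: outdeg_simps deg_image card_singleton_filter)

fun identify_ends :: "node \<Rightarrow> node" where
  "identify_ends (Low j) = Low j"
| "identify_ends (Inner k) = Inner k"
| "identify_ends (Up j) = Low j"

definition graph_closure :: "node dgraph \<Rightarrow> node dgraph" where
  "graph_closure G = rename identify_ends G"

definition Trace :: "(node dgraph \<Rightarrow>\<^sub>0 laurent) set \<Rightarrow> tpoly" where
  "Trace X = the_elem (lin_ext (\<lambda>G. web_eval (graph_closure G)) ` X)"

definition graph_representation ::
    "nat \<Rightarrow> ((bword set \<Rightarrow>\<^sub>0 laurent) set \<Rightarrow> (node dgraph \<Rightarrow>\<^sub>0 laurent) set) \<Rightarrow> bool" where
  "graph_representation n k \<longleftrightarrow>
     ring_hom_ring (VH n) (GraphEnd n) k \<and>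
     (\<forall>c. \<forall>X\<in>carrier (VH n). k (VH_scale n c X) = GraphCat_scale n n c (k X)) \<and>
     (\<forall>i\<in>{1..<n}.
        k (VH_proj n (P_elt n i)) = graph_class n n (Poly_Mapping.single (double_Y n i) 1) \<and>
        k (VH_proj n (braid_elt n [(Virt, i)])) =
          graph_class n n (Poly_Mapping.single (virtual_crossing n i) 1))"

end

theory Submission
  imports Defs
begin

text \<open>Every reduction lowers the number of edges, so uniqueness of the evaluation is a diamond
  lemma. Reductions at disjoint vertices commute. In a trivalent graph two overlapping ones are a bigon on
  a side of a quadrilateral, which works because \<open>(A\<^sup>3 + A\<^sup>-\<^sup>3)\<^sup>2 = (A\<^sup>6 + 1 + A\<^sup>-\<^sup>6) + 1\<close>, or two
  quadrilaterals with one common source and one common sink, or with two common sources or two common sinks.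
  In the last three cases the results agree only up to isomorphism, which is
  enough because every derivation of a value can be transported along an isomorphism.

  Closing a graph preserves the reduction relations, hence the trace factors through the graph category, and
  it is symmetric because the closures of \<open>FG\<close> and \<open>GF\<close> are isomorphic. The braid relation for
  \<open>A\<^sup>2 - A\<^sup>-\<^sup>1 P\<^sub>i\<close> reduces to \<open>P\<^sub>i P\<^sub>i\<^sub>+\<^sub>1 P\<^sub>i - P\<^sub>i = P\<^sub>i\<^sub>+\<^sub>1 P\<^sub>i P\<^sub>i\<^sub>+\<^sub>1 - P\<^sub>i\<^sub>+\<^sub>1\<close>: resolving the
  quadrilateral on the left leaves the graph with one sink for the three lower and one source for the three
  upper ends, which does not see the difference between \<open>i\<close> and \<open>i + 1\<close>. Finally, expanding the product of the letters of
  a braid word gives the sum over the states of its closure, each closed composite being the state graph with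
  the crossing ends smoothed.\<close>


section \<open>Linear maps between free modules over the Laurent polynomials\<close>

text \<open>\<open>web_eval\<close> is a definite description, so comparing two reductions of a
  graph requires unique values of the results before uniqueness is proved. The locale
  \<open>unique_below\<close> supplies it for fewer edges and turns every peak into an equation
  between values. Marked points shape the case analysis: a resolved bigon or quadrilateral leaves
  its vertices behind as points, smoothing is itself a reduction that competes with the others, and
  gluing by an extra edge has to be matched with gluing by identification. Composition uses explicit
  node names, so unit and associativity laws hold for classes only, through renamings and
  smoothings. Products of generators are computed in a form where every lower strand has an explicit
  target, so that composing is substitution. With a = A^2, b = -A^-1 and d = A^3 + A^-3 the equation
  a^2 b + a b^2 d + b^3 = 0 cancels exactly those terms of the braid relation that are not symmetric
  in the two generators.\<close>

lemma lookup_lscale [simp]: "Poly_Mapping.lookup (lscale c x) a = c * Poly_Mapping.lookup x a"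
  unfolding lscale_def by (simp add: Poly_Mapping.map.rep_eq when_def)

lemma lscale_add_right: "lscale c (x + y) = lscale c x + lscale c y"
  by (rule poly_mapping_eqI) (simp add: lookup_add algebra_simps)

lemma lscale_add_left: "lscale (c + d) x = lscale c x + lscale d x"
  by (rule poly_mapping_eqI) (simp add: lookup_add algebra_simps)

lemma lscale_diff_right: "lscale c (x - y) = lscale c x - lscale c y"
  by (rule poly_mapping_eqI) (simp add: lookup_minus algebra_simps)

lemma lscale_minus_left: "lscale (- c) x = - lscale c x"
  by (rule poly_mapping_eqI) simp

lemma lscale_lscale [simp]: "lscale c (lscale d x) = lscale (c * d) x"
  by (rule poly_mapping_eqI) (simp add: algebra_simps)

lemma lscale_1 [simp]: "lscale 1 x = x"
  by (rule poly_mapping_eqI) simp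

lemma lscale_0_right [simp]: "lscale c 0 = 0"
  by (rule poly_mapping_eqI) simp

lemma lscale_0_left [simp]: "lscale 0 x = 0"
  by (rule poly_mapping_eqI) simp

lemma lscale_single [simp]: "lscale c (Poly_Mapping.single a d) = Poly_Mapping.single a (c * d)"
  by (rule poly_mapping_eqI) (simp add: lookup_single when_def)

lemma keys_lscale: "Poly_Mapping.keys (lscale c x) \<subseteq> Poly_Mapping.keys x"
  by (auto simp: in_keys_iff)

text \<open>Identifies scalars with constant polynomials, so that in \<M> the coefficients of the
  reduction relations become factors in a commutative ring.\<close>

lemma lscale_conv_mult:
  "lscale c (x :: 'a::comm_monoid_add \<Rightarrow>\<^sub>0 laurent) = Poly_Mapping.single 0 c * x"
  unfolding lscale_def by (rule mult_map_scale_conv_mult)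

definition laurent_linear :: "(('a \<Rightarrow>\<^sub>0 laurent) \<Rightarrow> ('b \<Rightarrow>\<^sub>0 laurent)) \<Rightarrow> bool" where
  "laurent_linear F \<longleftrightarrow> (\<forall>x y. F (x + y) = F x + F y) \<and> (\<forall>c x. F (lscale c x) = lscale c (F x))"

lemma laurent_linearI:
  "(\<And>x y. F (x + y) = F x + F y) \<Longrightarrow> (\<And>c x. F (lscale c x) = lscale c (F x)) \<Longrightarrow> laurent_linear F"
  unfolding laurent_linear_def by blast

lemma laurent_linear_add: "laurent_linear F \<Longrightarrow> F (x + y) = F x + F y"
  and laurent_linear_scale: "laurent_linear F \<Longrightarrow> F (lscale c x) = lscale c (F x)"
  unfolding laurent_linear_def by blast+

lemma laurent_linear_0:
  assumes "laurent_linear F" shows "F 0 = 0"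
  using laurent_linear_scale[OF assms, of 0 0] by simp

lemma laurent_linear_minus:
  assumes "laurent_linear F" shows "F (- x) = - F x"
  using laurent_linear_scale[OF assms, of "-1" x] by (simp add: lscale_minus_left)

lemma laurent_linear_diff:
  assumes "laurent_linear F" shows "F (x - y) = F x - F y"
  using laurent_linear_add[OF assms, of x "- y"] laurent_linear_minus[OF assms, of y] by simp

lemma laurent_linear_sum:
  assumes "laurent_linear F" shows "F (sum f S) = (\<Sum>s\<in>S. F (f s))"
  by (induction S rule: infinite_finite_induct)
     (simp_all add: laurent_linear_0[OF assms] laurent_linear_add[OF assms])

lemma laurent_linear_id: "laurent_linear (\<lambda>x. x)"
  unfolding laurent_linear_def by simp

lemma laurent_linear_diff_fun:
  "laurent_linear F \<Longrightarrow> laurent_linear H \<Longrightarrow> laurent_linear (\<lambda>x. F x - H x)"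
  unfolding laurent_linear_def by (simp add: lscale_diff_right)

lemma lscale_sum: "lscale c (sum f S) = (\<Sum>s\<in>S. lscale c (f s))"
  by (rule laurent_linear_sum) (simp add: laurent_linear_def lscale_add_right mult.commute)

lemma lin_ext_superset:
  assumes "finite S" "Poly_Mapping.keys x \<subseteq> S"
  shows "lin_ext g x = (\<Sum>a\<in>S. lscale (Poly_Mapping.lookup x a) (g a))"
  unfolding lin_ext_def by (rule sum.mono_neutral_left) (use assms in \<open>auto simp: in_keys_iff\<close>)

lemma laurent_linear_lin_ext: "laurent_linear (lin_ext g)"
proof (rule laurent_linearI)
  fix x y :: "'a \<Rightarrow>\<^sub>0 laurent" and c
  let ?S = "Poly_Mapping.keys x \<union> Poly_Mapping.keys y"
  have "Poly_Mapping.keys (x + y) \<subseteq> ?S" by (rule keys_add)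
  then show "lin_ext g (x + y) = lin_ext g x + lin_ext g y"
    by (simp add: lin_ext_superset[of ?S] lookup_add lscale_add_left sum.distrib)
  show "lin_ext g (lscale c x) = lscale c (lin_ext g x)"
    using lin_ext_superset[OF finite_keys keys_lscale[of c x], where g = g]
    by (simp add: lin_ext_def lscale_sum)
qed

lemma lin_ext_add: "lin_ext g (x + y) = lin_ext g x + lin_ext g y"
  and lin_ext_diff: "lin_ext g (x - y) = lin_ext g x - lin_ext g y"
  and lin_ext_lscale: "lin_ext g (lscale c x) = lscale c (lin_ext g x)"
  and lin_ext_0 [simp]: "lin_ext g 0 = 0"
  and lin_ext_sum: "lin_ext g (sum f S) = (\<Sum>s\<in>S. lin_ext g (f s))"
  using laurent_linear_lin_ext[of g]
  by (auto simp: laurent_linear_add laurent_linear_diff laurent_linear_scale laurent_linear_0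
      laurent_linear_sum)

lemma lin_ext_single [simp]: "lin_ext g (Poly_Mapping.single a c) = lscale c (g a)"
  by (cases "c = 0") (simp_all add: lin_ext_def)

lemma lin_ext_fun_add: "lin_ext (\<lambda>a. g a + h a) x = lin_ext g x + lin_ext h x"
  by (simp add: lin_ext_def lscale_add_right sum.distrib)

lemma lin_ext_fun_lscale: "lin_ext (\<lambda>a. lscale c (g a)) x = lscale c (lin_ext g x)"
  by (simp add: lin_ext_def lscale_sum mult.commute)

lemma lin_ext_cong: "(\<And>a. a \<in> Poly_Mapping.keys x \<Longrightarrow> g a = h a) \<Longrightarrow> lin_ext g x = lin_ext h x"
  unfolding lin_ext_def by simp

lemma lin_ext_single_id: "lin_ext (\<lambda>a. Poly_Mapping.single a 1) x = x"
proof (rule poly_mapping_eqI)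
  fix k
  show "Poly_Mapping.lookup (lin_ext (\<lambda>a. Poly_Mapping.single a 1) x) k = Poly_Mapping.lookup x k"
    unfolding lin_ext_def
    by (cases "k \<in> Poly_Mapping.keys x")
       (auto simp: lookup_sum lookup_single when_def in_keys_iff if_distrib cong: if_cong)
qed

lemma laurent_linear_expand:
  assumes "laurent_linear F"
  shows "F x = lin_ext (\<lambda>a. F (Poly_Mapping.single a 1)) x"
proof -
  have "F x = F (lin_ext (\<lambda>a. Poly_Mapping.single a 1) x)"
    by (simp only: lin_ext_single_id)
  also have "\<dots> = lin_ext (\<lambda>a. F (Poly_Mapping.single a 1)) x"
    unfolding lin_ext_def
    by (simp only: laurent_linear_sum[OF assms] laurent_linear_scale[OF assms])
  finally show ?thesis .
qed

text \<open>Reduces every later identity between multilinear expressions to basis elements, one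
  argument at a time. The hypothesis is restricted to the keys of \<open>x\<close> because openness
  of graphs and membership in \<open>VB n\<close> are known only there.\<close>

lemma laurent_linear_eq:
  assumes "laurent_linear F" "laurent_linear H"
    and "\<And>a. a \<in> Poly_Mapping.keys x \<Longrightarrow> F (Poly_Mapping.single a 1) = H (Poly_Mapping.single a 1)"
  shows "F x = H x"
  using laurent_linear_expand[OF assms(1), of x] laurent_linear_expand[OF assms(2), of x]
    lin_ext_cong[OF assms(3)] by simp

lemma lin_ext_lin_ext: "lin_ext g (lin_ext h x) = lin_ext (\<lambda>a. lin_ext g (h a)) x"
  unfolding lin_ext_def[of h x] lin_ext_def[of "\<lambda>a. lin_ext g (h a)" x]
  by (simp add: lin_ext_sum lin_ext_lscale)

lemma keys_lin_ext:
  "Poly_Mapping.keys (lin_ext g x) \<subseteq> (\<Union>a\<in>Poly_Mapping.keys x. Poly_Mapping.keys (g a))"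
  unfolding lin_ext_def
  by (rule order_trans[OF keys_sum]) (intro UN_mono order_refl keys_lscale)

lemma laurent_linear_in_submodule:
  assumes F: "laurent_linear F" and "0 \<in> S"
    and add: "\<And>u v. u \<in> S \<Longrightarrow> v \<in> S \<Longrightarrow> u + v \<in> S"
    and scale: "\<And>c u. u \<in> S \<Longrightarrow> lscale c u \<in> S"
    and gen: "\<And>a. a \<in> Poly_Mapping.keys x \<Longrightarrow> F (Poly_Mapping.single a 1) \<in> S"
  shows "F x \<in> S"
proof -
  have "sum f A \<in> S" if "\<And>a. a \<in> A \<Longrightarrow> f a \<in> S" for f and A :: "'a set"
    using that by (induction A rule: infinite_finite_induct) (auto intro: add \<open>0 \<in> S\<close>)
  then show ?thesis
    unfolding laurent_linear_expand[OF F, of x] lin_ext_def by (simp add: gen scale)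
qed

section \<open>Bilinear extensions\<close>

lemma bilin_ext_lin_ext:
  "bilin_ext m x y = lin_ext (\<lambda>a. lin_ext (\<lambda>b. Poly_Mapping.single (m a b) 1) y) x"
  unfolding bilin_ext_def lin_ext_def
  by (simp add: lscale_sum)

lemma laurent_linear_bilin_ext_left: "laurent_linear (\<lambda>x. bilin_ext m x y)"
  unfolding bilin_ext_lin_ext by (rule laurent_linear_lin_ext)

lemma laurent_linear_bilin_ext_right: "laurent_linear (\<lambda>y. bilin_ext m x y)"
proof (rule laurent_linearI)
  fix y z :: "'a \<Rightarrow>\<^sub>0 laurent" and c
  show "bilin_ext m x (y + z) = bilin_ext m x y + bilin_ext m x z"
    unfolding bilin_ext_lin_ext
    by (simp add: lin_ext_add lin_ext_fun_add)
  show "bilin_ext m x (lscale c y) = lscale c (bilin_ext m x y)"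
    unfolding bilin_ext_lin_ext
    by (simp add: lin_ext_lscale lin_ext_fun_lscale)
qed

lemma bilin_ext_single [simp]:
  "bilin_ext m (Poly_Mapping.single a c) (Poly_Mapping.single b d) = Poly_Mapping.single (m a b) (c * d)"
  unfolding bilin_ext_lin_ext by simp

lemma bilin_ext_add_left: "bilin_ext m (x + y) z = bilin_ext m x z + bilin_ext m y z"
  and bilin_ext_diff_left: "bilin_ext m (x - y) z = bilin_ext m x z - bilin_ext m y z"
  and bilin_ext_lscale_left: "bilin_ext m (lscale c x) z = lscale c (bilin_ext m x z)"
  and bilin_ext_0_left [simp]: "bilin_ext m 0 z = 0"
  using laurent_linear_add[OF laurent_linear_bilin_ext_left[of m z]]
    laurent_linear_diff[OF laurent_linear_bilin_ext_left[of m z]]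
    laurent_linear_scale[OF laurent_linear_bilin_ext_left[of m z]]
    laurent_linear_0[OF laurent_linear_bilin_ext_left[of m z]] by auto

lemma bilin_ext_add_right: "bilin_ext m z (x + y) = bilin_ext m z x + bilin_ext m z y"
  and bilin_ext_diff_right: "bilin_ext m z (x - y) = bilin_ext m z x - bilin_ext m z y"
  and bilin_ext_lscale_right: "bilin_ext m z (lscale c x) = lscale c (bilin_ext m z x)"
  and bilin_ext_0_right [simp]: "bilin_ext m z 0 = 0"
  using laurent_linear_add[OF laurent_linear_bilin_ext_right[of m z]]
    laurent_linear_diff[OF laurent_linear_bilin_ext_right[of m z]]
    laurent_linear_scale[OF laurent_linear_bilin_ext_right[of m z]]
    laurent_linear_0[OF laurent_linear_bilin_ext_right[of m z]] by auto

lemma keys_bilin_ext: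
  "Poly_Mapping.keys (bilin_ext m x y) \<subseteq> (\<Union>a\<in>Poly_Mapping.keys x. \<Union>b\<in>Poly_Mapping.keys y. {m a b})"
  unfolding bilin_ext_lin_ext
  by (intro order_trans[OF keys_lin_ext] UN_mono order_refl) simp

lemma bilin_ext_sum_right: "bilin_ext m x (sum f S) = (\<Sum>s\<in>S. bilin_ext m x (f s))"
  by (rule laurent_linear_sum[OF laurent_linear_bilin_ext_right])

lemma Apow_mult: "Apow i * Apow j = Apow (i + j)"
  unfolding Apow_def by (simp add: mult_single)

lemma Apow_0: "Apow 0 = 1"
  unfolding Apow_def by simp


section \<open>Renaming, degrees and local relations\<close>

lemma nodes_simps [simp]:
  "nodes {#} = {}" "nodes (G + H) = nodes G \<union> nodes H"
  "nodes (add_mset e G) = {fst e, snd e} \<union> nodes G"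
  unfolding nodes_def by auto

lemma finite_nodes [simp]: "finite (nodes G)"
  unfolding nodes_def by simp

lemma rename_simps [simp]:
  "rename \<phi> {#} = {#}" "rename \<phi> (G + H) = rename \<phi> G + rename \<phi> H"
  "rename \<phi> (add_mset e G) = add_mset (\<phi> (fst e), \<phi> (snd e)) (rename \<phi> G)"
  by (auto simp: rename_def map_prod_def split: prod.splits)

lemma rename_image_mset [simp]:
  "rename \<phi> (image_mset f M) = image_mset (\<lambda>x. (\<phi> (fst (f x)), \<phi> (snd (f x)))) M"
  unfolding rename_def by (simp add: multiset.map_comp comp_def map_prod_def case_prod_unfold)

lemma size_rename [simp]: "size (rename \<phi> G) = size G"
  unfolding rename_def by simp

lemma nodes_rename [simp]: "nodes (rename \<phi> G) = \<phi> ` nodes G"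
  unfolding nodes_def rename_def by (force simp: image_iff)

lemma rename_rename: "rename \<phi> (rename \<psi> G) = rename (\<lambda>v. \<phi> (\<psi> v)) G"
  by (induction G) auto

lemma rename_cong: "(\<And>v. v \<in> nodes G \<Longrightarrow> \<phi> v = \<psi> v) \<Longrightarrow> rename \<phi> G = rename \<psi> G"
  by (induction G) auto

lemma rename_ident: "(\<And>v. v \<in> nodes G \<Longrightarrow> \<phi> v = v) \<Longrightarrow> rename \<phi> G = G"
  by (induction G) auto

lemma outdeg_rename: "outdeg (rename \<phi> G) u = size (filter_mset (\<lambda>e. \<phi> (fst e) = u) G)"
  and indeg_rename: "indeg (rename \<phi> G) u = size (filter_mset (\<lambda>e. \<phi> (snd e) = u) G)"
  unfolding outdeg_def indeg_def rename_def
  by (simp_all add: filter_mset_image_mset comp_def map_prod_def case_prod_unfold)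

text \<open>Injectivity at the single node \<open>v\<close>. Renamings such as
  \<open>identify_ends\<close> merge other nodes, and the degrees at \<open>v\<close> survive
  that.\<close>

definition isolates :: "('v \<Rightarrow> 'w) \<Rightarrow> 'v dgraph \<Rightarrow> 'v \<Rightarrow> bool" where
  "isolates \<phi> G v \<longleftrightarrow> (\<forall>v'\<in>nodes G. \<phi> v' = \<phi> v \<longrightarrow> v' = v)"

lemma deg_rename:
  assumes "isolates \<phi> G v"
  shows "outdeg (rename \<phi> G) (\<phi> v) = outdeg G v" "indeg (rename \<phi> G) (\<phi> v) = indeg G v"
proof -
  have "\<phi> (fst e) = \<phi> v \<longleftrightarrow> fst e = v" "\<phi> (snd e) = \<phi> v \<longleftrightarrow> snd e = v" if "e \<in># G" for e
    using assms that unfolding isolates_def nodes_def by auto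
  then show "outdeg (rename \<phi> G) (\<phi> v) = outdeg G v" "indeg (rename \<phi> G) (\<phi> v) = indeg G v"
    unfolding outdeg_rename indeg_rename unfolding outdeg_def indeg_def
    by (simp_all cong: filter_mset_cong)
qed

lemma isolates_inj: "inj_on \<phi> (nodes G) \<Longrightarrow> v \<in> nodes G \<Longrightarrow> isolates \<phi> G v"
  unfolding isolates_def inj_on_def by blast

lemma deg_notin_nodes: "v \<notin> nodes G \<Longrightarrow> outdeg G v = 0" "v \<notin> nodes G \<Longrightarrow> indeg G v = 0"
  by (auto simp: nodes_deg)

lemma edge_nodes: "(a, b) \<in># G \<Longrightarrow> a \<in> nodes G" "(a, b) \<in># G \<Longrightarrow> b \<in> nodes G"
  unfolding nodes_def by force+

definition trivalent_or_point :: "'v dgraph \<Rightarrow> 'v \<Rightarrow> bool" where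
  "trivalent_or_point G v \<longleftrightarrow> is_source G v \<or> is_sink G v \<or> is_point G v"

lemma trivalent_or_point_node: "trivalent_or_point G v \<Longrightarrow> v \<in> nodes G"
  unfolding trivalent_or_point_def is_source_def is_sink_def is_point_def nodes_deg by auto

lemmas trivalent_defs = trivalent_or_point_def is_source_def is_sink_def is_point_def

text \<open>The new edges run from sinks to sources, against the removed ones: a source keeps one
  outgoing edge and gains an incoming one, so it stays in the graph as a marked point. Nodes
  disappear only by \<open>smooth\<close> and \<open>circle\<close>, and these are points.\<close>

lemma local_rel_degrees:
  assumes "local_rel G x" "H \<in> Poly_Mapping.keys x"
  shows "v \<in> nodes H \<Longrightarrow> (outdeg H v = outdeg G v \<and> indeg H v = indeg G v) \<or>
           (is_point H v \<and> (is_source G v \<or> is_sink G v))"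
    and "v \<in> nodes G \<Longrightarrow> v \<notin> nodes H \<Longrightarrow> is_point G v"
    and "nodes H \<subseteq> nodes G"
    and "size H < size G"
proof -
  have "(v \<in> nodes H \<longrightarrow> (outdeg H v = outdeg G v \<and> indeg H v = indeg G v) \<or>
           (is_point H v \<and> (is_source G v \<or> is_sink G v))) \<and>
        (v \<in> nodes G \<longrightarrow> v \<notin> nodes H \<longrightarrow> is_point G v) \<and> nodes H \<subseteq> nodes G \<and> size H < size G"
    using assms
  proof cases
    case (smooth w G0 a b)
    then show ?thesis using assms(2)
      by (auto simp: is_point_def is_source_def is_sink_def outdeg_simps deg_notin_nodes)
  next
    case (circle w)
    then show ?thesis using assms(2)
      by (auto simp: is_point_def is_source_def is_sink_def outdeg_simps deg_notin_nodes split: if_splits)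
  next
    case (bigon G0 u v)
    then have "u \<noteq> v" by (auto simp: is_source_def is_sink_def)
    with bigon show ?thesis using assms(2)
      by (auto simp: is_point_def is_source_def is_sink_def outdeg_simps split: if_splits)
  next
    case (quadrilateral G0 v1 v2 v3 v4)
    have "H = G0 + {#(v2, v1), (v4, v3)#} \<or> H = G0 + {#(v2, v3), (v4, v1)#}"
      using subsetD[OF keys_add assms(2)[unfolded quadrilateral(1)]] by auto
    with quadrilateral(2-) show ?thesis
      by (elim disjE; simp add: is_point_def is_source_def is_sink_def outdeg_simps split: if_splits; auto)
  qed
  then show "v \<in> nodes H \<Longrightarrow> (outdeg H v = outdeg G v \<and> indeg H v = indeg G v) \<or>
           (is_point H v \<and> (is_source G v \<or> is_sink G v))"
    and "v \<in> nodes G \<Longrightarrow> v \<notin> nodes H \<Longrightarrow> is_point G v"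
    and "nodes H \<subseteq> nodes G"
    and "size H < size G" by blast+
qed

text \<open>Only the vertices whose degrees enter a local relation must stay separated; the other
  nodes may be identified with each other and with nodes of the context \<open>K\<close>.\<close>

lemma local_rel_rename:
  assumes "local_rel G x"
    and sep: "\<And>v. trivalent_or_point G v \<Longrightarrow> isolates \<phi> G v \<and> \<phi> v \<notin> nodes K"
  shows "local_rel (rename \<phi> G + K) (lin_ext (\<lambda>H. Poly_Mapping.single (rename \<phi> H + K) 1) x)"
proof -
  have deg: "outdeg (rename \<phi> G + K) (\<phi> v) = outdeg G v \<and> indeg (rename \<phi> G + K) (\<phi> v) = indeg G v"
    if "trivalent_or_point G v" for v
    using sep[OF that] by (simp add: outdeg_simps deg_rename deg_notin_nodes)
  have src: "is_source (rename \<phi> G + K) (\<phi> v)" if "is_source G v" for v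
    using deg[of v] that by (simp add: trivalent_defs)
  have snk: "is_sink (rename \<phi> G + K) (\<phi> v)" if "is_sink G v" for v
    using deg[of v] that by (simp add: trivalent_defs)
  from assms(1) show ?thesis
  proof cases
    case (smooth w G0 a b)
    have "trivalent_or_point G w"
      using smooth by (simp add: trivalent_defs outdeg_simps deg_notin_nodes)
    from sep[OF this] have "\<phi> w \<notin> nodes (rename \<phi> G0 + K)" "\<phi> w \<noteq> \<phi> a" "\<phi> w \<noteq> \<phi> b"
      using smooth unfolding isolates_def by force+
    from local_rel.smooth[OF this] show ?thesis
      using smooth by (simp add: ac_simps)
  next
    case (circle w G0)
    have "trivalent_or_point G w"
      using circle by (simp add: trivalent_defs outdeg_simps deg_notin_nodes)
    from sep[OF this] have "\<phi> w \<notin> nodes (rename \<phi> G0 + K)"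
      using circle unfolding isolates_def by force
    from local_rel.circle[OF this] show ?thesis
      using circle by (simp add: ac_simps)
  next
    case (bigon G0 u v)
    have "rename \<phi> G + K = (rename \<phi> G0 + K) + {#(\<phi> u, \<phi> v), (\<phi> u, \<phi> v)#}"
      using bigon by (simp add: ac_simps)
    from local_rel.bigon[OF this src snk] bigon show ?thesis
      by (simp add: ac_simps)
  next
    case (quadrilateral G0 v1 v2 v3 v4)
    have eq: "rename \<phi> G + K = (rename \<phi> G0 + K) +
        {#(\<phi> v1, \<phi> v2), (\<phi> v3, \<phi> v2), (\<phi> v3, \<phi> v4), (\<phi> v1, \<phi> v4)#}"
      using quadrilateral by (simp add: ac_simps)
    have "trivalent_or_point G v" if "v \<in> {v1, v2, v3, v4}" for v
      using that quadrilateral by (auto simp: trivalent_or_point_def)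
    then have "\<phi> v \<noteq> \<phi> v'" if "v \<in> {v1, v2, v3, v4}" "v' \<in> {v1, v2, v3, v4}" "v \<noteq> v'" for v v'
      using that sep trivalent_or_point_node unfolding isolates_def by metis
    with quadrilateral have "distinct [\<phi> v1, \<phi> v2, \<phi> v3, \<phi> v4]" by simp
    from local_rel.quadrilateral[OF eq this src snk src snk] quadrilateral show ?thesis
      by (simp add: lin_ext_add ac_simps)
  qed
qed

lemma local_rel_rename_inj:
  assumes "local_rel G x" "inj_on \<phi> (nodes G)"
  shows "local_rel (rename \<phi> G) (lin_ext (\<lambda>H. Poly_Mapping.single (rename \<phi> H) 1) x)"
  using local_rel_rename[OF assms(1), of \<phi> "{#}"] isolates_inj[OF assms(2) trivalent_or_point_node]
  by simp

section \<open>Invariance of the evaluation under isomorphisms\<close>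

lemma connected_graph_rename:
  assumes "connected_graph G" shows "connected_graph (rename \<phi> G)"
proof -
  let ?R = "\<lambda>G. set_mset G \<union> (set_mset G)\<inverse>"
  have "(\<phi> a, \<phi> b) \<in> (?R (rename \<phi> G))\<^sup>*" if "(a, b) \<in> (?R G)\<^sup>*" for a b
    using that
  proof (induction rule: rtrancl_induct)
    case (step y z)
    then have "(\<phi> y, \<phi> z) \<in> ?R (rename \<phi> G)" unfolding rename_def by force
    with step show ?case by (meson rtrancl.rtrancl_into_rtrancl)
  qed simp
  then show ?thesis using assms unfolding connected_graph_def by auto
qed

lemma has_bigon_rename:
  assumes "has_bigon G" "inj_on \<phi> (nodes G)" shows "has_bigon (rename \<phi> G)"
proof -
  obtain u v where uv: "u \<noteq> v" "count G (u, v) \<ge> 2"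
    using assms(1) unfolding has_bigon_def by blast
  then have "replicate_mset 2 (u, v) \<subseteq># G"
    by (simp add: count_le_replicate_mset_subset_eq)
  then have "replicate_mset 2 (\<phi> u, \<phi> v) \<subseteq># rename \<phi> G"
    unfolding rename_def by (metis image_mset_subseteq_mono image_replicate_mset map_prod_simp)
  moreover have "(u, v) \<in># G" using uv by (intro count_greater_zero_iff[THEN iffD1]) linarith
  then have "\<phi> u \<noteq> \<phi> v" using uv(1) assms(2) edge_nodes[of u v G] by (auto simp: inj_on_def)
  ultimately show ?thesis
    unfolding has_bigon_def by (metis count_le_replicate_mset_subset_eq)
qed

lemma has_quadrilateral_rename:
  assumes "has_quadrilateral G" "inj_on \<phi> (nodes G)" shows "has_quadrilateral (rename \<phi> G)"
proof -
  obtain v1 v2 v3 v4 where v: "distinct [v1, v2, v3, v4]"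
     "(v1, v2) \<in># G" "(v3, v2) \<in># G" "(v3, v4) \<in># G" "(v1, v4) \<in># G"
    using assms(1) unfolding has_quadrilateral_def by blast
  have e: "(\<phi> a, \<phi> b) \<in># rename \<phi> G" if "(a, b) \<in># G" for a b
    using that unfolding rename_def by force
  have "distinct [\<phi> v1, \<phi> v2, \<phi> v3, \<phi> v4]"
    using v edge_nodes[of _ _ G] assms(2) by (simp add: inj_on_eq_iff)
  then show ?thesis
    unfolding has_quadrilateral_def using e v by blast
qed

lemma rename_inv_into:
  assumes "inj_on \<phi> N" "nodes G \<subseteq> N"
  shows "rename (inv_into N \<phi>) (rename \<phi> G) = G"
  unfolding rename_rename by (rule rename_ident) (use assms in \<open>auto simp: inv_into_f_f\<close>)

lemma irreducible_web_rename:
  assumes "irreducible_web G" "inj_on \<phi> (nodes G)" shows "irreducible_web (rename \<phi> G)"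
proof -
  let ?\<psi> = "inv_into (nodes G) \<phi>"
  have inv: "rename ?\<psi> (rename \<phi> G) = G" using rename_inv_into[OF assms(2)] by simp
  have inj: "inj_on ?\<psi> (nodes (rename \<phi> G))" by (simp add: inj_on_inv_into)
  have "is_source (rename \<phi> G) v \<or> is_sink (rename \<phi> G) v" if v: "v \<in> nodes (rename \<phi> G)" for v
  proof -
    from v obtain u where u: "u \<in> nodes G" "v = \<phi> u" by auto
    with assms(1) have "is_source G u \<or> is_sink G u" unfolding irreducible_web_def by blast
    then show ?thesis
      using deg_rename[OF isolates_inj[OF assms(2) u(1)]] u(2) unfolding is_source_def is_sink_def by simp
  qed
  moreover have "rename \<phi> G \<noteq> {#}" using assms(1) unfolding irreducible_web_def rename_def by simp
  \<comment> \<open>A bigon or quadrilateral of the image would be carried back to \<open>G\<close>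
    by the inverse renaming.\<close>
  moreover have "\<not> has_bigon (rename \<phi> G)" "\<not> has_quadrilateral (rename \<phi> G)"
    using has_bigon_rename[OF _ inj] has_quadrilateral_rename[OF _ inj] assms(1)
    unfolding inv irreducible_web_def by auto
  ultimately show ?thesis
    using connected_graph_rename[of G \<phi>] assms(1) unfolding irreducible_web_def by simp
qed

lemma graph_iso_rename:
  assumes "inj_on \<phi> (nodes G)" shows "graph_iso (rename \<phi> G) H \<longleftrightarrow> graph_iso G H"
proof
  assume "graph_iso (rename \<phi> G) H"
  then obtain \<psi> where "inj_on \<psi> (\<phi> ` nodes G)" "H = rename \<psi> (rename \<phi> G)"
    unfolding graph_iso_def by auto
  then show "graph_iso G H"
    unfolding graph_iso_def rename_rename using comp_inj_on[OF assms, of \<psi>]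
    by (intro exI[of _ "\<psi> \<circ> \<phi>"]) (simp add: comp_def)
next
  let ?\<psi> = "inv_into (nodes G) \<phi>"
  assume "graph_iso G H"
  then obtain \<psi> where \<psi>: "inj_on \<psi> (nodes G)" "H = rename \<psi> G"
    unfolding graph_iso_def by auto
  have "H = rename (\<psi> \<circ> ?\<psi>) (rename \<phi> G)"
    unfolding rename_rename \<psi>(2) by (rule rename_cong) (simp add: inv_into_f_f[OF assms])
  moreover have "inj_on (\<psi> \<circ> ?\<psi>) (\<phi> ` nodes G)"
    using \<psi>(1) assms by (auto simp: inj_on_def)
  ultimately show "graph_iso (rename \<phi> G) H"
    unfolding graph_iso_def by auto
qed

lemma tvar_of_rename:
  assumes "inj_on \<phi> (nodes G)" shows "tvar_of (rename \<phi> G) = tvar_of G"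
proof -
  have "{H :: nat dgraph. graph_iso (rename \<phi> G) H} = {H. graph_iso G H}"
    using graph_iso_rename[OF assms] by blast
  then show ?thesis unfolding tvar_of_def by (rule arg_cong)
qed

lemma reduces_to_rename:
  assumes "reduces_to G p" "inj_on \<phi> (nodes G)"
  shows "reduces_to (rename \<phi> G) p"
  using assms
proof (induction rule: reduces_to.induct)
  case empty
  then show ?case by (simp add: reduces_to.empty)
next
  case (irreducible G H p)
  have inj: "inj_on \<phi> (nodes G)" "inj_on \<phi> (nodes H)"
    using irreducible.prems by (auto simp: inj_on_def)
  have "nodes (rename \<phi> G) \<inter> nodes (rename \<phi> H) = {}"
    using irreducible.prems irreducible.hyps(2) by (auto simp: inj_on_def)
  from reduces_to.irreducible[OF irreducible_web_rename[OF irreducible.hyps(1) inj(1)] this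
      irreducible.IH[OF inj(2)]]
  show ?case by (simp add: tvar_of_rename[OF inj(1)])
next
  case (relation G x g)
  let ?\<psi> = "inv_into (nodes G) \<phi>"
  let ?x = "lin_ext (\<lambda>H. Poly_Mapping.single (rename \<phi> H) 1) x"
  have inv: "rename ?\<psi> (rename \<phi> H) = H" if "H \<in> Poly_Mapping.keys x" for H
    using rename_inv_into[OF relation.prems] local_rel_degrees(3)[OF relation.hyps(1) that] .
  \<comment> \<open>The value of a renamed reduct is read off at its preimage, which the inverse
    renaming recovers because reducts only use nodes of \<open>G\<close>.\<close>
  have "reduces_to H' ((g \<circ> rename ?\<psi>) H')" if "H' \<in> Poly_Mapping.keys ?x" for H'
  proof -
    have "H' \<in> (\<Union>H\<in>Poly_Mapping.keys x. {rename \<phi> H})"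
      using subsetD[OF keys_lin_ext that] by simp
    then obtain H where H: "H \<in> Poly_Mapping.keys x" "H' = rename \<phi> H" by auto
    have "inj_on \<phi> (nodes H)"
      using relation.prems local_rel_degrees(3)[OF relation.hyps(1) H(1)] by (rule inj_on_subset)
    from relation.IH[OF H(1) this] show ?thesis by (simp add: H(2) inv[OF H(1)])
  qed
  from reduces_to.relation[OF local_rel_rename_inj[OF relation.hyps(1) relation.prems] this]
  have "reduces_to (rename \<phi> G) (lin_ext (g \<circ> rename ?\<psi>) ?x)" .
  also have "lin_ext (g \<circ> rename ?\<psi>) ?x = lin_ext g x"
    unfolding lin_ext_lin_ext by (rule lin_ext_cong) (simp add: inv)
  finally show ?case .
qed

text \<open>Both graphs derive the same values, so the definite descriptions agree whether or not a
  value exists uniquely. The lemma can therefore be used inside the confluence proof.\<close>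

lemma web_eval_rename:
  assumes "inj_on \<phi> (nodes G)" shows "web_eval (rename \<phi> G) = web_eval G"
proof -
  have "reduces_to (rename \<phi> G) p \<longleftrightarrow> reduces_to G p" for p
  proof
    assume "reduces_to (rename \<phi> G) p"
    from reduces_to_rename[OF this, of "inv_into (nodes G) \<phi>"] show "reduces_to G p"
      using rename_inv_into[OF assms] by (simp add: inj_on_inv_into)
  qed (rule reduces_to_rename[OF _ assms])
  then show ?thesis unfolding web_eval_def by presburger
qed

section \<open>Smoothing of marked points\<close>

text \<open>Iterated smoothing is kept apart from the evaluation because the same chains serve
  values of closed graphs, classes in \<open>GraphCat\<close> and state graphs.\<close>

inductive smooths :: "'v dgraph \<Rightarrow> 'v dgraph \<Rightarrow> bool" where
  smooths_refl: "smooths G G"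
| smooths_step: "\<lbrakk>w \<notin> nodes G; w \<noteq> a; w \<noteq> b; smooths (G + {#(a, b)#}) H\<rbrakk> \<Longrightarrow>
    smooths (G + {#(a, w), (w, b)#}) H"

lemma smooths_trans: "smooths G H \<Longrightarrow> smooths H K \<Longrightarrow> smooths G K"
proof (induction rule: smooths.induct)
  case (smooths_step w G a b H)
  then show ?case by (intro smooths.smooths_step) auto
qed

text \<open>The added edge makes the end \<open>p\<close> a marked point, and smoothing it redirects
  the edge into \<open>p\<close> to \<open>q\<close>. Thus gluing by an edge agrees with gluing by
  identification.\<close>

lemma smooths_glue_in:
  assumes "indeg G p = 1" "outdeg G p = 0" "p \<noteq> q"
  shows "smooths (G + {#(p, q)#}) (rename (id(p := q)) G)"
proof -
  have "p \<in> nodes G" using assms(1) by (simp add: nodes_deg)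
  then obtain a where "(a, p) \<in># G"
    using assms(2) unfolding nodes_def outdeg_def by force
  then obtain G0 where G: "G = add_mset (a, p) G0" by (meson mset_add)
  from assms have d: "indeg G0 p = 0" "outdeg G0 p = 0" "a \<noteq> p"
    unfolding G by (auto simp: outdeg_simps split: if_splits)
  then have p: "p \<notin> nodes G0" by (simp add: nodes_deg)
  then have "rename (id(p := q)) G0 = G0" by (intro rename_ident) auto
  then have "rename (id(p := q)) G = G0 + {#(a, q)#}" using d(3) unfolding G by simp
  with smooths_step[OF p, of a q, OF _ _ smooths_refl] d(3) assms(3) show ?thesis
    unfolding G by (simp add: add_mset_commute)
qed

lemma smooths_glue_out:
  assumes "outdeg G p = 1" "indeg G p = 0" "p \<noteq> q"
  shows "smooths (G + {#(q, p)#}) (rename (id(p := q)) G)"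
proof -
  have "p \<in> nodes G" using assms(1) by (simp add: nodes_deg)
  then obtain a where "(p, a) \<in># G"
    using assms(2) unfolding nodes_def indeg_def by force
  then obtain G0 where G: "G = add_mset (p, a) G0" by (meson mset_add)
  from assms have d: "indeg G0 p = 0" "outdeg G0 p = 0" "a \<noteq> p"
    unfolding G by (auto simp: outdeg_simps split: if_splits)
  then have p: "p \<notin> nodes G0" by (simp add: nodes_deg)
  then have "rename (id(p := q)) G0 = G0" by (intro rename_ident) auto
  then have "rename (id(p := q)) G = G0 + {#(q, a)#}" using d(3) unfolding G by simp
  with smooths_step[OF p, of q a, OF _ _ smooths_refl] d(3) assms(3) show ?thesis
    unfolding G by (simp add: add_mset_commute)
qed


section \<open>Confluence of the reduction relations\<close>

lemma out_edge: "outdeg G v \<noteq> 0 \<Longrightarrow> \<exists>b. (v, b) \<in># G"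
  and in_edge: "indeg G v \<noteq> 0 \<Longrightarrow> \<exists>a. (a, v) \<in># G"
  by (induction G) (auto simp: outdeg_simps split: if_splits)

section \<open>Closed webs and the reductions available on them\<close>

definition closed_web :: "'v dgraph \<Rightarrow> bool" where
  "closed_web G \<longleftrightarrow> (\<forall>v\<in>nodes G. trivalent_or_point G v)"

abbreviation bigon_value :: tpoly where
  "bigon_value \<equiv> Poly_Mapping.single 0 (Apow 3 + Apow (-3))"

abbreviation circle_value :: tpoly where
  "circle_value \<equiv> Poly_Mapping.single 0 (Apow 6 + 1 + Apow (-6))"

lemma bigon_value_square: "bigon_value * bigon_value = circle_value + 1"
proof -
  have "(Apow 3 + Apow (-3)) * (Apow 3 + Apow (-3)) = (Apow 6 + 1 + Apow (-6)) + 1"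
    by (simp add: algebra_simps Apow_mult Apow_0)
  then show ?thesis
    by (simp only: mult_single add_0_left flip: single_add single_one)
qed

text \<open>A nonzero coefficient keeps the reduced graph among the keys of the relation, so that a
  derivation really contains a value for it.\<close>

lemma circle_coeff_nonzero: "Apow 6 + 1 + Apow (-6) \<noteq> 0"
  and bigon_coeff_nonzero: "Apow 3 + Apow (-3) \<noteq> 0"
proof -
  have "Poly_Mapping.lookup (Apow 6 + 1 + Apow (-6)) 6 = 1"
    "Poly_Mapping.lookup (Apow 3 + Apow (-3)) 3 = 1"
    by (simp_all add: lookup_add Apow_def lookup_single lookup_one)
  then show "Apow 6 + 1 + Apow (-6) \<noteq> 0" "Apow 3 + Apow (-3) \<noteq> 0" by force+
qed

text \<open>All relations except \<open>smooth\<close>, in a uniform shape: the edges \<open>L\<close>, which lie between the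
  vertices \<open>V\<close>, are replaced by the edges \<open>R\<close> with coefficient \<open>c\<close>, for \<open>(c, R)\<close> in a list. Whether
  this is possible depends only on the degrees at \<open>V\<close>, so moves at disjoint sets commute.\<close>

inductive web_move ::
    "'v dgraph \<Rightarrow> 'v set \<Rightarrow> 'v dgraph \<Rightarrow> (tpoly \<times> 'v dgraph) list \<Rightarrow> bool" for H where
  circle_move: "is_point H w \<Longrightarrow> web_move H {w} {#(w, w)#} [(circle_value, {#})]"
| bigon_move: "\<lbrakk>is_source H u; is_sink H v\<rbrakk> \<Longrightarrow>
    web_move H {u, v} {#(u, v), (u, v)#} [(bigon_value, {#(v, u)#})]"
| quadrilateral_move: "\<lbrakk>distinct [v1, v2, v3, v4]; is_source H v1; is_sink H v2; is_source H v3; is_sink H v4\<rbrakk> \<Longrightarrow>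
    web_move H {v1, v2, v3, v4} {#(v1, v2), (v3, v2), (v3, v4), (v1, v4)#}
      [(1, {#(v2, v1), (v4, v3)#}), (1, {#(v2, v3), (v4, v1)#})]"
| component_move: "\<lbrakk>irreducible_web L; \<forall>v\<in>nodes L. outdeg H v = outdeg L v \<and> indeg H v = indeg L v\<rbrakk> \<Longrightarrow>
    web_move H (nodes L) L [(tvar_of L, {#})]"

definition move_value :: "'v dgraph \<Rightarrow> (tpoly \<times> 'v dgraph) list \<Rightarrow> tpoly" where
  "move_value G Rs = (\<Sum>(c, R)\<leftarrow>Rs. c * web_eval (G + R))"

lemma web_move_nodes:
  assumes "web_move H V L Rs"
  shows "nodes L \<subseteq> V" "(c, R) \<in> set Rs \<Longrightarrow> nodes R \<subseteq> V" "(c, R) \<in> set Rs \<Longrightarrow> size R < size L"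
  using assms by (auto elim!: web_move.cases simp: irreducible_web_def nonempty_has_size[symmetric])

lemma web_move_degrees:
  assumes "web_move H V L Rs" "\<And>v. v \<in> V \<Longrightarrow> outdeg H' v = outdeg H v \<and> indeg H' v = indeg H v"
  shows "web_move H' V L Rs"
  using assms(1)
proof cases
  case (circle_move w)
  then show ?thesis using web_move.circle_move[of H' w] assms(2) by (simp add: is_point_def)
next
  case (bigon_move u v)
  then show ?thesis using web_move.bigon_move[of H' u v] assms(2)
    by (simp add: is_source_def is_sink_def)
next
  case (quadrilateral_move v1 v2 v3 v4)
  then show ?thesis using web_move.quadrilateral_move[of v1 v2 v3 v4 H'] assms(2)
    by (simp add: is_source_def is_sink_def)
next
  case component_move
  then show ?thesis using web_move.component_move[of L H'] assms(2) by simp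
qed

text \<open>Equal degrees in \<open>L\<close> and in the whole graph leave no edge of
  \<open>G\<close> at a node of \<open>L\<close>, so \<open>L\<close> is a union of
  components.\<close>

lemma component_disjoint:
  assumes "\<forall>v\<in>nodes L. outdeg (G + L) v = outdeg L v \<and> indeg (G + L) v = indeg L v"
  shows "nodes L \<inter> nodes G = {}"
  using assms by (auto simp: nodes_deg[of _ G] outdeg_simps)

lemma web_move_closed:
  assumes "web_move (G + L) V L Rs" "closed_web (G + L)" "(c, R) \<in> set Rs"
  shows "closed_web (G + R)"
  unfolding closed_web_def
proof
  fix v assume v: "v \<in> nodes (G + R)"
  have *: "trivalent_or_point (G + L) v" if "v \<in> nodes G"
    using assms(2) that unfolding closed_web_def by simp
  show "trivalent_or_point (G + R) v"
    using assms(1)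
  proof cases
    case (circle_move w)
    then have "w \<notin> nodes G" by (simp add: is_point_def outdeg_simps nodes_deg)
    with circle_move assms(3) v * show ?thesis by (auto simp: trivalent_defs outdeg_simps split: if_splits)
  next
    case (bigon_move a b)
    then have "a \<noteq> b" by (auto simp: is_source_def is_sink_def)
    with bigon_move assms(3) v * show ?thesis
      by (cases "v = a \<or> v = b") (auto simp: trivalent_defs outdeg_simps split: if_splits)
  next
    case (quadrilateral_move v1 v2 v3 v4)
    with assms(3) have R: "R = {#(v2, v1), (v4, v3)#} \<or> R = {#(v2, v3), (v4, v1)#}" by auto
    show ?thesis
    proof (cases "v \<in> {v1, v2, v3, v4}")
      case True
      with R quadrilateral_move have "is_point (G + R) v"
        by (elim disjE; simp add: is_point_def is_source_def is_sink_def outdeg_simps split: if_splits; auto)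
      then show ?thesis by (simp add: trivalent_or_point_def)
    next
      case False
      with R v have "v \<in> nodes G" by auto
      from *[OF this] R quadrilateral_move False show ?thesis
        by (elim disjE; simp add: trivalent_defs outdeg_simps split: if_splits)
    qed
  next
    case component_move
    have "v \<in> nodes G" using component_move assms(3) v by simp
    with component_disjoint[OF component_move(4)] have "v \<notin> nodes L" by blast
    with *[OF \<open>v \<in> nodes G\<close>] component_move assms(3) show ?thesis
      by (simp add: trivalent_defs outdeg_simps deg_notin_nodes)
  qed
qed

lemma lscale_tpoly: "lscale c (p :: tpoly) = Poly_Mapping.single 0 c * p"
  by (rule lscale_conv_mult)

lemma reduces_to_move:
  assumes "web_move (G + L) V L Rs"
    and "\<And>c R. (c, R) \<in> set Rs \<Longrightarrow> reduces_to (G + R) (g (G + R))"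
  shows "reduces_to (G + L) (\<Sum>(c, R)\<leftarrow>Rs. c * g (G + R))"
  using assms(1)
proof cases
  case (circle_move w)
  then have "w \<notin> nodes G" by (simp add: is_point_def outdeg_simps nodes_deg)
  from reduces_to.relation[OF local_rel.circle[OF this], of g] assms(2) circle_move
  show ?thesis by (simp add: lscale_tpoly circle_coeff_nonzero bigon_coeff_nonzero)
next
  case (bigon_move u v)
  from reduces_to.relation[OF local_rel.bigon[of "G + L" G u v], of g] assms(2) bigon_move
  show ?thesis by (simp add: lscale_tpoly circle_coeff_nonzero bigon_coeff_nonzero)
next
  case (quadrilateral_move v1 v2 v3 v4)
  let ?x = "Poly_Mapping.single (G + {#(v2, v1), (v4, v3)#}) 1 +
      Poly_Mapping.single (G + {#(v2, v3), (v4, v1)#}) (1 :: laurent)"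
  have "H = G + {#(v2, v1), (v4, v3)#} \<or> H = G + {#(v2, v3), (v4, v1)#}"
    if "H \<in> Poly_Mapping.keys ?x" for H
    using subsetD[OF keys_add that] by auto
  moreover have "reduces_to (G + {#(v2, v1), (v4, v3)#}) (g (G + {#(v2, v1), (v4, v3)#}))"
    "reduces_to (G + {#(v2, v3), (v4, v1)#}) (g (G + {#(v2, v3), (v4, v1)#}))"
    by (rule assms(2)[of 1]; simp add: quadrilateral_move)+
  ultimately have "reduces_to H (g H)" if "H \<in> Poly_Mapping.keys ?x" for H
    using that by blast
  from reduces_to.relation[OF local_rel.quadrilateral[of "G + L" G v1 v2 v3 v4] this] quadrilateral_move
  show ?thesis by (simp add: lin_ext_add)
next
  case component_move
  from reduces_to.irreducible[OF component_move(3) component_disjoint[OF component_move(4)], of "g G"]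
    assms(2) component_move
  show ?thesis by (simp add: add.commute)
qed

text \<open>Brings the last rule of a derivation into the shapes on which the analysis of peaks is
  based. Splitting off an irreducible component counts as a move that replaces its edges by
  nothing.\<close>

lemma reduces_to_first_step:
  assumes "reduces_to H p"
  obtains (empty) "H = {#}" "p = 1"
  | (move) G V L Rs g where "H = G + L" "web_move H V L Rs"
      "\<And>c R. (c, R) \<in> set Rs \<Longrightarrow> reduces_to (G + R) (g (G + R))"
      "p = (\<Sum>(c, R)\<leftarrow>Rs. c * g (G + R))"
  | (smooth) G a w b where "H = G + {#(a, w), (w, b)#}" "w \<notin> nodes G" "w \<noteq> a" "w \<noteq> b"
      "reduces_to (G + {#(a, b)#}) p"
  using assms
proof cases
  case empty
  then show ?thesis by (rule that(1))
next
  case (irreducible L G q)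
  show ?thesis
  proof (rule that(2)[of G L "nodes L" "[(tvar_of L, {#})]" "\<lambda>_. q"])
    have "outdeg (L + G) v = outdeg L v \<and> indeg (L + G) v = indeg L v" if "v \<in> nodes L" for v
      using irreducible that deg_notin_nodes[of v G] by (auto simp: outdeg_simps)
    then show "web_move H (nodes L) L [(tvar_of L, {#})]"
      using web_move.component_move[of L H] irreducible by simp
  qed (use irreducible in \<open>auto simp: add.commute\<close>)
next
  case (relation x g)
  from relation(2) show ?thesis
  proof cases
    case (smooth w G a b)
    then show ?thesis using relation by (intro that(3)[of G a w b]) auto
  next
    case (circle w G)
    then have "is_point H w" by (simp add: is_point_def outdeg_simps deg_notin_nodes)
    from web_move.circle_move[OF this] show ?thesis
      using circle relation by (intro that(2)[of G _ _ _ g]) (auto simp: lscale_tpoly circle_coeff_nonzero bigon_coeff_nonzero)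
  next
    case (bigon G u v)
    from web_move.bigon_move[OF bigon(3,4)] show ?thesis
      using bigon relation by (intro that(2)[of G _ _ _ g]) (auto simp: lscale_tpoly circle_coeff_nonzero bigon_coeff_nonzero)
  next
    case (quadrilateral G v1 v2 v3 v4)
    have "Poly_Mapping.keys x = {G + {#(v2, v1), (v4, v3)#}, G + {#(v2, v3), (v4, v1)#}}"
    proof (cases "G + {#(v2, v1), (v4, v3)#} = G + {#(v2, v3), (v4, v1)#}")
      case True
      \<comment> \<open>If the two glueings coincide, their coefficients add up to 2, which is
        nonzero, so the graph remains a key.\<close>
      have "(1 + 1 :: laurent) = 2" by simp
      moreover have "(2 :: laurent) \<noteq> 0" by simp
      ultimately show ?thesis unfolding quadrilateral(1) True by (simp add: single_add[symmetric])
    next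
      case False
      then show ?thesis unfolding quadrilateral(1)
        by (auto simp: in_keys_iff lookup_add lookup_single when_def set_eq_iff)
    qed
    then have "reduces_to (G + {#(v2, v1), (v4, v3)#}) (g (G + {#(v2, v1), (v4, v3)#}))"
      "reduces_to (G + {#(v2, v3), (v4, v1)#}) (g (G + {#(v2, v3), (v4, v1)#}))"
      using relation(3) by auto
    with web_move.quadrilateral_move[OF quadrilateral(3-)] show ?thesis
      using quadrilateral relation(1) by (intro that(2)[of G _ _ _ g]) (auto simp: lin_ext_add)
  qed
qed

lemma smooth_closed_web:
  assumes "w \<notin> nodes G" "w \<noteq> a" "w \<noteq> b"
  shows "closed_web (G + {#(a, w), (w, b)#}) \<longleftrightarrow> closed_web (G + {#(a, b)#})"
proof -
  let ?H = "G + {#(a, w), (w, b)#}" and ?K = "G + {#(a, b)#}"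
  have "trivalent_or_point ?H v \<longleftrightarrow> trivalent_or_point ?K v" if "v \<noteq> w" for v
    using that by (simp add: trivalent_defs outdeg_simps)
  moreover have "trivalent_or_point ?H w"
    using assms by (simp add: trivalent_defs outdeg_simps deg_notin_nodes)
  moreover have "nodes ?H = insert w (nodes ?K)" "w \<notin> nodes ?K" using assms by auto
  ultimately show ?thesis unfolding closed_web_def by (metis insert_iff)
qed

lemma smooths_closed_web: "smooths G H \<Longrightarrow> closed_web G \<longleftrightarrow> closed_web H"
  by (induction rule: smooths.induct) (simp_all only: smooth_closed_web not_False_eq_True)

text \<open>The basic tool for overlaps: the part of one configuration that has no edge in common
  with another one survives in the rest of the graph.\<close>

lemma disjoint_subset_mset:
  assumes "L \<subseteq># G + M" "set_mset L \<inter> set_mset M = {}" shows "L \<subseteq># G"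
proof (rule mset_subset_eqI)
  fix e
  show "count L e \<le> count G e"
  proof (cases "e \<in># L")
    case True
    then have "count M e = 0" using assms(2) by (auto simp: count_eq_zero_iff)
    then show ?thesis using mset_subset_eq_count[OF assms(1), of e] by simp
  qed (simp add: not_in_iff)
qed

lemma sum_list_swap:
  "(\<Sum>x\<leftarrow>xs. \<Sum>y\<leftarrow>ys. f x y) = (\<Sum>y\<leftarrow>ys. \<Sum>x\<leftarrow>xs. f x y :: 'b :: comm_monoid_add)"
  by (induction xs) (simp_all add: sum_list_addf)

text \<open>Progress: a point carries a loop, which is a circle, or can be smoothed. Without points
  all nodes are sources or sinks, and if there are neither bigons nor quadrilaterals, the component
  of any node is irreducible and can be split off.\<close>

lemma closed_web_obtain_step:
  fixes H :: "'v dgraph"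
  assumes "closed_web H" "H \<noteq> {#}"
  obtains (move) G V L Rs where "H = G + L" "web_move H V L Rs"
  | (smooth) G a w b where "H = G + {#(a, w), (w, b)#}" "w \<notin> nodes G" "w \<noteq> a" "w \<noteq> b"
proof (cases "\<exists>w. is_point H w")
  case True
  then obtain w where w: "is_point H w" by blast
  then obtain b where b: "(w, b) \<in># H" using out_edge[of H w] by (auto simp: is_point_def)
  then obtain G where G: "H = add_mset (w, b) G" by (meson mset_add)
  show ?thesis
  proof (cases "b = w")
    case True
    with G have "H = G + {#(w, w)#}" by simp
    from move[OF this web_move.circle_move[OF w]] show ?thesis .
  next
    case False
    with w G have d: "outdeg G w = 0" "indeg G w = 1" by (simp_all add: is_point_def outdeg_simps)
    then obtain a where "(a, w) \<in># G" using in_edge[of G w] by auto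
    then obtain G' where G': "G = add_mset (a, w) G'" by (meson mset_add)
    with d have "a \<noteq> w" "w \<notin> nodes G'" by (auto simp: nodes_deg outdeg_simps split: if_splits)
    with smooth[of G' a w b] G G' False show ?thesis by (simp add: add_mset_commute)
  qed
next
  case False
  then have st: "is_source H v \<or> is_sink H v" if "v \<in> nodes H" for v
    using assms(1) that unfolding closed_web_def trivalent_or_point_def by blast
  have src: "is_source H u" "is_sink H v" if "(u, v) \<in># H" for u v
  proof -
    have "outdeg H u \<noteq> 0" "indeg H v \<noteq> 0"
      using multi_member_split[OF that] by (auto simp: outdeg_simps)
    then show "is_source H u" "is_sink H v"
      using st[of u] st[of v] edge_nodes[OF that] by (auto simp: is_source_def is_sink_def)
  qed
  consider "has_bigon H" | "\<not> has_bigon H" "has_quadrilateral H" | "\<not> has_bigon H" "\<not> has_quadrilateral H" by blast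
  then show ?thesis
  proof cases
    case 1
    then obtain u v where uv: "u \<noteq> v" "count H (u, v) \<ge> 2" unfolding has_bigon_def by blast
    then have "replicate_mset 2 (u, v) \<subseteq># H" by (simp add: count_le_replicate_mset_subset_eq)
    then have "{#(u, v), (u, v)#} \<subseteq># H" by (simp add: numeral_2_eq_2)
    then have "H = (H - {#(u, v), (u, v)#}) + {#(u, v), (u, v)#}"
      by (rule subset_mset.diff_add[symmetric])
    moreover have "(u, v) \<in># H" using uv(2) by (intro count_greater_zero_iff[THEN iffD1]) linarith
    ultimately show ?thesis using move web_move.bigon_move[OF src] by blast
  next
    case 2
    then obtain v1 v2 v3 v4 where v: "distinct [v1, v2, v3, v4]"
     "(v1, v2) \<in># H" "(v3, v2) \<in># H" "(v3, v4) \<in># H" "(v1, v4) \<in># H"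
      unfolding has_quadrilateral_def by blast
    let ?L = "{#(v1, v2), (v3, v2), (v3, v4), (v1, v4)#}"
    have "?L \<subseteq># H"
      using v by (auto simp: insert_subset_eq_iff in_diff_count)
    then have "H = (H - ?L) + ?L" by (rule subset_mset.diff_add[symmetric])
    moreover have "web_move H {v1, v2, v3, v4} ?L
      [(1, {#(v2, v1), (v4, v3)#}), (1, {#(v2, v3), (v4, v1)#})]"
      using v(1) src(1)[OF v(2)] src(2)[OF v(2)] src(1)[OF v(4)] src(2)[OF v(4)]
      by (rule web_move.quadrilateral_move)
    ultimately show ?thesis using move by blast
  next
    case 3
    let ?R = "set_mset H \<union> (set_mset H)\<inverse>"
    obtain e where "e \<in># H" using assms(2) by blast
    then obtain r where r: "r \<in> nodes H" unfolding nodes_def by blast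
    define C where "C = {v. (r, v) \<in> ?R\<^sup>*}"
    have C: "u \<in> C \<longleftrightarrow> v \<in> C" if "(u, v) \<in># H" for u v
      using that unfolding C_def by (auto intro: rtrancl.rtrancl_into_rtrancl)
    define L where "L = filter_mset (\<lambda>e. fst e \<in> C) H"
    define G where "G = filter_mset (\<lambda>e. fst e \<notin> C) H"
    have H: "H = G + L" unfolding G_def L_def by (simp add: multiset_partition add.commute)
    have L: "nodes L \<subseteq> C" "nodes G \<inter> C = {}" using C unfolding L_def G_def nodes_def by auto
    have nL: "v \<in> nodes L" if "v \<in> C" "v \<in> nodes H" for v
      using that L H by auto
    have deg: "outdeg H v = outdeg L v \<and> indeg H v = indeg L v" if "v \<in> nodes L" for v
      using that L deg_notin_nodes[of v G] unfolding H by (auto simp: outdeg_simps)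
    have "r \<in> nodes L" using nL[OF _ r] by (simp add: C_def)
    \<comment> \<open>A path from \<open>r\<close> never leaves \<open>C\<close>, so all its edges
      belong to \<open>L\<close>; this is what makes \<open>L\<close> connected by itself.\<close>
    have reach: "(r, v) \<in> (set_mset L \<union> (set_mset L)\<inverse>)\<^sup>*" if "(r, v) \<in> ?R\<^sup>*" for v
      using that
    proof (induction rule: rtrancl_induct)
      case (step y z)
      then have "y \<in> C" unfolding C_def by simp
      with step have "(y, z) \<in> set_mset L \<union> (set_mset L)\<inverse>"
        unfolding L_def using C by auto
      with step show ?case by (meson rtrancl.rtrancl_into_rtrancl)
    qed simp
    have sym: "sym ((set_mset L \<union> (set_mset L)\<inverse>)\<^sup>*)" by (intro sym_rtrancl sym_Un_converse)
    have "(a, b) \<in> (set_mset L \<union> (set_mset L)\<inverse>)\<^sup>*" if "a \<in> nodes L" "b \<in> nodes L" for a b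
    proof -
      have "(r, a) \<in> ?R\<^sup>*" "(r, b) \<in> ?R\<^sup>*" using that L(1) unfolding C_def by blast+
      from symD[OF sym reach[OF this(1)]] reach[OF this(2)] show ?thesis by (rule rtrancl_trans)
    qed
    then have "connected_graph L" unfolding connected_graph_def by blast
    moreover have "count L e \<le> count H e" for e unfolding H by simp
    then have "\<not> has_bigon L" using 3(1) unfolding has_bigon_def by (meson order_trans)
    moreover have "\<not> has_quadrilateral L"
      using 3(2) unfolding has_quadrilateral_def L_def by fastforce
    moreover have "is_source L v \<or> is_sink L v" if "v \<in> nodes L" for v
      using st[of v] deg[OF that] that unfolding H by (simp add: is_source_def is_sink_def)
    moreover have "L \<noteq> {#}" using \<open>r \<in> nodes L\<close> by auto
    ultimately have "irreducible_web L" unfolding irreducible_web_def by blast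
    from move[OF H web_move.component_move[OF this]] deg show ?thesis by blast
  qed
qed


section \<open>Peaks of reductions at separate places and of two smoothings\<close>

lemma sum_list_pair_cong:
  "(\<And>c R. (c, R) \<in> set Rs \<Longrightarrow> f c R = g c R) \<Longrightarrow> (\<Sum>(c, R)\<leftarrow>Rs. f c R) = (\<Sum>(c, R)\<leftarrow>Rs. g c R)"
  by (induction Rs) auto

text \<open>Packages the induction hypothesis of \<open>reduces_to_ex1\<close>. One node type
  suffices, because no reduction introduces new nodes.\<close>

locale unique_below =
  fixes N :: nat
  assumes ex1: "\<And>H :: 'v dgraph. size H < N \<Longrightarrow> closed_web H \<Longrightarrow> \<exists>!p. reduces_to H p"
begin

lemma reduces_to_web_eval:
  fixes H :: "'v dgraph"
  shows "size H < N \<Longrightarrow> closed_web H \<Longrightarrow> reduces_to H (web_eval H)"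
  unfolding web_eval_def by (rule theI'[OF ex1])

lemma web_eval_eqI:
  fixes H :: "'v dgraph"
  shows "size H < N \<Longrightarrow> closed_web H \<Longrightarrow> reduces_to H p \<Longrightarrow> web_eval H = p"
  unfolding web_eval_def by (rule the1_equality[OF ex1])

lemma reduces_to_move_value:
  fixes G :: "'v dgraph"
  assumes "size (G + L) \<le> N" "closed_web (G + L)" "web_move (G + L) V L Rs"
  shows "reduces_to (G + L) (move_value G Rs)"
  unfolding move_value_def
proof (rule reduces_to_move[OF assms(3)])
  fix c R assume cR: "(c, R) \<in> set Rs"
  have "size (G + R) < N" using web_move_nodes(3)[OF assms(3) cR] assms(1) by simp
  with web_move_closed[OF assms(3,2) cR] show "reduces_to (G + R) (web_eval (G + R))"
    by (rule reduces_to_web_eval[rotated])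
qed

lemma web_eval_move:
  fixes G :: "'v dgraph"
  assumes "size (G + L) < N" "closed_web (G + L)" "web_move (G + L) V L Rs"
  shows "web_eval (G + L) = move_value G Rs"
  using web_eval_eqI[OF assms(1,2)] reduces_to_move_value[OF _ assms(2,3)] assms(1) by simp

lemma reduces_to_smooth:
  assumes "w \<notin> nodes G" "w \<noteq> a" "w \<noteq> b" "reduces_to (G + {#(a, b)#}) p"
  shows "reduces_to (G + {#(a, w), (w, b)#}) p"
  using reduces_to.relation[OF local_rel.smooth[OF assms(1-3)], of "\<lambda>_. p"] assms(4) by simp

lemma web_eval_smooths:
  fixes G :: "'v dgraph"
  assumes "smooths G H" "size G < N" "closed_web G"
  shows "web_eval G = web_eval H"
  using assms
proof (induction rule: smooths.induct)
  case (smooths_step w G a b H)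
  let ?H = "G + {#(a, w), (w, b)#}" and ?K = "G + {#(a, b)#}"
  have K: "size ?K < N" "closed_web ?K"
    using smooths_step.prems smooth_closed_web[OF smooths_step.hyps(1-3)] by auto
  have "web_eval ?H = web_eval ?K"
    by (rule web_eval_eqI[OF smooths_step.prems
          reduces_to_smooth[OF smooths_step.hyps(1-3) reduces_to_web_eval[OF K]]])
  with smooths_step.IH[OF K] show ?case by simp
qed simp

text \<open>Carrying out the second move on each result of the first expands both values to the same
  double sum.\<close>

lemma disjoint_moves:
  fixes H :: "'v dgraph"
  assumes H: "H = G1 + L1" "H = G2 + L2" "size H = N" "closed_web H"
    and m: "web_move H V1 L1 Rs1" "web_move H V2 L2 Rs2" "V1 \<inter> V2 = {}"
  shows "move_value G1 Rs1 = move_value G2 Rs2"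
proof -
  have "e \<notin># L2" if "e \<in># L1" for e
  proof -
    have "fst e \<in> V1" using that web_move_nodes(1)[OF m(1)] unfolding nodes_def by blast
    moreover have "fst e \<in> V2" if "e \<in># L2"
      using that web_move_nodes(1)[OF m(2)] unfolding nodes_def by blast
    ultimately show ?thesis using m(3) by blast
  qed
  then have "set_mset L1 \<inter> set_mset L2 = {}" by blast
  then have "L1 \<subseteq># G2" by (intro disjoint_subset_mset[of L1 G2 L2]) (simp_all add: H(2)[symmetric], simp add: H(1))
  from subset_mset.diff_add[OF this, symmetric] obtain G where G2: "G2 = G + L1" by blast
  with H have G1: "G1 = G + L2" by (simp add: add.assoc add.commute[of L1])
  \<comment> \<open>The first move leaves the degrees on the other, disjoint vertex set unchanged,
    so the second move is still available and computes the value of the smaller graph.\<close>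
  have ev: "web_eval (G + R + L') = move_value (G + R) Rs'"
    if m: "web_move H V L Rs" "web_move H V' L' Rs'" "V \<inter> V' = {}" and HG: "H = G + L + L'" and R: "(c, R) \<in> set Rs"
    for V V' L L' Rs Rs' c R
  proof (rule web_eval_move)
    have HG': "H = (G + L') + L" using HG by (simp add: ac_simps)
    have "closed_web ((G + L') + R)"
      using web_move_closed[of "G + L'" L] m(1) R H(4) unfolding HG'[symmetric] by blast
    then show "closed_web (G + R + L')" by (simp add: ac_simps)
    show "size (G + R + L') < N"
      using web_move_nodes(3)[OF m(1) R] H(3) unfolding HG by simp
    have "outdeg (G + R + L') v = outdeg H v \<and> indeg (G + R + L') v = indeg H v" if "v \<in> V'" for v
    proof -
      have "v \<notin> nodes L" "v \<notin> nodes R"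
        using web_move_nodes(1)[OF m(1)] web_move_nodes(2)[OF m(1) R] m(3) that by blast+
      then show ?thesis unfolding HG by (simp add: outdeg_simps deg_notin_nodes)
    qed
    then show "web_move (G + R + L') V' L' Rs'" by (rule web_move_degrees[OF m(2)])
  qed
  have "move_value G1 Rs1 = (\<Sum>(c, R)\<leftarrow>Rs1. c * move_value (G + R) Rs2)"
    unfolding G1 move_value_def[of "G + L2"]
  proof (rule sum_list_pair_cong)
    fix c R assume "(c, R) \<in> set Rs1"
    from ev[OF m _ this] H(2) show "c * web_eval (G + L2 + R) = c * move_value (G + R) Rs2"
      unfolding G2 by (simp add: ac_simps)
  qed
  also have "\<dots> = (\<Sum>x\<leftarrow>Rs1. \<Sum>y\<leftarrow>Rs2. fst x * (fst y * web_eval (G + snd x + snd y)))"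
    unfolding move_value_def by (simp add: case_prod_unfold sum_list_const_mult)
  also have "\<dots> = (\<Sum>y\<leftarrow>Rs2. \<Sum>x\<leftarrow>Rs1. fst y * (fst x * web_eval (G + snd y + snd x)))"
    by (subst sum_list_swap) (simp add: ac_simps)
  also have "\<dots> = (\<Sum>(c, R)\<leftarrow>Rs2. c * move_value (G + R) Rs1)"
    unfolding move_value_def by (simp add: case_prod_unfold sum_list_const_mult)
  also have "\<dots> = move_value G2 Rs2"
    unfolding G2 move_value_def[of "G + L1"]
  proof (rule sum_list_pair_cong)
    fix c R assume "(c, R) \<in> set Rs2"
    from ev[OF m(2,1) _ _ this] H(1) m(3) show "c * move_value (G + R) Rs1 = c * web_eval (G + L1 + R)"
      unfolding G1 by (simp add: ac_simps Int_commute)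
  qed
  finally show ?thesis .
qed

lemma smooth_commutes_move:
  fixes H :: "'v dgraph"
  assumes H: "H = G1 + {#(a, w), (w, b)#}" "H = G2 + L" "size H = N" "closed_web H"
    and w: "w \<notin> nodes G1" "w \<noteq> a" "w \<noteq> b" and m: "web_move H V L Rs"
  shows "web_eval (G1 + {#(a, b)#}) = move_value G2 Rs"
proof -
  have pt: "is_point H w" using w unfolding H(1) by (simp add: is_point_def outdeg_simps deg_notin_nodes)
  \<comment> \<open>Among the moves only \<open>circle_move\<close> takes place at a point, and its
    point carries a loop, which \<open>w\<close> does not.\<close>
  have wV: "w \<notin> V"
    using m
  proof cases
    case (circle_move u)
    have "(u, u) \<in># H" unfolding H(2) circle_move by simp
    then have "u \<noteq> w" using w unfolding H(1) by (auto dest: edge_nodes)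
    then show ?thesis using circle_move by simp
  next
    case component_move
    then show ?thesis using pt by (auto simp: irreducible_web_def is_source_def is_sink_def is_point_def)
  qed (use pt in \<open>auto simp: is_source_def is_sink_def is_point_def\<close>)
  then have wL: "w \<notin> nodes L" using web_move_nodes(1)[OF m] by blast
  then have "set_mset L \<inter> set_mset {#(a, w), (w, b)#} = {}" by (auto dest: edge_nodes)
  then have "L \<subseteq># G1" by (intro disjoint_subset_mset[of L G1]) (simp_all only: H(1)[symmetric], simp add: H(2))
  from subset_mset.diff_add[OF this, symmetric] obtain G where G1: "G1 = G + L" by blast
  with H have G2: "G2 = G + {#(a, w), (w, b)#}" by (simp add: ac_simps)
  have "closed_web (G1 + {#(a, b)#})"
    using smooth_closed_web[OF w] H(1,4) by simp
  moreover have "size (G1 + {#(a, b)#}) < N" using H(1,3) by auto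
  moreover have "web_move (G1 + {#(a, b)#}) V L Rs"
  proof (rule web_move_degrees[OF m])
    fix v assume "v \<in> V"
    with wV have "v \<noteq> w" by blast
    then show "outdeg (G1 + {#(a, b)#}) v = outdeg H v \<and> indeg (G1 + {#(a, b)#}) v = indeg H v"
      unfolding H(1) by (simp add: outdeg_simps)
  qed
  ultimately have "web_eval (G1 + {#(a, b)#}) = move_value (G + {#(a, b)#}) Rs"
    using web_eval_move[of "G + {#(a, b)#}" L V Rs] unfolding G1 by (simp add: ac_simps)
  also have "\<dots> = move_value G2 Rs"
    unfolding move_value_def
  proof (rule sum_list_pair_cong)
    fix c R assume cR: "(c, R) \<in> set Rs"
    have "w \<notin> nodes (G + R)" using w(1) G1 web_move_nodes(2)[OF m cR] wV by auto
    from smooths_step[OF this w(2,3) smooths_refl]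
    have "smooths (G2 + R) (G + {#(a, b)#} + R)" unfolding G2 by (simp add: ac_simps)
    moreover have "closed_web (G2 + R)"
      using web_move_closed[of G2 L V Rs c R] m cR H(2,4) by simp
    moreover have "size (G2 + R) < N" using web_move_nodes(3)[OF m cR] H(2,3) by auto
    ultimately show "c * web_eval (G + {#(a, b)#} + R) = c * web_eval (G2 + R)"
      using web_eval_smooths by simp
  qed
  finally show ?thesis .
qed

text \<open>Usually both orders end in the edge from \<open>a\<close> to \<open>b'\<close>. If
  \<open>a = u\<close>, the two points form a circle of length two; smoothing leaves a loop at
  \<open>u\<close> or at \<open>w\<close>, and these agree only up to renaming.\<close>

lemma smooths_commute_adjacent:
  fixes H :: "'v dgraph"
  assumes H: "H = G1 + {#(a, w), (w, u)#}" "H = G2 + {#(a', u), (u, b')#}" "size H = N" "closed_web H"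
    and w: "w \<notin> nodes G1" "w \<noteq> a" and u: "u \<notin> nodes G2" "u \<noteq> b'" "u \<noteq> a'" and "w \<noteq> u"
  shows "web_eval (G1 + {#(a, u)#}) = web_eval (G2 + {#(a', b')#})"
proof -
  have sz: "size (G1 + {#(a, u)#}) < N" "size (G2 + {#(a', b')#}) < N"
    unfolding H(3)[symmetric] by (simp add: H(1), simp add: H(2))
  have cl: "closed_web (G1 + {#(a, u)#})" "closed_web (G2 + {#(a', b')#})"
    using smooth_closed_web[of w G1 a u] smooth_closed_web[of u G2 a' b'] w u \<open>w \<noteq> u\<close> H(1,2,4) by auto
  have "(w, u) \<in># H" unfolding H(1) by simp
  then have a': "a' = w" using u \<open>w \<noteq> u\<close> unfolding H(2) by (auto dest: edge_nodes)
  show ?thesis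
  proof (cases "a = u")
    case True
    have "(u, w) \<in># H" unfolding H(1) True by simp
    then have b': "b' = w" using u \<open>w \<noteq> u\<close> unfolding H(2) a' by (auto dest: edge_nodes)
    have "G1 + {#(w, u), (u, w)#} = G2 + {#(w, u), (u, w)#}"
      using H(1,2) unfolding a' b' True by (simp add: add_mset_commute)
    then have G: "G1 = G2" by simp
    then have "rename (id(u := w)) G1 = G1" using u by (intro rename_ident) auto
    then have "rename (id(u := w)) (G1 + {#(u, u)#}) = G2 + {#(w, w)#}" by (simp add: G)
    moreover have "inj_on (id(u := w)) (nodes (G1 + {#(u, u)#}))"
      using w u G by (auto simp: inj_on_def)
    ultimately show ?thesis unfolding a' b' True 
      using web_eval_rename[of "id(u := w)" "G1 + {#(u, u)#}"] by simp
  next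
    case False
    have "(u, b') \<in># H" unfolding H(2) by simp
    then have "(u, b') \<in># G1" using False \<open>w \<noteq> u\<close> unfolding H(1) by auto
    then obtain G where G1: "G1 = G + {#(u, b')#}" by (auto dest!: multi_member_split)
    have "G2 + {#(w, u), (u, b')#} = (G + {#(a, w)#}) + {#(w, u), (u, b')#}"
      using H(1,2) unfolding G1 a' by (simp add: ac_simps)
    then have G2: "G2 = G + {#(a, w)#}" by simp
    have "u \<notin> nodes G" "w \<notin> nodes G" "w \<noteq> b'" using u w unfolding G1 G2 by auto
    then have "smooths (G + {#(a, u), (u, b')#}) (G + {#(a, b')#})"
      and "smooths (G + {#(a, w), (w, b')#}) (G + {#(a, b')#})"
      using False u(2) w(2) by (blast intro: smooths_step[OF _ _ _ smooths_refl])+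
    then show ?thesis
      using web_eval_smooths[OF _ sz(1) cl(1)] web_eval_smooths[OF _ sz(2) cl(2)]
      unfolding G1 G2 a' by (simp add: add_mset_commute)
  qed
qed

text \<open>Points that are not adjacent are smoothed independently of each other. Adjacent ones are
  covered by \<open>smooths_commute_adjacent\<close>, with either point in front.\<close>

lemma smooths_commute:
  fixes H :: "'v dgraph"
  assumes H: "H = G1 + {#(a, w), (w, b)#}" "H = G2 + {#(a', u), (u, b')#}" "size H = N" "closed_web H"
    and w: "w \<notin> nodes G1" "w \<noteq> a" "w \<noteq> b" and u: "u \<notin> nodes G2" "u \<noteq> a'" "u \<noteq> b'"
  shows "web_eval (G1 + {#(a, b)#}) = web_eval (G2 + {#(a', b')#})"
proof -
  have e: "(a, w) \<in># H" "(w, b) \<in># H" "(a', u) \<in># H" "(u, b') \<in># H" 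
    by (simp add: H(1), simp add: H(1), simp add: H(2), simp add: H(2))
  consider "w = u" | "w \<noteq> u" "b = u" | "w \<noteq> u" "b' = w" | "w \<noteq> u" "b \<noteq> u" "b' \<noteq> w" by blast
  then show ?thesis
  proof cases
    case 1
    have "(a, w) \<in># G2 + {#(a', u), (u, b')#}" "(w, b) \<in># G2 + {#(a', u), (u, b')#}"
      using e by (simp_all add: H(2))
    then have "a' = a" "b' = b" using u w 1 by (auto dest: edge_nodes)
    then show ?thesis using H(1,2) 1 by simp
  next
    case 2
    then show ?thesis using smooths_commute_adjacent[OF H(1)[unfolded 2] H(2-4)] w u by blast
  next
    case 3
    then show ?thesis
      using smooths_commute_adjacent[OF H(2)[unfolded 3] H(1,3,4)] w u by simp
  next
    case 4
    have "(a, w) \<in># G2 + {#(a', u), (u, b')#}" "(a', u) \<in># G1 + {#(a, w), (w, b)#}"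
      using e by (simp_all only: flip: H(1,2))
    then have "a' \<noteq> w" "a \<noteq> u" using u w 4 by (auto dest: edge_nodes)
    then have "(a', u) \<in># G1" "(u, b') \<in># G1" using e 4 unfolding H(1) by auto
    from multi_member_split[OF this(1)] obtain G0 where G0: "G1 = add_mset (a', u) G0" by blast
    with \<open>(u, b') \<in># G1\<close> u have "(u, b') \<in># G0" by simp
    with G0 obtain G where G1: "G1 = G + {#(a', u), (u, b')#}"
      by (auto dest!: multi_member_split)
    have "G2 + {#(a', u), (u, b')#} = (G + {#(a, w), (w, b)#}) + {#(a', u), (u, b')#}"
      using H(1,2) unfolding G1 by (simp add: ac_simps)
    then have G2: "G2 = G + {#(a, w), (w, b)#}" by simp
    have sz: "size (G1 + {#(a, b)#}) < N" "size (G2 + {#(a', b')#}) < N"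
      unfolding H(3)[symmetric] by (simp add: H(1), simp add: H(2))
    have cl: "closed_web (G1 + {#(a, b)#})" "closed_web (G2 + {#(a', b')#})"
      using smooth_closed_web[of w G1 a b] smooth_closed_web[of u G2 a' b'] w u H(1,2,4) by auto
    have "smooths ((G + {#(a, b)#}) + {#(a', u), (u, b')#}) ((G + {#(a, b)#}) + {#(a', b')#})"
      "smooths ((G + {#(a', b')#}) + {#(a, w), (w, b)#}) ((G + {#(a', b')#}) + {#(a, b)#})"
      by (rule smooths_step[OF _ _ _ smooths_refl]; use u w 4 \<open>a' \<noteq> w\<close> \<open>a \<noteq> u\<close> in \<open>auto simp: G1 G2\<close>)+
    then show ?thesis
      using web_eval_smooths[OF _ sz(1) cl(1)] web_eval_smooths[OF _ sz(2) cl(2)]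
      unfolding G1 G2 by (simp add: ac_simps)
  qed
qed

end


section \<open>Peaks of overlapping bigons, quadrilaterals and components\<close>

definition quadrilateral_at :: "'v dgraph \<Rightarrow> 'v dgraph \<Rightarrow> 'v \<Rightarrow> 'v \<Rightarrow> 'v \<Rightarrow> 'v \<Rightarrow> bool" where
  "quadrilateral_at H G a b c d \<longleftrightarrow> H = G + {#(a, b), (c, b), (c, d), (a, d)#} \<and> distinct [a, b, c, d] \<and>
     is_source H a \<and> is_sink H b \<and> is_source H c \<and> is_sink H d"

definition quadrilateral_value :: "'v dgraph \<Rightarrow> 'v \<Rightarrow> 'v \<Rightarrow> 'v \<Rightarrow> 'v \<Rightarrow> tpoly" where
  "quadrilateral_value G a b c d =
     web_eval (G + {#(b, a), (d, c)#}) + web_eval (G + {#(b, c), (d, a)#})"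

lemma quadrilateral_at_swap:
  "quadrilateral_at H G a b c d \<Longrightarrow> quadrilateral_at H G c b a d"
  "quadrilateral_at H G a b c d \<Longrightarrow> quadrilateral_at H G a d c b"
  unfolding quadrilateral_at_def by (auto simp: add_mset_commute)

lemma quadrilateral_value_swap:
  "quadrilateral_value G c b a d = quadrilateral_value G a b c d"
  "quadrilateral_value G a d c b = quadrilateral_value G a b c d"
  unfolding quadrilateral_value_def by (simp_all add: add_mset_commute add.commute)

text \<open>Every source of a quadrilateral is adjacent to both of its sinks, so a source and a sink
  shared by two quadrilaterals can be moved to the first two places of both.\<close>

lemma quadrilateral_arrange:
  assumes "quadrilateral_at H G a b c d" "s \<in> {a, c}" "t \<in> {b, d}"
  obtains c' d' where "quadrilateral_at H G s t c' d'"
    "quadrilateral_value G s t c' d' = quadrilateral_value G a b c d"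
proof -
  have "quadrilateral_at H G c d a b" "quadrilateral_value G c d a b = quadrilateral_value G a b c d"
    using quadrilateral_at_swap assms(1) quadrilateral_value_swap by metis+
  with assms that[of c d] that[of a d] that[of c b] that[of a b] show ?thesis
    using quadrilateral_at_swap[OF assms(1)] quadrilateral_value_swap[of G] by fastforce
qed

lemma quadrilateral_at_degrees:
  assumes "quadrilateral_at H G a b c d"
  shows "outdeg G a = 1" "indeg G a = 0" "outdeg G c = 1" "indeg G c = 0"
    "outdeg G b = 0" "indeg G b = 1" "outdeg G d = 0" "indeg G d = 1"
  using assms unfolding quadrilateral_at_def by (auto simp: is_source_def is_sink_def outdeg_simps)

lemma quadrilateral_at_move:
  "quadrilateral_at H G a b c d \<Longrightarrow> web_move H {a, b, c, d} {#(a, b), (c, b), (c, d), (a, d)#}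
      [(1, {#(b, a), (d, c)#}), (1, {#(b, c), (d, a)#})]"
  unfolding quadrilateral_at_def by (intro quadrilateral_move) auto

lemma quadrilateral_at_closed:
  assumes "quadrilateral_at H G a b c d" "closed_web H"
  shows "closed_web (G + {#(b, a), (d, c)#})" "closed_web (G + {#(b, c), (d, a)#})"
proof -
  have H: "H = G + {#(a, b), (c, b), (c, d), (a, d)#}" using assms(1) unfolding quadrilateral_at_def by simp
  note closed = web_move_closed[OF quadrilateral_at_move[OF assms(1), unfolded H] assms(2)[unfolded H]]
  show "closed_web (G + {#(b, a), (d, c)#})" "closed_web (G + {#(b, c), (d, a)#})"
    by (rule closed[of 1]; simp)+
qed

text \<open>Gluing at both ends of an edge leaves it between two points; results of moves and of
  compositions typically contain such paths.\<close>

lemma smooths_two: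
  assumes "w \<notin> nodes G" "u \<notin> nodes G" "w \<noteq> u" "a \<noteq> w" "a \<noteq> u" "b \<noteq> w" "b \<noteq> u"
  shows "smooths (G + {#(a, w), (w, u), (u, b)#}) (G + {#(a, b)#})"
proof -
  have "smooths ((G + {#(u, b)#}) + {#(a, w), (w, u)#}) (G + {#(a, b)#})"
  proof (rule smooths_step)
    have "smooths (G + {#(a, u), (u, b)#}) (G + {#(a, b)#})"
      by (rule smooths_step[OF _ _ _ smooths_refl]) (use assms in auto)
    then show "smooths (G + {#(u, b)#} + {#(a, u)#}) (G + {#(a, b)#})" by (simp add: add_mset_commute)
  qed (use assms in auto)
  then show ?thesis by (simp add: add_mset_commute)
qed

lemma smooths_one: "w \<notin> nodes G \<Longrightarrow> a \<noteq> w \<Longrightarrow> b \<noteq> w \<Longrightarrow> smooths (G + {#(a, w), (w, b)#}) (G + {#(a, b)#})"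
  by (rule smooths_step[OF _ _ _ smooths_refl]) auto

lemma move_value_simps [simp]:
  "move_value G [] = 0"
  "move_value G ((c, R) # Rs) = c * web_eval (G + R) + move_value G Rs"
  unfolding move_value_def by simp_all

lemma smooths_glue_in':
  assumes "indeg G p = 1" "outdeg G p = 0" "p \<noteq> q" "p \<notin> nodes K"
  shows "smooths (G + K + {#(p, q)#}) (rename (id(p := q)) G + K)"
proof -
  have "rename (id(p := q)) K = K" using assms(4) by (intro rename_ident) auto
  with smooths_glue_in[of "G + K" p q] assms show ?thesis
    by (simp add: outdeg_simps deg_notin_nodes)
qed

lemma smooths_glue_out':
  assumes "outdeg G p = 1" "indeg G p = 0" "p \<noteq> q" "p \<notin> nodes K"
  shows "smooths (G + K + {#(q, p)#}) (rename (id(p := q)) G + K)"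
proof -
  have "rename (id(p := q)) K = K" using assms(4) by (intro rename_ident) auto
  with smooths_glue_out[of "G + K" p q] assms show ?thesis
    by (simp add: outdeg_simps deg_notin_nodes)
qed

lemma component_edge:
  assumes "\<forall>v\<in>nodes L. outdeg (G + L) v = outdeg L v \<and> indeg (G + L) v = indeg L v"
    and "u \<in> nodes L \<or> v \<in> nodes L"
  shows "count (G + L) (u, v) = count L (u, v)"
proof -
  have "(u, v) \<notin># G" using component_disjoint[OF assms(1)] assms(2) edge_nodes[of u v G] by blast
  then show ?thesis by (simp add: not_in_iff)
qed

text \<open>Each node set contains everything that the other component reaches from
  \<open>r\<close>, so the node sets agree; and a component consists of all edges whose tail is one
  of its nodes.\<close>

lemma component_unique:
  assumes L1: "H = G1 + L1" "connected_graph L1" "\<forall>v\<in>nodes L1. outdeg H v = outdeg L1 v \<and> indeg H v = indeg L1 v"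
    and L2: "H = G2 + L2" "connected_graph L2" "\<forall>v\<in>nodes L2. outdeg H v = outdeg L2 v \<and> indeg H v = indeg L2 v"
    and r: "r \<in> nodes L1" "r \<in> nodes L2"
  shows "L1 = L2"
proof -
  have sub: "nodes M \<subseteq> nodes L"
    if M: "H = F + M" "connected_graph M" "r \<in> nodes M"
      and L: "H = G + L" "\<forall>v\<in>nodes L. outdeg H v = outdeg L v \<and> indeg H v = indeg L v" "r \<in> nodes L"
    for F M G L
  proof
    fix v assume "v \<in> nodes M"
    then have "(r, v) \<in> (set_mset M \<union> (set_mset M)\<inverse>)\<^sup>*"
      using M(2,3) unfolding connected_graph_def by blast
    then show "v \<in> nodes L"
    proof (induction rule: rtrancl_induct)
      case (step y z)
      have "(y, z) \<in># L \<or> (z, y) \<in># L"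
      proof -
        have "(y, z) \<in># H \<or> (z, y) \<in># H" using step.hyps(2) unfolding M(1) by auto
        then show ?thesis
          using component_edge[OF L(2)[unfolded L(1)], of y z] component_edge[OF L(2)[unfolded L(1)], of z y] step.IH
          unfolding L(1) by (metis count_greater_zero_iff)
      qed
      then show ?case using edge_nodes by fast
    qed (rule L(3))
  qed
  have eq: "nodes L1 = nodes L2"
    using sub[OF L1(1,2) r(1) L2(1,3) r(2)] sub[OF L2(1,2) r(2) L1(1,3) r(1)] by blast
  have flt: "L = filter_mset (\<lambda>e. fst e \<in> nodes L) H"
    if L: "H = G + L" "\<forall>v\<in>nodes L. outdeg H v = outdeg L v \<and> indeg H v = indeg L v" for G L
  proof (rule multiset_eqI)
    fix e :: "'a \<times> 'a"
    show "count L e = count (filter_mset (\<lambda>e. fst e \<in> nodes L) H) e"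
      using component_edge[OF L(2)[unfolded L(1)], of "fst e" "snd e"] L(1) edge_nodes(1)[of "fst e" "snd e" L]
      by (auto simp: count_eq_zero_iff)
  qed
  show ?thesis using flt[OF L1(1,3)] flt[OF L2(1,3)] eq by simp
qed

context unique_below
begin

text \<open>Here \<open>(a, b)\<close> is doubled. One glueing of the quadrilateral closes the
  second copy to a circle beside D = \<open>G + {#(d, c)#}\<close>, the other one yields D alone.
  Removing the bigon first turns the path \<open>c\<close>, \<open>b\<close>, \<open>a\<close>,
  \<open>d\<close> into a second edge beside \<open>(c, d)\<close>, that is, into another bigon over
  D.\<close>

lemma bigon_in_quadrilateral:
  fixes H :: "'v dgraph"
  assumes Q: "quadrilateral_at H (G + {#(a, b)#}) a b c d" and H: "size H = N" "closed_web H"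
  shows "bigon_value * web_eval (G + {#(c, b), (c, d), (a, d)#} + {#(b, a)#}) =
    quadrilateral_value (G + {#(a, b)#}) a b c d"
proof -
  have HG: "H = G + {#(a, b)#} + {#(a, b), (c, b), (c, d), (a, d)#}" and dist: "distinct [a, b, c, d]"
    using Q unfolding quadrilateral_at_def by auto
  have deg: "outdeg G a = 0" "indeg G a = 0" "outdeg G b = 0" "indeg G b = 0"
    "outdeg G c = 1" "indeg G c = 0" "outdeg G d = 0" "indeg G d = 1"
    using quadrilateral_at_degrees[OF Q] dist by (auto simp: outdeg_simps)
  then have ab: "a \<notin> nodes G" "b \<notin> nodes G" by (simp_all add: nodes_deg)
  let ?D = "G + {#(d, c)#}"
  have "web_eval (G + {#(a, b)#} + {#(b, a), (d, c)#}) = circle_value * web_eval ?D"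
  proof -
    have s: "smooths (G + {#(a, b)#} + {#(b, a), (d, c)#}) (?D + {#(b, b)#})"
      using ab dist smooths_one[of a ?D b b] by (auto simp add: add_mset_commute)
    have c: "closed_web (?D + {#(b, b)#})"
      using smooths_closed_web[OF s] quadrilateral_at_closed(1)[OF Q H(2)] by simp
    have "is_point (?D + {#(b, b)#}) b" using dist deg by (auto simp: is_point_def outdeg_simps)
    from web_eval_move[OF _ c circle_move[OF this]]
    show ?thesis
      using web_eval_smooths[OF s _ quadrilateral_at_closed(1)[OF Q H(2)]] H(1) unfolding HG by simp
  qed
  moreover have "web_eval (G + {#(a, b)#} + {#(b, c), (d, a)#}) = web_eval ?D"
  proof (rule web_eval_smooths[OF _ _ quadrilateral_at_closed(2)[OF Q H(2)]])
    show "smooths (G + {#(a, b)#} + {#(b, c), (d, a)#}) ?D"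
      using ab dist smooths_two[of a G b d c] by (auto simp add: add_mset_commute)
    show "size (G + {#(a, b)#} + {#(b, c), (d, a)#}) < N" unfolding H(1)[symmetric] HG by simp
  qed
  moreover have "web_eval (G + {#(c, b), (c, d), (a, d)#} + {#(b, a)#}) = bigon_value * web_eval ?D"
  proof -
    have s: "smooths (G + {#(c, b), (c, d), (a, d)#} + {#(b, a)#}) (G + {#(c, d), (c, d)#})"
      using ab dist smooths_two[of b "G + {#(c, d)#}" a c d] by (auto simp add: add_mset_commute)
    have HG': "H = G + {#(c, b), (c, d), (a, d)#} + {#(a, b), (a, b)#}" unfolding HG by (simp add: add_mset_commute)
    have "web_move H {a, b} {#(a, b), (a, b)#} [(bigon_value, {#(b, a)#})]"
      using Q unfolding quadrilateral_at_def by (intro bigon_move) auto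
    from web_move_closed[OF this[unfolded HG'] H(2)[unfolded HG'], of bigon_value]
    have c': "closed_web (G + {#(c, b), (c, d), (a, d)#} + {#(b, a)#})" by simp
    have c: "closed_web (G + {#(c, d), (c, d)#})" using smooths_closed_web[OF s] c' by simp
    have "is_source (G + {#(c, d), (c, d)#}) c" "is_sink (G + {#(c, d), (c, d)#}) d"
      using dist deg by (auto simp: is_source_def is_sink_def outdeg_simps)
    from web_eval_move[OF _ c bigon_move[OF this]]
    show ?thesis using web_eval_smooths[OF s _ c'] H(1) unfolding HG by simp
  qed
  ultimately show ?thesis
    unfolding quadrilateral_value_def
    by (simp add: bigon_value_square mult.assoc[symmetric] distrib_right)
qed

text \<open>One glueing of the first quadrilateral turns the path \<open>c'\<close>,
  \<open>b\<close>, \<open>a\<close>, \<open>d'\<close> into a second edge beside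
  \<open>(c', d')\<close>, a bigon. The other one merges \<open>c\<close> into \<open>c'\<close> and
  \<open>d\<close> into \<open>d'\<close>. Both results are symmetric in the two quadrilaterals, the
  second one up to renaming.\<close>

lemma quadrilaterals_share_edge_value:
  fixes G :: "'v dgraph"
  assumes dist: "distinct [a, b, c, d, c', d']"
    and ab: "a \<notin> nodes G" "b \<notin> nodes G"
    and deg: "outdeg G c = 1" "indeg G c = 0" "outdeg G d = 0" "indeg G d = 1"
      "outdeg G c' = 1" "indeg G c' = 0" "outdeg G d' = 0" "indeg G d' = 1"
    and cl: "closed_web (G + {#(a, d'), (c', b), (c', d')#} + {#(b, a), (d, c)#})"
      "closed_web (G + {#(a, d'), (c', b), (c', d')#} + {#(b, c), (d, a)#})"
    and sz: "size G + 5 < N"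
  shows "quadrilateral_value (G + {#(a, d'), (c', b), (c', d')#}) a b c d =
    bigon_value * web_eval (G + {#(d, c), (d', c')#}) + web_eval (rename (id(c := c', d := d')) G + {#(c', d')#})"
proof -
  have "web_eval (G + {#(a, d'), (c', b), (c', d')#} + {#(b, a), (d, c)#}) =
      bigon_value * web_eval (G + {#(d, c), (d', c')#})"
  proof -
    let ?K = "G + {#(d, c)#} + {#(c', d'), (c', d')#}"
    have s: "smooths (G + {#(a, d'), (c', b), (c', d')#} + {#(b, a), (d, c)#}) ?K"
      using ab dist smooths_two[of b "G + {#(c', d'), (d, c)#}" a c' d'] by (auto simp add: add_mset_commute)
    have c: "closed_web ?K" using smooths_closed_web[OF s] cl(1) by simp
    have "is_source ?K c'" "is_sink ?K d'"
      using dist deg by (auto simp: is_source_def is_sink_def outdeg_simps)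
    from web_eval_move[OF _ c bigon_move[OF this]]
    show ?thesis using web_eval_smooths[OF s _ cl(1)] sz by (simp add: add_mset_commute)
  qed
  moreover have "web_eval (G + {#(a, d'), (c', b), (c', d')#} + {#(b, c), (d, a)#}) =
      web_eval (rename (id(c := c', d := d')) G + {#(c', d')#})"
  proof (rule web_eval_smooths[OF _ _ cl(2)])
    have "smooths ((G + {#(c', d'), (d, a), (a, d')#}) + {#(c', b), (b, c)#}) ((G + {#(c', d'), (d, a), (a, d')#}) + {#(c', c)#})"
      using ab dist by (intro smooths_one) auto
    also have "smooths ((G + {#(c', d'), (d, a), (a, d')#}) + {#(c', c)#}) ((G + {#(c', d'), (c', c)#}) + {#(d, d')#})"
      using ab dist smooths_one[of a "G + {#(c', d'), (c', c)#}" d d'] by (auto simp add: add_mset_commute)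
    also (smooths_trans) have "smooths \<dots> (rename (id(c := c')) G + {#(c', d'), (d, d')#})"
      using smooths_glue_out'[of G c c' "{#(c', d'), (d, d')#}"] dist deg by (simp add: add_mset_commute)
    also (smooths_trans) have "smooths \<dots> (rename (id(d := d')) (rename (id(c := c')) G) + {#(c', d')#})"
    proof -
      have iso: "isolates (id(c := c')) G d" using dist by (auto simp: isolates_def)
      have "(id(c := c')) d = d" using dist by auto
      then have "indeg (rename (id(c := c')) G) d = 1" "outdeg (rename (id(c := c')) G) d = 0"
        using deg_rename[OF iso] deg by simp_all
      from smooths_glue_in'[OF this, of d' "{#(c', d')#}"] dist show ?thesis by (simp add: add_mset_commute)
    qed
    also (smooths_trans) have "rename (id(d := d')) (rename (id(c := c')) G) = rename (id(c := c', d := d')) G"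
      unfolding rename_rename by (rule rename_cong) (use dist in auto)
    finally show "smooths (G + {#(a, d'), (c', b), (c', d')#} + {#(b, c), (d, a)#})
        (rename (id(c := c', d := d')) G + {#(c', d')#})"
      by (simp add: add_mset_commute)
  qed (use sz in simp)
  ultimately show ?thesis unfolding quadrilateral_value_def by simp
qed

lemma quadrilaterals_share_edge:
  fixes H :: "'v dgraph"
  assumes Q1: "quadrilateral_at H G1 a b c d" and Q2: "quadrilateral_at H G2 a b c' d'"
    and ne: "c' \<noteq> c" "d' \<noteq> d" and H: "size H = N" "closed_web H"
  shows "quadrilateral_value G1 a b c d = quadrilateral_value G2 a b c' d'"
proof -
  have H1: "H = G1 + {#(a, b), (c, b), (c, d), (a, d)#}" and H2: "H = G2 + {#(a, b), (c', b), (c', d'), (a, d')#}"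
    using Q1 Q2 unfolding quadrilateral_at_def by auto
  have dist: "distinct [a, b, c, d, c', d']"
    using Q1 Q2 ne unfolding quadrilateral_at_def is_source_def is_sink_def by auto
  \<comment> \<open>The other three sides of the second quadrilateral are not sides of the first, so
    \<open>G\<close> is what remains of \<open>H\<close> outside both.\<close>
  have "{#(a, d'), (c', b), (c', d')#} \<subseteq># H" unfolding H2 by (simp add: add_mset_commute)
  then have "{#(a, d'), (c', b), (c', d')#} \<subseteq># G1"
    unfolding H1 by (rule disjoint_subset_mset) (use dist in auto)
  from subset_mset.diff_add[OF this, symmetric] obtain G where G1: "G1 = G + {#(a, d'), (c', b), (c', d')#}"
    by blast
  have G2: "G2 = G + {#(a, d), (c, b), (c, d)#}"
    using H2 unfolding H1 G1 by (simp add: add_mset_commute)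
  note deg = quadrilateral_at_degrees[OF Q1, unfolded G1] quadrilateral_at_degrees[OF Q2, unfolded G2]
  have ab: "a \<notin> nodes G" "b \<notin> nodes G" using deg dist by (auto simp: nodes_deg outdeg_simps)
  have degs: "outdeg G c = 1" "indeg G c = 0" "outdeg G d = 0" "indeg G d = 1"
      "outdeg G c' = 1" "indeg G c' = 0" "outdeg G d' = 0" "indeg G d' = 1"
    using deg dist by (auto simp: outdeg_simps)
  have sz: "size G + 5 < N" unfolding H(1)[symmetric] H1 G1 by simp
  have v1: "quadrilateral_value G1 a b c d = bigon_value * web_eval (G + {#(d, c), (d', c')#}) +
      web_eval (rename (id(c := c', d := d')) G + {#(c', d')#})"
    unfolding G1 using dist ab degs sz quadrilateral_at_closed[OF Q1 H(2), unfolded G1]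
    by (intro quadrilaterals_share_edge_value) auto
  have v2: "quadrilateral_value G2 a b c' d' = bigon_value * web_eval (G + {#(d', c'), (d, c)#}) +
      web_eval (rename (id(c' := c, d' := d)) G + {#(c, d)#})"
    unfolding G2 using dist ab degs sz quadrilateral_at_closed[OF Q2 H(2), unfolded G2]
    by (intro quadrilaterals_share_edge_value) auto
  let ?K = "rename (id(c := c', d := d')) G + {#(c', d')#}"
  have "inj_on (id(c' := c, d' := d)) (nodes ?K)"
    using dist by (auto simp: inj_on_def)
  moreover have "rename (id(c' := c, d' := d)) ?K = rename (id(c' := c, d' := d)) G + {#(c, d)#}"
    using dist by (auto simp: rename_rename intro!: rename_cong)
  ultimately have "web_eval ?K = web_eval (rename (id(c' := c, d' := d)) G + {#(c, d)#})"
    by (metis web_eval_rename)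
  then show ?thesis using v1 v2 by (simp add: add_mset_commute)
qed

text \<open>The edges of \<open>a\<close> and \<open>c\<close> all lead to the sinks
  \<open>b\<close>, \<open>d\<close> and \<open>d'\<close>. Each glueing makes the external edges of
  these three sinks meet in a single sink, so either value is twice the same graph up to
  renaming.\<close>

lemma quadrilaterals_share_sources:
  fixes H :: "'v dgraph"
  assumes Q1: "quadrilateral_at H G1 a b c d" and Q2: "quadrilateral_at H G2 a b c d'"
    and ne: "d' \<noteq> d" and H: "size H = N" "closed_web H"
  shows "quadrilateral_value G1 a b c d = quadrilateral_value G2 a b c d'"
proof -
  have H1: "H = G1 + {#(a, b), (c, b), (c, d), (a, d)#}" and H2: "H = G2 + {#(a, b), (c, b), (c, d'), (a, d')#}"
    using Q1 Q2 unfolding quadrilateral_at_def by auto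
  have dist: "distinct [a, b, c, d, d']"
    using Q1 Q2 ne unfolding quadrilateral_at_def is_source_def is_sink_def by auto
  have "{#(a, d'), (c, d')#} \<subseteq># H" unfolding H2 by (simp add: add_mset_commute)
  then have "{#(a, d'), (c, d')#} \<subseteq># G1"
    unfolding H1 by (rule disjoint_subset_mset) (use dist in auto)
  from subset_mset.diff_add[OF this, symmetric] obtain G where G1: "G1 = G + {#(a, d'), (c, d')#}"
    by blast
  have G2: "G2 = G + {#(a, d), (c, d)#}"
    using H2 unfolding H1 G1 by (simp add: add_mset_commute)
  have val: "quadrilateral_value (G + {#(a, d'), (c, d')#}) a b c d =
      web_eval (rename (id(d := d')) G + {#(b, d')#}) + web_eval (rename (id(d := d')) G + {#(b, d')#})"
    if Q: "quadrilateral_at H (G + {#(a, d'), (c, d')#}) a b c d" and dist: "distinct [a, b, c, d, d']" for d d'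
  proof -
    note deg = quadrilateral_at_degrees[OF Q]
    have HG: "H = G + {#(a, d'), (c, d')#} + {#(a, b), (c, b), (c, d), (a, d)#}"
      using Q unfolding quadrilateral_at_def by simp
    have ac: "a \<notin> nodes G" "c \<notin> nodes G" using deg dist by (auto simp: nodes_deg outdeg_simps)
    have degd: "indeg G d = 1" "outdeg G d = 0" using deg dist by (auto simp: outdeg_simps)
    have g: "smooths (G + {#(b, d')#} + {#(d, d')#}) (rename (id(d := d')) G + {#(b, d')#})"
      using smooths_glue_in'[OF degd, of d' "{#(b, d')#}"] dist by (auto simp: add_mset_commute)
    have "web_eval (G + {#(a, d'), (c, d')#} + {#(b, a), (d, c)#}) = web_eval (rename (id(d := d')) G + {#(b, d')#})"
    proof (rule web_eval_smooths[OF _ _ quadrilateral_at_closed(1)[OF Q H(2)]])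
      have "smooths ((G + {#(d, c), (c, d')#}) + {#(b, a), (a, d')#}) ((G + {#(d, c), (c, d')#}) + {#(b, d')#})"
        using ac dist by (intro smooths_one) auto
      also have "smooths ((G + {#(d, c), (c, d')#}) + {#(b, d')#}) (G + {#(b, d')#} + {#(d, d')#})"
        using ac dist smooths_one[of c "G + {#(b, d')#}" d d'] by (auto simp add: add_mset_commute)
      also (smooths_trans) note g
      finally (smooths_trans) show "smooths (G + {#(a, d'), (c, d')#} + {#(b, a), (d, c)#}) (rename (id(d := d')) G + {#(b, d')#})"
        by (simp add: add_mset_commute)
    qed (use H(1) HG in auto)
    moreover have "web_eval (G + {#(a, d'), (c, d')#} + {#(b, c), (d, a)#}) = web_eval (rename (id(d := d')) G + {#(b, d')#})"
    proof (rule web_eval_smooths[OF _ _ quadrilateral_at_closed(2)[OF Q H(2)]])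
      have "smooths ((G + {#(d, a), (a, d')#}) + {#(b, c), (c, d')#}) ((G + {#(d, a), (a, d')#}) + {#(b, d')#})"
        using ac dist by (intro smooths_one) auto
      also have "smooths ((G + {#(d, a), (a, d')#}) + {#(b, d')#}) (G + {#(b, d')#} + {#(d, d')#})"
        using ac dist smooths_one[of a "G + {#(b, d')#}" d d'] by (auto simp add: add_mset_commute)
      also (smooths_trans) note g
      finally (smooths_trans) show "smooths (G + {#(a, d'), (c, d')#} + {#(b, c), (d, a)#}) (rename (id(d := d')) G + {#(b, d')#})"
        by (simp add: add_mset_commute)
    qed (use H(1) HG in auto)
    ultimately show ?thesis unfolding quadrilateral_value_def by simp
  qed
  let ?K = "rename (id(d := d')) G + {#(b, d')#}"
  have "inj_on (id(d' := d)) (nodes ?K)" using dist by (auto simp: inj_on_def)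
  moreover have "rename (id(d' := d)) ?K = rename (id(d' := d)) G + {#(b, d)#}"
    using dist by (auto simp: rename_rename intro!: rename_cong)
  ultimately have "web_eval ?K = web_eval (rename (id(d' := d)) G + {#(b, d)#})"
    by (metis web_eval_rename)
  moreover have "distinct [a, b, c, d', d]" using dist by auto
  ultimately show ?thesis using val[OF Q1[unfolded G1] dist] val[OF Q2[unfolded G2]] unfolding G1 G2 by simp
qed

text \<open>Dual to \<open>quadrilaterals_share_sources\<close>: each glueing makes the external
  edges of \<open>a\<close>, \<open>c\<close> and \<open>c'\<close> leave a single source.\<close>

lemma quadrilaterals_share_sinks:
  fixes H :: "'v dgraph"
  assumes Q1: "quadrilateral_at H G1 a b c d" and Q2: "quadrilateral_at H G2 a b c' d"
    and ne: "c' \<noteq> c" and H: "size H = N" "closed_web H"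
  shows "quadrilateral_value G1 a b c d = quadrilateral_value G2 a b c' d"
proof -
  have H1: "H = G1 + {#(a, b), (c, b), (c, d), (a, d)#}" and H2: "H = G2 + {#(a, b), (c', b), (c', d), (a, d)#}"
    using Q1 Q2 unfolding quadrilateral_at_def by auto
  have dist: "distinct [a, b, c, d, c']"
    using Q1 Q2 ne unfolding quadrilateral_at_def is_source_def is_sink_def by auto
  have "{#(c', b), (c', d)#} \<subseteq># H" unfolding H2 by (simp add: add_mset_commute)
  then have "{#(c', b), (c', d)#} \<subseteq># G1"
    unfolding H1 by (rule disjoint_subset_mset) (use dist in auto)
  from subset_mset.diff_add[OF this, symmetric] obtain G where G1: "G1 = G + {#(c', b), (c', d)#}"
    by blast
  have G2: "G2 = G + {#(c, b), (c, d)#}"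
    using H2 unfolding H1 G1 by (simp add: add_mset_commute)
  have val: "quadrilateral_value (G + {#(c', b), (c', d)#}) a b c d =
      web_eval (rename (id(c := c')) G + {#(c', a)#}) + web_eval (rename (id(c := c')) G + {#(c', a)#})"
    if Q: "quadrilateral_at H (G + {#(c', b), (c', d)#}) a b c d" and dist: "distinct [a, b, c, d, c']" for c c'
  proof -
    note deg = quadrilateral_at_degrees[OF Q]
    have HG: "H = G + {#(c', b), (c', d)#} + {#(a, b), (c, b), (c, d), (a, d)#}"
      using Q unfolding quadrilateral_at_def by simp
    have bd: "b \<notin> nodes G" "d \<notin> nodes G" using deg dist by (auto simp: nodes_deg outdeg_simps)
    have degc: "outdeg G c = 1" "indeg G c = 0" using deg dist by (auto simp: outdeg_simps)
    have g: "smooths (G + {#(c', a)#} + {#(c', c)#}) (rename (id(c := c')) G + {#(c', a)#})"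
      using smooths_glue_out'[OF degc, of c' "{#(c', a)#}"] dist by (auto simp: add_mset_commute)
    have "web_eval (G + {#(c', b), (c', d)#} + {#(b, a), (d, c)#}) = web_eval (rename (id(c := c')) G + {#(c', a)#})"
    proof (rule web_eval_smooths[OF _ _ quadrilateral_at_closed(1)[OF Q H(2)]])
      have "smooths ((G + {#(c', d), (d, c)#}) + {#(c', b), (b, a)#}) ((G + {#(c', d), (d, c)#}) + {#(c', a)#})"
        using bd dist by (intro smooths_one) auto
      also have "smooths ((G + {#(c', d), (d, c)#}) + {#(c', a)#}) (G + {#(c', a)#} + {#(c', c)#})"
        using bd dist smooths_one[of d "G + {#(c', a)#}" c' c] by (auto simp add: add_mset_commute)
      also (smooths_trans) note g
      finally (smooths_trans) show "smooths (G + {#(c', b), (c', d)#} + {#(b, a), (d, c)#}) (rename (id(c := c')) G + {#(c', a)#})"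
        by (simp add: add_mset_commute)
    qed (use H(1) HG in auto)
    moreover have "web_eval (G + {#(c', b), (c', d)#} + {#(b, c), (d, a)#}) = web_eval (rename (id(c := c')) G + {#(c', a)#})"
    proof (rule web_eval_smooths[OF _ _ quadrilateral_at_closed(2)[OF Q H(2)]])
      have "smooths ((G + {#(c', b), (b, c)#}) + {#(c', d), (d, a)#}) ((G + {#(c', b), (b, c)#}) + {#(c', a)#})"
        using bd dist by (intro smooths_one) auto
      also have "smooths ((G + {#(c', b), (b, c)#}) + {#(c', a)#}) (G + {#(c', a)#} + {#(c', c)#})"
        using bd dist smooths_one[of b "G + {#(c', a)#}" c' c] by (auto simp add: add_mset_commute)
      also (smooths_trans) note g
      finally (smooths_trans) show "smooths (G + {#(c', b), (c', d)#} + {#(b, c), (d, a)#}) (rename (id(c := c')) G + {#(c', a)#})"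
        by (simp add: add_mset_commute)
    qed (use H(1) HG in auto)
    ultimately show ?thesis unfolding quadrilateral_value_def by simp
  qed
  let ?K = "rename (id(c := c')) G + {#(c', a)#}"
  have "inj_on (id(c' := c)) (nodes ?K)" using dist by (auto simp: inj_on_def)
  moreover have "rename (id(c' := c)) ?K = rename (id(c' := c)) G + {#(c, a)#}"
    using dist by (auto simp: rename_rename intro!: rename_cong)
  ultimately have "web_eval ?K = web_eval (rename (id(c' := c)) G + {#(c, a)#})"
    by (metis web_eval_rename)
  moreover have "distinct [a, b, c', d, c]" using dist by auto
  ultimately show ?thesis using val[OF Q1[unfolded G1] dist] val[OF Q2[unfolded G2]] unfolding G1 G2 by simp
qed

end


lemma outdeg_mono: "L \<subseteq># G \<Longrightarrow> outdeg L v \<le> outdeg G v"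
  and indeg_mono: "L \<subseteq># G \<Longrightarrow> indeg L v \<le> indeg G v"
  unfolding outdeg_def indeg_def by (simp_all add: multiset_filter_mono size_mset_mono)

text \<open>All edges of \<open>H\<close> at a node of \<open>L\<close> belong to \<open>L\<close>,
  so a quadrilateral that meets a split-off component lies inside it. For an irreducible
  \<open>L\<close> this rules the overlap out.\<close>

lemma quadrilateral_in_component:
  assumes L: "H = G + L" "\<forall>v\<in>nodes L. outdeg H v = outdeg L v \<and> indeg H v = indeg L v"
    and Q: "quadrilateral_at H G' a b c d" "v \<in> nodes L" "v \<in> {a, b, c, d}"
  shows "has_quadrilateral L"
proof -
  have dist: "distinct [a, b, c, d]" using Q(1) unfolding quadrilateral_at_def by simp
  have H: "(a, b) \<in># H" "(c, b) \<in># H" "(c, d) \<in># H" "(a, d) \<in># H"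
    using Q(1) unfolding quadrilateral_at_def by auto
  have e: "(x, y) \<in># L" if "(x, y) \<in># H" "x \<in> nodes L \<or> y \<in> nodes L" for x y
    using component_edge[OF L(2)[unfolded L(1)] that(2)] that(1) unfolding L(1)
    by (metis count_greater_zero_iff)
  have n: "x \<in> nodes L \<longleftrightarrow> y \<in> nodes L" if "(x, y) \<in># H" for x y
    using e[OF that] edge_nodes[of x y L] by blast
  have "a \<in> nodes L" "b \<in> nodes L" "c \<in> nodes L" "d \<in> nodes L"
    using Q(2,3) n[OF H(1)] n[OF H(2)] n[OF H(3)] n[OF H(4)] by auto
  then show ?thesis using e[OF H(1)] e[OF H(2)] e[OF H(3)] e[OF H(4)] dist
    unfolding has_quadrilateral_def by blast
qed

lemma bigon_in_component:
  assumes L: "H = G + L" "\<forall>v\<in>nodes L. outdeg H v = outdeg L v \<and> indeg H v = indeg L v"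
    and B: "H = G' + {#(u, v), (u, v)#}" "u \<noteq> v" "u \<in> nodes L \<or> v \<in> nodes L"
  shows "has_bigon L"
proof -
  have "count H (u, v) \<ge> 2" unfolding B(1) by simp
  then have "count L (u, v) \<ge> 2"
    using component_edge[OF L(2)[unfolded L(1)] B(3)] unfolding L(1) by simp
  then show ?thesis using B(2) unfolding has_bigon_def by blast
qed

text \<open>Two different bigons at a common vertex would need four edges there. On a triple edge
  the choice of the pair makes no difference, since edges are only counted with
  multiplicity.\<close>

lemma bigons_overlap:
  assumes H: "H = G1 + {#(u, v), (u, v)#}" "H = G2 + {#(u', v'), (u', v')#}"
    and st: "is_source H u" "is_sink H v" "is_source H u'" "is_sink H v'" and o: "{u, v} \<inter> {u', v'} \<noteq> {}"
  shows "u' = u \<and> v' = v"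
proof (rule ccontr)
  assume ne: "\<not> (u' = u \<and> v' = v)"
  have "u \<noteq> v'" "v \<noteq> u'" using st by (auto simp: is_source_def is_sink_def)
  then have "u' = u \<or> v' = v" using o by auto
  have "{#(u', v'), (u', v')#} \<subseteq># G1 + {#(u, v), (u, v)#}" unfolding H(1)[symmetric] H(2) by simp
  then have "{#(u', v'), (u', v')#} \<subseteq># G1" by (rule disjoint_subset_mset) (use ne in auto)
  from outdeg_mono[OF this, of u] indeg_mono[OF this, of v] \<open>u' = u \<or> v' = v\<close>
  have "outdeg G1 u \<ge> 2 \<or> indeg G1 v \<ge> 2" by (auto simp: outdeg_simps)
  then show False using st(1,2) unfolding H(1) by (auto simp: is_source_def is_sink_def outdeg_simps)
qed

context unique_below
begin

lemma bigon_quadrilateral_overlap: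
  fixes H :: "'v dgraph"
  assumes B: "H = G1 + {#(u, v), (u, v)#}" "is_source H u" "is_sink H v"
    and Q: "quadrilateral_at H G2 a b c d" and o: "{u, v} \<inter> {a, b, c, d} \<noteq> {}"
    and H: "size H = N" "closed_web H"
  shows "bigon_value * web_eval (G1 + {#(v, u)#}) = quadrilateral_value G2 a b c d"
proof -
  have HQ: "H = G2 + {#(a, b), (c, b), (c, d), (a, d)#}" and dist: "distinct [a, b, c, d]"
    and st: "is_source H a" "is_sink H b" "is_source H c" "is_sink H d"
    using Q unfolding quadrilateral_at_def by auto
  have "u \<noteq> b" "u \<noteq> d" "v \<noteq> a" "v \<noteq> c"
    using B(2,3) st by (auto simp: is_source_def is_sink_def)
  then have uv: "u \<in> {a, c} \<or> v \<in> {b, d}" using o by auto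
  have sub: "{#(u, v), (u, v)#} \<subseteq># G2 + {#(a, b), (c, b), (c, d), (a, d)#}"
    unfolding HQ[symmetric] B(1) by simp
  note deg = quadrilateral_at_degrees[OF Q]
  \<comment> \<open>A vertex of the quadrilateral has only one further edge, so the two bigon edges
    cannot both avoid the quadrilateral: one of them is a side.\<close>
  have "\<not> {#(u, v), (u, v)#} \<subseteq># G2"
  proof
    assume "{#(u, v), (u, v)#} \<subseteq># G2"
    from outdeg_mono[OF this, of u] indeg_mono[OF this, of v] show False
      using uv deg by (auto simp: outdeg_simps)
  qed
  then have uv: "u \<in> {a, c}" "v \<in> {b, d}"
    using disjoint_subset_mset[OF sub] by auto
  have "2 \<le> count H (u, v)" unfolding B(1) by simp
  then have "count G2 (u, v) > 0" using uv dist unfolding HQ by auto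
  then have "(u, v) \<in># G2" by simp
  then obtain G where G2: "G2 = G + {#(u, v)#}" by (auto dest!: multi_member_split)
  obtain c' d' where
    Q': "quadrilateral_at H G2 u v c' d'" "quadrilateral_value G2 u v c' d' = quadrilateral_value G2 a b c d"
    by (rule quadrilateral_arrange[OF Q uv])
  then have "H = G2 + {#(u, v), (c', v), (c', d'), (u, d')#}" unfolding quadrilateral_at_def by simp
  then have "G1 = G + {#(c', v), (c', d'), (u, d')#}" unfolding G2 B(1) by (simp add: add_mset_commute)
  then show ?thesis using bigon_in_quadrilateral[OF Q'(1)[unfolded G2] H] Q'(2) unfolding G2 by simp
qed

lemma quadrilaterals_overlap:
  fixes H :: "'v dgraph"
  assumes Q1: "quadrilateral_at H G1 a b c d" and Q2: "quadrilateral_at H G2 a' b' c' d'"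
    and o: "{a, b, c, d} \<inter> {a', b', c', d'} \<noteq> {}" and H: "size H = N" "closed_web H"
  shows "quadrilateral_value G1 a b c d = quadrilateral_value G2 a' b' c' d'"
proof -
  have H1: "H = G1 + {#(a, b), (c, b), (c, d), (a, d)#}" and H2: "H = G2 + {#(a', b'), (c', b'), (c', d'), (a', d')#}"
    and dist: "distinct [a, b, c, d]" "distinct [a', b', c', d']"
    and st: "is_source H a" "is_sink H b" "is_source H c" "is_sink H d"
     "is_source H a'" "is_sink H b'" "is_source H c'" "is_sink H d'"
    using Q1 Q2 unfolding quadrilateral_at_def by auto
  have ss: "x \<noteq> y" if "x \<in> {a, c, a', c'}" "y \<in> {b, d, b', d'}" for x y
    using that st by (auto simp: is_source_def is_sink_def)
  note deg = quadrilateral_at_degrees[OF Q1]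
  \<comment> \<open>A common source has three edges, two of them in each quadrilateral. Hence the
    quadrilaterals share an edge there, and with it a sink; \<open>B\<close> is the dual
    argument.\<close>
  have A: "{b, d} \<inter> {b', d'} \<noteq> {}" if s: "s \<in> {a, c}" "s \<in> {a', c'}" for s
  proof
    assume e: "{b, d} \<inter> {b', d'} = {}"
    have "{#(s, b'), (s, d')#} \<subseteq># H" unfolding H2 using s(2) by (auto simp: add_mset_commute)
    then have "{#(s, b'), (s, d')#} \<subseteq># G1"
      unfolding H1 by (rule disjoint_subset_mset) (use e in auto)
    from outdeg_mono[OF this, of s] show False using s(1) deg by (auto simp: outdeg_simps)
  qed
  have B: "{a, c} \<inter> {a', c'} \<noteq> {}" if t: "t \<in> {b, d}" "t \<in> {b', d'}" for t
  proof
    assume e: "{a, c} \<inter> {a', c'} = {}"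
    have "{#(a', t), (c', t)#} \<subseteq># H" unfolding H2 using t(2) by (auto simp: add_mset_commute)
    then have "{#(a', t), (c', t)#} \<subseteq># G1"
      unfolding H1 by (rule disjoint_subset_mset) (use e in auto)
    from indeg_mono[OF this, of t] show False using t(1) deg by (auto simp: outdeg_simps)
  qed
  have "{a, c} \<inter> {a', c'} \<noteq> {} \<or> {b, d} \<inter> {b', d'} \<noteq> {}"
    using o ss by blast
  then have "{a, c} \<inter> {a', c'} \<noteq> {}" "{b, d} \<inter> {b', d'} \<noteq> {}"
    using A B by (meson IntE ex_in_conv)+
  then obtain s t where s: "s \<in> {a, c}" "s \<in> {a', c'}" and t: "t \<in> {b, d}" "t \<in> {b', d'}"
    by (meson IntE ex_in_conv)
  obtain c1 d1 where
    R1: "quadrilateral_at H G1 s t c1 d1" "quadrilateral_value G1 s t c1 d1 = quadrilateral_value G1 a b c d"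
    by (rule quadrilateral_arrange[OF Q1 s(1) t(1)])
  obtain c2 d2 where
    R2: "quadrilateral_at H G2 s t c2 d2" "quadrilateral_value G2 s t c2 d2 = quadrilateral_value G2 a' b' c' d'"
    by (rule quadrilateral_arrange[OF Q2 s(2) t(2)])
  have "quadrilateral_value G1 s t c1 d1 = quadrilateral_value G2 s t c2 d2"
  proof (cases "c2 = c1"; cases "d2 = d1")
    assume "c2 = c1" "d2 = d1"
    with R1(1) R2(1) have "G1 = G2" unfolding quadrilateral_at_def by simp
    then show ?thesis using \<open>c2 = c1\<close> \<open>d2 = d1\<close> by simp
  next
    assume "c2 = c1" "d2 \<noteq> d1"
    then show ?thesis using quadrilaterals_share_sources[OF R1(1) _ _ H] R2(1) by simp
  next
    assume "c2 \<noteq> c1" "d2 = d1"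
    then show ?thesis using quadrilaterals_share_sinks[OF R1(1) _ _ H] R2(1) by simp
  next
    assume "c2 \<noteq> c1" "d2 \<noteq> d1"
    then show ?thesis by (rule quadrilaterals_share_edge[OF R1(1) R2(1) _ _ H])
  qed
  then show ?thesis using R1(2) R2(2) by simp
qed

text \<open>Points are neither sources nor sinks, and irreducible components contain no bigon and no
  quadrilateral. Apart from moves that coincide, the overlaps are therefore those of bigons and
  quadrilaterals treated above.\<close>

lemma overlapping_moves:
  fixes H :: "'v dgraph"
  assumes H1: "H = G1 + L1" "web_move H V1 L1 Rs1" and H2: "H = G2 + L2" "web_move H V2 L2 Rs2"
    and o: "V1 \<inter> V2 \<noteq> {}" and H: "size H = N" "closed_web H"
  shows "move_value G1 Rs1 = move_value G2 Rs2"
  using H1(2)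
proof cases
  case 1: (circle_move w)
  from H2(2) show ?thesis
  proof cases
    case (circle_move w')
    then have "w' = w" using 1 o by auto
    then show ?thesis using H1(1) H2(1) 1 circle_move by simp
  next
    case component_move
    then have "is_source H w \<or> is_sink H w"
      using 1 o unfolding irreducible_web_def is_source_def is_sink_def by auto
    then show ?thesis using 1 by (auto simp: is_source_def is_sink_def is_point_def)
  qed (use 1 o in \<open>auto simp: is_source_def is_sink_def is_point_def\<close>)
next
  case 1: (bigon_move u v)
  then have uv: "u \<noteq> v" by (auto simp: is_source_def is_sink_def)
  from H2(2) show ?thesis
  proof cases
    case (circle_move w')
    then show ?thesis using 1 o by (auto simp: is_source_def is_sink_def is_point_def)
  next
    case (bigon_move u' v')
    then have "u' = u \<and> v' = v"
      using bigons_overlap[of H G1 u v G2 u' v'] 1 o H1(1) H2(1) by simp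
    then show ?thesis using H1(1) H2(1) 1 bigon_move by simp
  next
    case (quadrilateral_move a b c d)
    then have "quadrilateral_at H G2 a b c d" unfolding quadrilateral_at_def using H2(1) by simp
    from bigon_quadrilateral_overlap[of H G1 u v, OF _ _ _ this _ H] 1 quadrilateral_move o H1(1)
    show ?thesis by (simp add: quadrilateral_value_def)
  next
    case component_move
    then show ?thesis
      using bigon_in_component[OF H2(1), of G1 u v] 1 o uv H1(1) by (auto simp: irreducible_web_def)
  qed
next
  case 1: (quadrilateral_move a b c d)
  then have Q: "quadrilateral_at H G1 a b c d" unfolding quadrilateral_at_def using H1(1) by simp
  from H2(2) show ?thesis
  proof cases
    case (circle_move w')
    then show ?thesis using 1 o by (auto simp: is_source_def is_sink_def is_point_def)
  next
    case (bigon_move u v)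
    from bigon_quadrilateral_overlap[of H G2 u v, OF _ _ _ Q _ H] 1 bigon_move o H2(1)
    show ?thesis by (simp add: quadrilateral_value_def Int_commute)
  next
    case (quadrilateral_move a' b' c' d')
    then have "quadrilateral_at H G2 a' b' c' d'" unfolding quadrilateral_at_def using H2(1) by simp
    from quadrilaterals_overlap[OF Q this _ H] 1 quadrilateral_move o
    show ?thesis by (simp add: quadrilateral_value_def)
  next
    case component_move
    obtain v where "v \<in> {a, b, c, d}" "v \<in> nodes L2" using o 1(1) component_move(1) by blast
    then have "has_quadrilateral L2"
      using quadrilateral_in_component[OF H2(1) component_move(4) Q] by blast
    then show ?thesis using component_move by (auto simp: irreducible_web_def)
  qed
next
  case 1: component_move
  from H2(2) show ?thesis
  proof cases
    case (circle_move w)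
    then have "is_source H w \<or> is_sink H w"
      using 1 o unfolding irreducible_web_def is_source_def is_sink_def by auto
    then show ?thesis using circle_move by (auto simp: is_source_def is_sink_def is_point_def)
  next
    case (bigon_move u v)
    then have "u \<noteq> v" by (auto simp: is_source_def is_sink_def)
    then show ?thesis
      using bigon_in_component[OF H1(1), of G2 u v] 1 o bigon_move H2(1) by (auto simp: irreducible_web_def)
  next
    case (quadrilateral_move a b c d)
    then have Q: "quadrilateral_at H G2 a b c d" unfolding quadrilateral_at_def using H2(1) by simp
    obtain v where "v \<in> {a, b, c, d}" "v \<in> nodes L1" using o 1(1) quadrilateral_move(1) by blast
    then have "has_quadrilateral L1"
      using quadrilateral_in_component[OF H1(1) 1(4) Q] by blast
    then show ?thesis using 1 by (auto simp: irreducible_web_def)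
  next
    case component_move
    obtain r where "r \<in> nodes L1" "r \<in> nodes L2" using o 1(1) component_move(1) by blast
    then have "L1 = L2"
      using component_unique[OF H1(1) _ 1(4) H2(1) _ component_move(4)] 1(3) component_move(3)
      unfolding irreducible_web_def by blast
    then show ?thesis using 1 component_move H1(1) H2(1) by simp
  qed
qed

section \<open>Existence and uniqueness of the evaluation\<close>

lemma reduces_to_first_step_value:
  fixes H :: "'v dgraph"
  assumes "reduces_to H p" "size H = N" "closed_web H"
  obtains (empty) "H = {#}" "p = 1"
  | (move) G V L Rs where "H = G + L" "web_move H V L Rs" "p = move_value G Rs"
  | (smooth) G a w b where "H = G + {#(a, w), (w, b)#}" "w \<notin> nodes G" "w \<noteq> a" "w \<noteq> b"
      "p = web_eval (G + {#(a, b)#})"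
  using assms(1)
proof (cases rule: reduces_to_first_step)
  case empty
  then show ?thesis by (rule that(1))
next
  case (move G V L Rs g)
  have "p = move_value G Rs"
    unfolding move_value_def move(4)
  proof (rule sum_list_pair_cong)
    fix c R assume cR: "(c, R) \<in> set Rs"
    have "size (G + R) < N" using web_move_nodes(3)[OF move(2) cR] assms(2) move(1) by auto
    moreover have "closed_web (G + R)"
      using web_move_closed[OF move(2)[unfolded move(1)] assms(3)[unfolded move(1)] cR] .
    ultimately show "c * g (G + R) = c * web_eval (G + R)"
      using web_eval_eqI[OF _ _ move(3)[OF cR]] by simp
  qed
  with move show ?thesis by (intro that(2))
next
  case (smooth G a w b)
  have "size (G + {#(a, b)#}) < N" using assms(2) smooth(1) by auto
  moreover have "closed_web (G + {#(a, b)#})"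
    using smooth_closed_web[OF smooth(2-4)] assms(3) smooth(1) by simp
  ultimately have "p = web_eval (G + {#(a, b)#})" using web_eval_eqI[OF _ _ smooth(5)] by simp
  with smooth show ?thesis by (intro that(3))
qed

lemma reduces_to_unique:
  fixes H :: "'v dgraph"
  assumes p: "reduces_to H p" and q: "reduces_to H q" and H: "size H = N" "closed_web H"
  shows "p = q"
proof -
  have L: "L \<noteq> {#}" if "web_move H V L Rs" for V L Rs
    using that by (auto elim!: web_move.cases simp: irreducible_web_def)
  from p H show ?thesis
  proof (cases rule: reduces_to_first_step_value)
    case 1: empty
    from q H show ?thesis
      by (cases rule: reduces_to_first_step_value) (use 1 L in auto)
  next
    case 1: (move G V L Rs)
    from q H show ?thesis
    proof (cases rule: reduces_to_first_step_value)
      case empty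
      then show ?thesis using 1 L by auto
    next
      case (move G' V' L' Rs')
      then show ?thesis
        using 1 disjoint_moves[OF 1(1) move(1) H 1(2) move(2)] overlapping_moves[OF 1(1,2) move(1,2) _ H]
        by (cases "V \<inter> V' = {}") simp_all
    next
      case (smooth G' a w b)
      then show ?thesis using 1 smooth_commutes_move[OF smooth(1) 1(1) H smooth(2-4) 1(2)] by simp
    qed
  next
    case 1: (smooth G a w b)
    from q H show ?thesis
    proof (cases rule: reduces_to_first_step_value)
      case empty
      then show ?thesis using 1 by auto
    next
      case (move G' V' L' Rs')
      then show ?thesis using 1 smooth_commutes_move[OF 1(1) move(1) H 1(2-4) move(2)] by simp
    next
      case (smooth G' a' w' b')
      then show ?thesis using 1 smooths_commute[OF 1(1) smooth(1) H 1(2-4) smooth(2-4)] by simp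
    qed
  qed
qed

lemma reduces_to_exists:
  fixes H :: "'v dgraph"
  assumes H: "size H = N" "closed_web H"
  shows "\<exists>p. reduces_to H p"
proof (cases "H = {#}")
  case True
  then show ?thesis using reduces_to.empty by blast
next
  case False
  with H(2) show ?thesis
  proof (cases rule: closed_web_obtain_step)
    case (move G V L Rs)
    then show ?thesis using reduces_to_move_value[of G L V Rs] H by auto
  next
    case (smooth G a w b)
    have "reduces_to (G + {#(a, b)#}) (web_eval (G + {#(a, b)#}))"
      using smooth_closed_web[OF smooth(2-4)] H smooth(1) by (intro reduces_to_web_eval) auto
    then show ?thesis using reduces_to_smooth[OF smooth(2-4)] smooth(1) by blast
  qed
qed

end

theorem reduces_to_ex1:
  fixes G :: "'v dgraph"
  assumes "closed_web G" shows "\<exists>!p. reduces_to G p"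
  using assms
proof (induction "size G" arbitrary: G rule: less_induct)
  case less
  interpret unique_below "size G" by unfold_locales (use less in blast)
  show ?case using reduces_to_exists[OF HOL.refl less.prems] reduces_to_unique[OF _ _ HOL.refl less.prems] by blast
qed

lemma reduces_to_web_eval: "closed_web G \<Longrightarrow> reduces_to G (web_eval G)"
  unfolding web_eval_def by (rule theI'[OF reduces_to_ex1])

lemma web_eval_eqI: "closed_web G \<Longrightarrow> reduces_to G p \<Longrightarrow> web_eval G = p"
  unfolding web_eval_def by (rule the1_equality[OF reduces_to_ex1])

lemma local_rel_closed_web:
  assumes "local_rel G x" "H \<in> Poly_Mapping.keys x" "closed_web G" shows "closed_web H"
  unfolding closed_web_def
proof
  fix v assume v: "v \<in> nodes H"
  then have "trivalent_or_point G v"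
    using local_rel_degrees(3)[OF assms(1,2)] assms(3) unfolding closed_web_def by blast
  then show "trivalent_or_point H v"
    using local_rel_degrees(1)[OF assms(1,2) v] by (auto simp: trivalent_defs)
qed

lemma web_eval_local_rel:
  assumes "local_rel G x" "closed_web G" shows "web_eval G = lin_ext web_eval x"
  by (rule web_eval_eqI[OF assms(2) reduces_to.relation[OF assms(1)]])
     (rule reduces_to_web_eval[OF local_rel_closed_web[OF assms(1) _ assms(2)]])

lemma web_eval_smooths:
  assumes "smooths G H" "closed_web G" shows "web_eval G = web_eval H"
  using assms
proof (induction rule: smooths.induct)
  case (smooths_step w G a b H)
  have "web_eval (G + {#(a, w), (w, b)#}) = web_eval (G + {#(a, b)#})"
    using web_eval_local_rel[OF local_rel.smooth[OF smooths_step.hyps(1-3)] smooths_step.prems] by simp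
  then show ?case
    using smooths_step.IH smooth_closed_web[OF smooths_step.hyps(1-3)] smooths_step.prems by simp
qed simp


section \<open>Morphisms of the graph category\<close>

lemma open_graph_inner: "open_graph m n G \<Longrightarrow> Inner k \<in> nodes G \<Longrightarrow> trivalent_or_point G (Inner k)"
  unfolding open_graph_def trivalent_or_point_def by blast

lemma open_graph_low: "open_graph m n G \<Longrightarrow> Low j \<in> nodes G \<longleftrightarrow> j \<in> {1..m}"
  and open_graph_up: "open_graph m n G \<Longrightarrow> Up j \<in> nodes G \<longleftrightarrow> j \<in> {1..n}"
  unfolding open_graph_def by (metis nodes_deg one_neq_zero)+

lemma open_graph_degrees:
  assumes "open_graph m n G"
  shows "j \<in> {1..m} \<Longrightarrow> outdeg G (Low j) = 1" "indeg G (Low j) = 0"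
    "j \<in> {1..n} \<Longrightarrow> indeg G (Up j) = 1" "outdeg G (Up j) = 0"
  using assms unfolding open_graph_def by (metis deg_notin_nodes)+

lemma open_graphI:
  assumes "\<And>j. outdeg G (Low j) = (if j \<in> {1..m} then 1 else 0)" "\<And>j. indeg G (Low j) = 0"
    "\<And>j. indeg G (Up j) = (if j \<in> {1..n} then 1 else 0)" "\<And>j. outdeg G (Up j) = 0"
    "\<And>k. Inner k \<in> nodes G \<Longrightarrow> trivalent_or_point G (Inner k)"
  shows "open_graph m n G"
  using assms unfolding open_graph_def trivalent_or_point_def nodes_deg by simp

lemma open_graph_outdeg_low: "open_graph m n G \<Longrightarrow> outdeg G (Low j) = (if j \<in> {1..m} then 1 else 0)"
  and open_graph_indeg_up: "open_graph m n G \<Longrightarrow> indeg G (Up j) = (if j \<in> {1..n} then 1 else 0)"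
  unfolding open_graph_def by (metis deg_notin_nodes)+

text \<open>A free end has total degree one, so the nodes whose degrees enter a local relation are
  always inner.\<close>

lemma open_graph_trivalent:
  assumes "open_graph m n G" "trivalent_or_point G v" shows "\<exists>k. v = Inner k"
  using assms(2) open_graph_outdeg_low[OF assms(1)] open_graph_indeg_up[OF assms(1)]
    open_graph_degrees(2,4)[OF assms(1)]
  by (cases v) (auto simp: trivalent_defs split: if_splits)

lemma local_rel_open_graph:
  assumes "local_rel G x" "H \<in> Poly_Mapping.keys x" "open_graph m n G"
  shows "open_graph m n H"
proof -
  note d = local_rel_degrees[OF assms(1,2)]
  have ends: "outdeg H v = outdeg G v \<and> indeg H v = indeg G v" if v: "\<And>k. v \<noteq> Inner k" for v
  proof -
    have nt: "\<not> trivalent_or_point G v" using open_graph_trivalent[OF assms(3)] v by blast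
    show ?thesis
    proof (cases "v \<in> nodes H")
      case True
      then show ?thesis using d(1)[OF True] nt by (auto simp: trivalent_or_point_def)
    next
      case False
      then have "v \<notin> nodes G" using d(2) nt by (auto simp: trivalent_or_point_def)
      then show ?thesis using False by (simp add: deg_notin_nodes)
    qed
  qed
  show ?thesis
  proof (rule open_graphI)
    fix k assume k: "Inner k \<in> nodes H"
    then have "trivalent_or_point G (Inner k)" using open_graph_inner[OF assms(3)] d(3) by blast
    then show "trivalent_or_point H (Inner k)" using d(1)[OF k] by (auto simp: trivalent_defs)
  qed (use ends open_graph_outdeg_low[OF assms(3)] open_graph_indeg_up[OF assms(3)]
        open_graph_degrees[OF assms(3)] in simp_all)
qed

lemma graph_combs_single: "open_graph m n G \<Longrightarrow> Poly_Mapping.single G c \<in> graph_combs m n"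
  unfolding graph_combs_def by simp

lemma graph_combs_0: "0 \<in> graph_combs m n"
  unfolding graph_combs_def by simp

lemma graph_combs_add: "x \<in> graph_combs m n \<Longrightarrow> y \<in> graph_combs m n \<Longrightarrow> x + y \<in> graph_combs m n"
  unfolding graph_combs_def by (auto dest!: subsetD[OF keys_add])

lemma graph_combs_lscale: "x \<in> graph_combs m n \<Longrightarrow> lscale c x \<in> graph_combs m n"
  unfolding graph_combs_def by (auto dest!: subsetD[OF keys_lscale])

lemma graph_combs_minus: "x \<in> graph_combs m n \<Longrightarrow> - x \<in> graph_combs m n"
  using graph_combs_lscale[of x m n "-1"] by (simp add: lscale_minus_left)

lemma graph_combs_diff: "x \<in> graph_combs m n \<Longrightarrow> y \<in> graph_combs m n \<Longrightarrow> x - y \<in> graph_combs m n"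
  using graph_combs_add[OF _ graph_combs_minus, of x m n y] by simp

lemma graph_combs_lin_ext:
  assumes "\<And>a. a \<in> Poly_Mapping.keys x \<Longrightarrow> g a \<in> graph_combs m n"
  shows "lin_ext g x \<in> graph_combs m n"
  using assms unfolding graph_combs_def by (auto dest!: subsetD[OF keys_lin_ext])

lemma graph_relators_combs: "graph_relators m n \<subseteq> graph_combs m n"
proof
  fix r assume "r \<in> graph_relators m n"
  then consider G \<phi> where "r = Poly_Mapping.single G 1 - Poly_Mapping.single (rename \<phi> G) 1"
      "open_graph m n G" "open_graph m n (rename \<phi> G)"
    | G x where "r = Poly_Mapping.single G 1 - x" "open_graph m n G" "local_rel G x"
    unfolding graph_relators_def by blast
  then show "r \<in> graph_combs m n"
  proof cases
    case (2 G x)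
    then have "x \<in> graph_combs m n" unfolding graph_combs_def using local_rel_open_graph by blast
    with 2 show ?thesis by (simp add: graph_combs_diff graph_combs_single)
  qed (simp add: graph_combs_diff graph_combs_single)
qed

lemma graph_span_combs: "graph_span m n \<subseteq> graph_combs m n"
proof
  fix x assume "x \<in> graph_span m n"
  then show "x \<in> graph_combs m n"
  proof (induction rule: graph_span.induct)
    case (add x r c)
    then show ?case using subsetD[OF graph_relators_combs] by (intro graph_combs_add graph_combs_lscale)
  qed (rule graph_combs_0)
qed

lemma graph_span_relator: "r \<in> graph_relators m n \<Longrightarrow> r \<in> graph_span m n"
  using graph_span.add[OF graph_span.zero, of r m n 1] by simp

lemma graph_span_add: "y \<in> graph_span m n \<Longrightarrow> x \<in> graph_span m n \<Longrightarrow> x + y \<in> graph_span m n"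
  by (induction rule: graph_span.induct) (auto simp: add.assoc[symmetric] intro: graph_span.add)

lemma graph_span_lscale: "x \<in> graph_span m n \<Longrightarrow> lscale c x \<in> graph_span m n"
  by (induction rule: graph_span.induct)
     (auto simp: lscale_add_right intro: graph_span.zero graph_span.add)

lemma graph_span_minus: "x \<in> graph_span m n \<Longrightarrow> - x \<in> graph_span m n"
  using graph_span_lscale[of x m n "-1"] by (simp add: lscale_minus_left)

lemma graph_span_diff: "x \<in> graph_span m n \<Longrightarrow> y \<in> graph_span m n \<Longrightarrow> x - y \<in> graph_span m n"
  using graph_span_add[OF graph_span_minus, of y m n x] by simp

lemma graph_class_eq_iff: "graph_class m n x = graph_class m n y \<longleftrightarrow> x - y \<in> graph_span m n"
proof
  assume "graph_class m n x = graph_class m n y"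
  moreover have "x \<in> graph_class m n x" unfolding graph_class_def by (simp add: graph_span.zero)
  ultimately show "x - y \<in> graph_span m n" unfolding graph_class_def by blast
next
  assume d: "x - y \<in> graph_span m n"
  have "z - x \<in> graph_span m n \<longleftrightarrow> z - y \<in> graph_span m n" for z
    using graph_span_add[OF d, of "z - x"] graph_span_diff[OF _ d, of "z - y"] by auto
  then show "graph_class m n x = graph_class m n y" unfolding graph_class_def by simp
qed

lemma graph_class_self: "x \<in> graph_class m n x"
  unfolding graph_class_def by (simp add: graph_span.zero)

lemma graph_class_memD: "y \<in> graph_class m n x \<Longrightarrow> y - x \<in> graph_span m n"
  unfolding graph_class_def by simp

lemma graph_class_combs: "x \<in> graph_combs m n \<Longrightarrow> y \<in> graph_class m n x \<Longrightarrow> y \<in> graph_combs m n"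
  using graph_combs_add[of x m n "y - x"] graph_span_combs graph_class_memD by fastforce

lemma GraphCat_add_class:
  "GraphCat_add m n (graph_class m n x) (graph_class m n y) = graph_class m n (x + y)"
proof -
  have "graph_class m n (x' + y') = graph_class m n (x + y)"
    if "x' \<in> graph_class m n x" "y' \<in> graph_class m n y" for x' y'
    unfolding graph_class_eq_iff
    using graph_span_add[OF graph_class_memD[OF that(2)] graph_class_memD[OF that(1)]]
    by (simp add: algebra_simps)
  then have "GraphCat_add m n (graph_class m n x) (graph_class m n y) =
      (\<Union>x'\<in>graph_class m n x. \<Union>y'\<in>graph_class m n y. graph_class m n (x + y))"
    unfolding GraphCat_add_def by (intro SUP_cong HOL.refl)
  then show ?thesis using graph_class_self[of x m n] graph_class_self[of y m n] by auto
qed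

lemma GraphCat_scale_class:
  "GraphCat_scale m n c (graph_class m n x) = graph_class m n (lscale c x)"
proof -
  have "graph_class m n (lscale c x') = graph_class m n (lscale c x)"
    if "x' \<in> graph_class m n x" for x'
    unfolding graph_class_eq_iff
    using graph_span_lscale[OF graph_class_memD[OF that], of c] by (simp add: lscale_diff_right)
  then have "GraphCat_scale m n c (graph_class m n x) =
      (\<Union>x'\<in>graph_class m n x. graph_class m n (lscale c x))"
    unfolding GraphCat_scale_def by (intro SUP_cong HOL.refl)
  then show ?thesis using graph_class_self[of x m n] by auto
qed

lemma graph_class_local_rel:
  assumes "open_graph m n G" "local_rel G x"
  shows "graph_class m n (Poly_Mapping.single G 1) = graph_class m n x"
  unfolding graph_class_eq_iff
  by (rule graph_span_relator) (use assms in \<open>auto simp: graph_relators_def\<close>)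

lemma graph_class_rename:
  assumes G: "open_graph m n G" "open_graph m n (rename \<phi> G)" and inj: "inj_on \<phi> (nodes G)"
    and fixed: "\<And>j. Low j \<in> nodes G \<Longrightarrow> \<phi> (Low j) = Low j" "\<And>j. Up j \<in> nodes G \<Longrightarrow> \<phi> (Up j) = Up j"
  shows "graph_class m n (Poly_Mapping.single G 1) = graph_class m n (Poly_Mapping.single (rename \<phi> G) 1)"
  unfolding graph_class_eq_iff
proof (rule graph_span_relator)
  \<comment> \<open>A relator requires all names of ends to be fixed, including those that do not
    occur in \<open>G\<close>; outside \<open>G\<close> the renaming is therefore replaced by the
    identity.\<close>
  define \<psi> where "\<psi> v = (if v \<in> nodes G then \<phi> v else v)" for v
  have eq: "rename \<phi> G = rename \<psi> G" by (rule rename_cong) (simp add: \<psi>_def)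
  have "inj_on \<psi> (nodes G)" using inj by (simp add: \<psi>_def inj_on_def)
  moreover have "\<psi> (Low j) = Low j" "\<psi> (Up j) = Up j" for j using fixed by (simp_all add: \<psi>_def)
  ultimately show "Poly_Mapping.single G 1 - Poly_Mapping.single (rename \<phi> G) 1 \<in> graph_relators m n"
    using G unfolding graph_relators_def eq by blast
qed

lemma smooths_open_graph:
  assumes "smooths G H" "open_graph m n G"
  shows "open_graph m n H"
    and "graph_class m n (Poly_Mapping.single G 1) = graph_class m n (Poly_Mapping.single H 1)"
proof -
  have "open_graph m n H \<and>
      graph_class m n (Poly_Mapping.single G 1) = graph_class m n (Poly_Mapping.single H 1)"
    using assms
  proof (induction rule: smooths.induct)
    case (smooths_step w G a b H)
    note rel = local_rel.smooth[OF smooths_step.hyps(1-3)]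
    have "open_graph m n (G + {#(a, b)#})"
      using local_rel_open_graph[OF rel _ smooths_step.prems] by simp
    then show ?case
      using smooths_step.IH graph_class_local_rel[OF smooths_step.prems rel] by simp
  qed simp
  then show "open_graph m n H"
    "graph_class m n (Poly_Mapping.single G 1) = graph_class m n (Poly_Mapping.single H 1)" by blast+
qed

text \<open>\<open>G\<close> and its image have the same free ends and \<phi> fixes them, so by
  injectivity no inner node can be sent to an end.\<close>

lemma open_rename_inner:
  assumes G: "open_graph m n G" "open_graph m n (rename \<phi> G)" and inj: "inj_on \<phi> (nodes G)"
    and fixed: "\<And>j. \<phi> (Low j) = Low j \<and> \<phi> (Up j) = Up j" and k: "Inner k \<in> nodes G"
  shows "\<exists>k'. \<phi> (Inner k) = Inner k'"
proof (cases "\<phi> (Inner k)")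
  case (Low j)
  have "\<phi> (Inner k) \<in> nodes (rename \<phi> G)" using k by simp
  then have "Low j \<in> nodes G" using open_graph_low[OF G(1)] open_graph_low[OF G(2)] unfolding Low by blast
  then show ?thesis using inj_onD[OF inj, of "Inner k" "Low j"] fixed k Low by simp
next
  case (Up j)
  have "\<phi> (Inner k) \<in> nodes (rename \<phi> G)" using k by simp
  then have "Up j \<in> nodes G" using open_graph_up[OF G(1)] open_graph_up[OF G(2)] unfolding Up by blast
  then show ?thesis using inj_onD[OF inj, of "Inner k" "Up j"] fixed k Up by simp
qed simp

section \<open>The trace\<close>

lemma graph_closure_degrees:
  "outdeg (graph_closure G) (Low j) = outdeg G (Low j) + outdeg G (Up j)"
  "indeg (graph_closure G) (Low j) = indeg G (Low j) + indeg G (Up j)"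
  "outdeg (graph_closure G) (Inner k) = outdeg G (Inner k)"
  "indeg (graph_closure G) (Inner k) = indeg G (Inner k)"
  "outdeg (graph_closure G) (Up j) = 0" "indeg (graph_closure G) (Up j) = 0"
  unfolding graph_closure_def
  by (induction G; auto simp: outdeg_simps elim!: identify_ends.elims)+

lemma closed_web_graph_closure:
  assumes "open_graph n n G" shows "closed_web (graph_closure G)"
  unfolding closed_web_def
proof
  fix v assume v: "v \<in> nodes (graph_closure G)"
  show "trivalent_or_point (graph_closure G) v"
  proof (cases v)
    case (Low j)
    then show ?thesis using v open_graph_degrees[OF assms, of j] open_graph_outdeg_low[OF assms, of j]
        open_graph_indeg_up[OF assms, of j]
      by (auto simp: nodes_deg trivalent_defs graph_closure_degrees split: if_splits)
  next
    case (Inner k)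
    then have "Inner k \<in> nodes G" using v by (simp add: nodes_deg graph_closure_degrees)
    then show ?thesis using open_graph_inner[OF assms, of k] Inner
      by (simp add: trivalent_defs graph_closure_degrees)
  next
    case (Up j)
    then show ?thesis using v by (simp add: nodes_deg graph_closure_degrees)
  qed
qed

abbreviation closure_eval :: "node dgraph \<Rightarrow> tpoly" where
  "closure_eval \<equiv> \<lambda>G. web_eval (graph_closure G)"

lemma closure_eval_rename:
  assumes G: "open_graph n n G" "open_graph n n (rename \<phi> G)" and inj: "inj_on \<phi> (nodes G)"
    and fixed: "\<And>j. \<phi> (Low j) = Low j \<and> \<phi> (Up j) = Up j"
  shows "closure_eval (rename \<phi> G) = closure_eval G"
proof -
  \<comment> \<open>In the closure every joint is named after its lower end, which \<phi> fixes, so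
    only inner names have to move.\<close>
  define \<psi> where "\<psi> v = (case v of Inner k \<Rightarrow> \<phi> (Inner k) | _ \<Rightarrow> v)" for v
  note inner = open_rename_inner[OF G inj fixed]
  have "graph_closure (rename \<phi> G) = rename \<psi> (graph_closure G)"
    unfolding graph_closure_def rename_rename
  proof (rule rename_cong)
    fix v assume "v \<in> nodes G"
    then show "identify_ends (\<phi> v) = \<psi> (identify_ends v)"
      using fixed by (cases v) (auto simp: \<psi>_def dest!: inner)
  qed
  moreover have "inj_on \<psi> (nodes (graph_closure G))"
  proof (rule inj_onI)
    fix u v assume uv: "u \<in> nodes (graph_closure G)" "v \<in> nodes (graph_closure G)" "\<psi> u = \<psi> v"
    have *: "Inner k \<in> nodes G" if "Inner k \<in> nodes (graph_closure G)" for k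
      using that by (simp add: nodes_deg graph_closure_degrees)
    show "u = v"
      using uv inj_onD[OF inj, of u v] *
      by (cases u; cases v) (auto simp: \<psi>_def dest!: * dest: inner)
  qed
  ultimately show ?thesis using web_eval_rename by metis
qed

text \<open>Closing merges only free ends, and these are never the vertices of a relation, so the
  relation persists in the closure.\<close>

lemma closure_eval_local_rel:
  assumes "open_graph n n G" "local_rel G x"
  shows "closure_eval G = lin_ext closure_eval x"
proof -
  have "isolates identify_ends G v" if tv: "trivalent_or_point G v" for v
  proof -
    obtain k where "v = Inner k" using open_graph_trivalent[OF assms(1) tv] by blast
    then show ?thesis unfolding isolates_def by (auto elim!: identify_ends.elims)
  qed
  then have "local_rel (graph_closure G) (lin_ext (\<lambda>H. Poly_Mapping.single (graph_closure H) 1) x)"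
    using local_rel_rename[OF assms(2), of identify_ends "{#}"] by (simp add: graph_closure_def)
  from web_eval_local_rel[OF this closed_web_graph_closure[OF assms(1)]]
  show ?thesis by (simp add: lin_ext_lin_ext)
qed

lemma closure_eval_graph_span:
  assumes "x \<in> graph_span n n" shows "lin_ext closure_eval x = 0"
  using assms
proof (induction rule: graph_span.induct)
  case (add x r c)
  have "lin_ext closure_eval r = 0"
    using add.hyps(2) unfolding graph_relators_def
    by (auto simp: lin_ext_diff closure_eval_rename closure_eval_local_rel)
  then show ?case using add.IH by (simp add: lin_ext_add lin_ext_lscale)
qed simp

text \<open>The evaluation of closures is constant on a class, which is what makes
  \<open>the_elem\<close> in \<open>Trace\<close> meaningful.\<close>

lemma Trace_graph_class: "Trace (graph_class n n x) = lin_ext closure_eval x"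
proof -
  have "lin_ext closure_eval y = lin_ext closure_eval x" if "y \<in> graph_class n n x" for y
    using closure_eval_graph_span[OF graph_class_memD[OF that]] by (simp add: lin_ext_diff)
  then have "lin_ext closure_eval ` graph_class n n x = {lin_ext closure_eval x}"
    using graph_class_self[of x n n] by blast
  then show ?thesis unfolding Trace_def by simp
qed


section \<open>Composition\<close>

lemma mod_3_simps:
  "(3 * k) mod 3 = (0::nat)" "Suc (3 * k) mod 3 = Suc 0" "Suc (Suc (3 * k)) mod 3 = 2"
  "Suc (3 * k) div 3 = k" "Suc (Suc (3 * k)) div 3 = k"
  by presburger+

lemma inj_in_upper: "inj in_upper"
proof (rule injI)
  fix u v show "in_upper u = in_upper v \<Longrightarrow> u = v"
    by (cases u; cases v) (simp; presburger)+
qed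

lemma inj_in_lower: "inj in_lower"
proof (rule injI)
  fix u v show "in_lower u = in_lower v \<Longrightarrow> u = v"
    by (cases u; cases v) (simp; presburger)+
qed

lemma in_upper_notin:
  "Low j \<notin> in_upper ` S" "Inner (3 * k) \<notin> in_upper ` S"
  by (auto elim!: in_upper.elims[OF HOL.sym]) presburger+

lemma in_lower_notin:
  "Up j \<notin> in_lower ` S" "Inner (3 * k + 1) \<notin> in_lower ` S"
  by (auto elim!: in_lower.elims[OF HOL.sym]) presburger+

lemma deg_rename_inj:
  assumes "inj \<phi>"
  shows "outdeg (rename \<phi> G) (\<phi> v) = outdeg G v" "indeg (rename \<phi> G) (\<phi> v) = indeg G v"
  using assms deg_rename[of \<phi> G v] by (auto simp: isolates_def inj_eq)

lemmas deg_in_upper = deg_rename_inj[OF inj_in_upper, of _ "Low _", simplified]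
  deg_rename_inj[OF inj_in_upper, of _ "Inner _", simplified]
  deg_rename_inj[OF inj_in_upper, of _ "Up _", simplified]

lemmas deg_in_lower = deg_rename_inj[OF inj_in_lower, of _ "Low _", simplified]
  deg_rename_inj[OF inj_in_lower, of _ "Inner _", simplified]
  deg_rename_inj[OF inj_in_lower, of _ "Up _", simplified]

lemma graph_comp_degrees:
  "outdeg (graph_comp G H) (Low j) = outdeg H (Low j)"
  "indeg (graph_comp G H) (Low j) = indeg H (Low j)"
  "outdeg (graph_comp G H) (Up j) = outdeg G (Up j)"
  "indeg (graph_comp G H) (Up j) = indeg G (Up j)"
  "outdeg (graph_comp G H) (Inner (3 * k)) = outdeg H (Inner k)"
  "indeg (graph_comp G H) (Inner (3 * k)) = indeg H (Inner k)"
  "outdeg (graph_comp G H) (Inner (3 * k + 1)) = outdeg G (Inner k)"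
  "indeg (graph_comp G H) (Inner (3 * k + 1)) = indeg G (Inner k)"
  "outdeg (graph_comp G H) (Inner (3 * k + 2)) = outdeg G (Low k) + outdeg H (Up k)"
  "indeg (graph_comp G H) (Inner (3 * k + 2)) = indeg G (Low k) + indeg H (Up k)"
  using in_upper_notin[of _ "nodes G"] in_lower_notin[of _ "nodes H"]
  by (simp_all add: graph_comp_def outdeg_simps deg_in_upper deg_in_lower deg_notin_nodes)

lemma nat_mod_3_cases:
  fixes k :: nat
  obtains q where "k = 3 * q" | q where "k = 3 * q + 1" | q where "k = 3 * q + 2"
proof -
  have "k = 3 * (k div 3) \<or> k = 3 * (k div 3) + 1 \<or> k = 3 * (k div 3) + 2" by presburger
  then show ?thesis using that by blast
qed

lemma open_graph_comp:
  assumes G: "open_graph p n G" and H: "open_graph m p H"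
  shows "open_graph m n (graph_comp G H)"
proof (rule open_graphI)
  fix k assume k: "Inner k \<in> nodes (graph_comp G H)"
  show "trivalent_or_point (graph_comp G H) (Inner k)"
  proof (cases k rule: nat_mod_3_cases)
    case (1 q)
    then show ?thesis using k open_graph_inner[OF H, of q]
      by (simp add: nodes_deg trivalent_defs graph_comp_degrees)
  next
    case (2 q)
    then show ?thesis using k open_graph_inner[OF G, of q] graph_comp_degrees(7,8)[of G H q]
      by (simp add: nodes_deg trivalent_defs)
  next
    case (3 q)
    then show ?thesis using k graph_comp_degrees(9,10)[of G H q] open_graph_outdeg_low[OF G, of q]
        open_graph_indeg_up[OF H, of q] open_graph_degrees[OF G, of q] open_graph_degrees[OF H, of q]
      by (auto simp add: nodes_deg trivalent_defs split: if_splits)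
  qed
qed (use open_graph_outdeg_low[OF H] open_graph_indeg_up[OF G] open_graph_degrees[OF G] open_graph_degrees[OF H]
    in \<open>simp_all add: graph_comp_degrees\<close>)

lemma bilin_ext_combs:
  assumes "x \<in> graph_combs p n" "y \<in> graph_combs m p"
  shows "bilin_ext graph_comp x y \<in> graph_combs m n"
  using assms unfolding graph_combs_def
  by (auto dest!: subsetD[OF keys_bilin_ext] intro: open_graph_comp)

lemma graph_span_lin_ext:
  assumes "laurent_linear F" "\<And>a. a \<in> Poly_Mapping.keys x \<Longrightarrow> F (Poly_Mapping.single a 1) \<in> graph_span m n"
  shows "F x \<in> graph_span m n"
  using laurent_linear_in_submodule[OF assms(1) graph_span.zero _ _ assms(2)] graph_span_add graph_span_lscale
  by metis

lemma graph_class_linear_eq: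
  assumes "laurent_linear F" "laurent_linear F'"
    and "\<And>a. a \<in> Poly_Mapping.keys x \<Longrightarrow>
      graph_class m n (F (Poly_Mapping.single a 1)) = graph_class m n (F' (Poly_Mapping.single a 1))"
  shows "graph_class m n (F x) = graph_class m n (F' x)"
  unfolding graph_class_eq_iff
  by (rule graph_span_lin_ext[OF laurent_linear_diff_fun[OF assms(1,2)]])
     (use assms(3) in \<open>simp add: graph_class_eq_iff\<close>)

text \<open>Composition with a fixed graph turns relators into relators: a renaming extends by the
  identity to the composite, and the vertices of a local relation are inner nodes, which composition
  keeps apart from all others.\<close>

lemma graph_comp_relator_left:
  assumes r: "r \<in> graph_relators p n" and H: "open_graph m p H"
  shows "bilin_ext graph_comp r (Poly_Mapping.single H 1) \<in> graph_span m n"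
proof -
  from r consider G \<phi> where "r = Poly_Mapping.single G 1 - Poly_Mapping.single (rename \<phi> G) 1"
      "open_graph p n G" "open_graph p n (rename \<phi> G)" "inj_on \<phi> (nodes G)"
      "\<And>j. \<phi> (Low j) = Low j \<and> \<phi> (Up j) = Up j"
    | G x where "r = Poly_Mapping.single G 1 - x" "open_graph p n G" "local_rel G x"
    unfolding graph_relators_def by blast
  then show ?thesis
  proof cases
    case (1 G \<phi>)
    note inner = open_rename_inner[OF 1(2-5)]
    \<comment> \<open>Residue 1 marks the inner nodes of the upper factor, and \<phi> acts on them
      through \<open>k div 3\<close>. The joints, of residue 2, and the lower factor stay
      fixed.\<close>
    define \<psi> where "\<psi> v = (case v of Inner k \<Rightarrow> if k mod 3 = 1 then in_upper (\<phi> (Inner (k div 3))) else v | _ \<Rightarrow> v)" for v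
    have up: "\<psi> (in_upper v) = in_upper (\<phi> v)" for v
      using 1(5) by (cases v) (simp_all add: \<psi>_def mod_3_simps)
    have lo: "\<psi> (in_lower v) = in_lower v" for v
      by (cases v) (simp_all add: \<psi>_def mod_3_simps)
    have eq: "graph_comp (rename \<phi> G) H = rename \<psi> (graph_comp G H)"
      unfolding graph_comp_def by (simp add: rename_rename up lo)
    have "inj_on \<psi> (in_upper ` nodes G \<union> in_lower ` nodes H)"
    proof (rule inj_onI)
      have ne: "in_upper (\<phi> u) = in_lower v \<longleftrightarrow> in_upper u = in_lower v" if "u \<in> nodes G" for u v
        using 1(5) that by (cases u; cases v) (auto dest!: inner; presburger)+
      have inj: "in_upper (\<phi> u) = in_upper (\<phi> v) \<longleftrightarrow> in_upper u = in_upper v" if "u \<in> nodes G" "v \<in> nodes G" for u v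
        using inj_onD[OF 1(4) _ that] inj_in_upper by (auto simp: inj_eq)
      fix x y assume xy: "x \<in> in_upper ` nodes G \<union> in_lower ` nodes H"
        "y \<in> in_upper ` nodes G \<union> in_lower ` nodes H" "\<psi> x = \<psi> y"
      then show "x = y"
        by (auto simp: up lo inj ne) (metis ne)+
    qed
    then have inj: "inj_on \<psi> (nodes (graph_comp G H))" by (simp add: graph_comp_def)
    have "graph_class m n (Poly_Mapping.single (graph_comp G H) 1) =
        graph_class m n (Poly_Mapping.single (rename \<psi> (graph_comp G H)) 1)"
      by (rule graph_class_rename[OF open_graph_comp[OF 1(2) H] _ inj])
         (use open_graph_comp[OF 1(3) H] eq in \<open>simp_all add: \<psi>_def\<close>)
    then show ?thesis
      unfolding graph_class_eq_iff 1(1) by (simp add: bilin_ext_diff_left eq)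
  next
    case (2 G x)
    have "local_rel (graph_comp G H) (lin_ext (\<lambda>G'. Poly_Mapping.single (graph_comp G' H) 1) x)"
      unfolding graph_comp_def
    proof (rule local_rel_rename[OF 2(3)])
      fix v assume "trivalent_or_point G v"
      then obtain k where v: "v = Inner k" using open_graph_trivalent[OF 2(2)] by blast
      have "isolates in_upper G v" using inj_in_upper by (simp add: isolates_def inj_eq)
      then show "isolates in_upper G v \<and> in_upper v \<notin> nodes (rename in_lower H)"
        using in_lower_notin[of k "nodes H"] by (simp add: v)
    qed
    from graph_class_local_rel[OF open_graph_comp[OF 2(2) H] this] show ?thesis
      unfolding graph_class_eq_iff 2(1) by (simp add: bilin_ext_lin_ext lin_ext_diff)
  qed
qed

lemma graph_comp_relator_right:
  assumes r: "r \<in> graph_relators m p" and H: "open_graph p n H"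
  shows "bilin_ext graph_comp (Poly_Mapping.single H 1) r \<in> graph_span m n"
proof -
  from r consider G \<phi> where "r = Poly_Mapping.single G 1 - Poly_Mapping.single (rename \<phi> G) 1"
      "open_graph m p G" "open_graph m p (rename \<phi> G)" "inj_on \<phi> (nodes G)"
      "\<And>j. \<phi> (Low j) = Low j \<and> \<phi> (Up j) = Up j"
    | G x where "r = Poly_Mapping.single G 1 - x" "open_graph m p G" "local_rel G x"
    unfolding graph_relators_def by blast
  then show ?thesis
  proof cases
    case (1 G \<phi>)
    note inner = open_rename_inner[OF 1(2-5)]
    \<comment> \<open>As for the other factor, with residue 0 marking the inner nodes of the lower
      graph.\<close>
    define \<psi> where "\<psi> v = (case v of Inner k \<Rightarrow> if k mod 3 = 0 then in_lower (\<phi> (Inner (k div 3))) else v | _ \<Rightarrow> v)" for v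
    have lo: "\<psi> (in_lower v) = in_lower (\<phi> v)" for v
      using 1(5) by (cases v) (simp_all add: \<psi>_def mod_3_simps)
    have up: "\<psi> (in_upper v) = in_upper v" for v
      by (cases v) (simp_all add: \<psi>_def mod_3_simps)
    have eq: "graph_comp H (rename \<phi> G) = rename \<psi> (graph_comp H G)"
      unfolding graph_comp_def by (simp add: rename_rename up lo)
    have "inj_on \<psi> (in_upper ` nodes H \<union> in_lower ` nodes G)"
    proof (rule inj_onI)
      have ne: "in_lower (\<phi> u) = in_upper v \<longleftrightarrow> in_lower u = in_upper v" if "u \<in> nodes G" for u v
        using 1(5) that by (cases u; cases v) (auto dest!: inner; presburger)+
      have inj: "in_lower (\<phi> u) = in_lower (\<phi> v) \<longleftrightarrow> in_lower u = in_lower v" if "u \<in> nodes G" "v \<in> nodes G" for u v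
        using inj_onD[OF 1(4) _ that] inj_in_lower by (auto simp: inj_eq)
      fix x y assume xy: "x \<in> in_upper ` nodes H \<union> in_lower ` nodes G"
        "y \<in> in_upper ` nodes H \<union> in_lower ` nodes G" "\<psi> x = \<psi> y"
      then show "x = y"
        by (auto simp: up lo inj ne) (metis ne)+
    qed
    then have inj: "inj_on \<psi> (nodes (graph_comp H G))" by (simp add: graph_comp_def)
    have "graph_class m n (Poly_Mapping.single (graph_comp H G) 1) =
        graph_class m n (Poly_Mapping.single (rename \<psi> (graph_comp H G)) 1)"
      by (rule graph_class_rename[OF open_graph_comp[OF H 1(2)] _ inj])
         (use open_graph_comp[OF H 1(3)] eq in \<open>simp_all add: \<psi>_def\<close>)
    then show ?thesis
      unfolding graph_class_eq_iff 1(1) by (simp add: bilin_ext_diff_right eq)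
  next
    case (2 G x)
    have "local_rel (rename in_lower G + rename in_upper H)
        (lin_ext (\<lambda>G'. Poly_Mapping.single (rename in_lower G' + rename in_upper H) 1) x)"
    proof (rule local_rel_rename[OF 2(3)])
      fix v assume "trivalent_or_point G v"
      then obtain k where v: "v = Inner k" using open_graph_trivalent[OF 2(2)] by blast
      have "isolates in_lower G v" using inj_in_lower by (simp add: isolates_def inj_eq)
      then show "isolates in_lower G v \<and> in_lower v \<notin> nodes (rename in_upper H)"
        using in_upper_notin[of k "nodes H"] by (simp add: v)
    qed
    then have "local_rel (graph_comp H G) (lin_ext (\<lambda>G'. Poly_Mapping.single (graph_comp H G') 1) x)"
      unfolding graph_comp_def by (simp add: add.commute)
    from graph_class_local_rel[OF open_graph_comp[OF H 2(2)] this] show ?thesis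
      unfolding graph_class_eq_iff 2(1) by (simp add: bilin_ext_lin_ext lin_ext_diff)
  qed
qed

lemma graph_comp_span_left:
  assumes "x \<in> graph_span p n" "y \<in> graph_combs m p"
  shows "bilin_ext graph_comp x y \<in> graph_span m n"
  using assms(1)
proof (induction rule: graph_span.induct)
  case zero
  then show ?case by (simp add: graph_span.zero)
next
  case (add x r c)
  have "bilin_ext graph_comp r y \<in> graph_span m n"
    by (rule graph_span_lin_ext[OF laurent_linear_bilin_ext_right graph_comp_relator_left[OF add.hyps(2)]])
       (use assms(2) in \<open>auto simp: graph_combs_def\<close>)
  then show ?case
    using add.IH by (simp add: bilin_ext_add_left bilin_ext_lscale_left graph_span_add graph_span_lscale)
qed

lemma graph_comp_span_right:
  assumes "y \<in> graph_span m p" "x \<in> graph_combs p n"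
  shows "bilin_ext graph_comp x y \<in> graph_span m n"
  using assms(1)
proof (induction rule: graph_span.induct)
  case zero
  then show ?case by (simp add: graph_span.zero)
next
  case (add y r c)
  have "bilin_ext graph_comp x r \<in> graph_span m n"
    by (rule graph_span_lin_ext[OF laurent_linear_bilin_ext_left graph_comp_relator_right[OF add.hyps(2)]])
       (use assms(2) in \<open>auto simp: graph_combs_def\<close>)
  then show ?case
    using add.IH by (simp add: bilin_ext_add_right bilin_ext_lscale_right graph_span_add graph_span_lscale)
qed

lemma graph_comp_class_cong:
  assumes "graph_class p n x = graph_class p n x'" "graph_class m p y = graph_class m p y'"
    and "x' \<in> graph_combs p n" "y \<in> graph_combs m p"
  shows "graph_class m n (bilin_ext graph_comp x y) = graph_class m n (bilin_ext graph_comp x' y')"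
proof -
  have "bilin_ext graph_comp x y - bilin_ext graph_comp x' y' =
      bilin_ext graph_comp (x - x') y + bilin_ext graph_comp x' (y - y')"
    by (simp add: bilin_ext_diff_left bilin_ext_diff_right)
  then show ?thesis
    using assms unfolding graph_class_eq_iff
    by (metis graph_span_add graph_comp_span_left graph_comp_span_right)
qed

lemma GraphCat_comp_class:
  assumes x: "x \<in> graph_combs n n" and y: "y \<in> graph_combs n n"
  shows "GraphCat_comp n n (graph_class n n x) (graph_class n n y) = graph_class n n (bilin_ext graph_comp x y)"
proof -
  have "graph_class n n (bilin_ext graph_comp x' y') = graph_class n n (bilin_ext graph_comp x y)"
    if "x' \<in> graph_class n n x" "y' \<in> graph_class n n y" for x' y'
    by (rule graph_comp_class_cong)
       (use that graph_class_combs[OF y that(2)] x in \<open>simp_all add: graph_class_eq_iff graph_class_memD\<close>)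
  then have "GraphCat_comp n n (graph_class n n x) (graph_class n n y) =
      (\<Union>x'\<in>graph_class n n x. \<Union>y'\<in>graph_class n n y. graph_class n n (bilin_ext graph_comp x y))"
    unfolding GraphCat_comp_def by (intro SUP_cong HOL.refl)
  then show ?thesis using graph_class_self[of x n n] graph_class_self[of y n n] by auto
qed

lemma graph_comp_assoc:
  assumes A: "open_graph n n A" and B: "open_graph n n B" and C: "open_graph n n C"
  shows "graph_class n n (Poly_Mapping.single (graph_comp (graph_comp A B) C) 1) =
    graph_class n n (Poly_Mapping.single (graph_comp A (graph_comp B C)) 1)"
proof -
  \<comment> \<open>Names in the left and the right bracketing: nodes of \<open>C\<close> are 3k and
    9k, joints of \<open>B\<close> and \<open>C\<close> are 3k + 2 and 9k + 6, nodes of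
    \<open>B\<close> are 9k + 1 and 9k + 3, nodes of \<open>A\<close> are 9k + 4 and 3k + 1, joints
    of \<open>A\<close> and \<open>B\<close> are 9k + 7 and 3k + 2. \<open>f\<close> translates the
    former into the latter.\<close>
  define f :: "nat \<Rightarrow> nat" where
    "f m = (if m mod 3 \<noteq> 1 then 3 * m else if m mod 9 = 1 then m + 2 else m div 3)" for m
  define \<phi> where "\<phi> v = (case v of Inner m \<Rightarrow> Inner (f m) | _ \<Rightarrow> v)" for v
  have f: "f (3 * k) = 9 * k" "f (3 * k + 2) = 9 * k + 6" "f (9 * k + 4) = 3 * k + 1"
    "f (9 * k + 7) = 3 * k + 2" "f (9 * k + 1) = 9 * k + 3" for k
  proof -
    have "(9 * k + 4) mod 3 = 1" "(9 * k + 4) mod 9 = 4" "(9 * k + 4) div 3 = 3 * k + 1"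
      "(9 * k + 7) mod 3 = 1" "(9 * k + 7) mod 9 = 7" "(9 * k + 7) div 3 = 3 * k + 2"
      "(9 * k + 1) mod 3 = 1" "(9 * k + 1) mod 9 = 1" "(3 * k + 2) mod 3 = 2" for k :: nat
      by presburger+
    then show "f (3 * k) = 9 * k" "f (3 * k + 2) = 9 * k + 6" "f (9 * k + 4) = 3 * k + 1"
      "f (9 * k + 7) = 3 * k + 2" "f (9 * k + 1) = 9 * k + 3"
      unfolding f_def by simp_all
  qed
  have "inj f"
  proof (rule inj_on_inverseI)
    have form: "\<exists>k. m = 3 * k \<or> m = 3 * k + 2 \<or> m = 9 * k + 4 \<or> m = 9 * k + 7 \<or> m = 9 * k + 1" for m :: nat
    proof (cases m rule: nat_mod_3_cases)
      case (2 q)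
      show ?thesis by (cases q rule: nat_mod_3_cases) (use 2 in auto)
    qed auto
    define g where "g p = (if p mod 3 \<noteq> 0 then 3 * p + 1 else if p mod 9 = 3 then p - 2 else p div 3)" for p :: nat
    have m: "(9 * k) mod 3 = 0" "(9 * k) mod 9 = 0" "(9 * k) div 3 = 3 * k"
      "(9 * k + 6) mod 3 = 0" "(9 * k + 6) mod 9 = 6" "(9 * k + 6) div 3 = 3 * k + 2"
      "(9 * k + 3) mod 3 = 0" "(9 * k + 3) mod 9 = 3" "(3 * k + 1) mod 3 = 1" "(3 * k + 2) mod 3 = 2" for k :: nat
      by presburger+
    have g: "g (9 * k) = 3 * k" "g (9 * k + 6) = 3 * k + 2" "g (9 * k + 3) = 9 * k + 1"
      "g (3 * k + 1) = 9 * k + 4" "g (3 * k + 2) = 9 * k + 7" for k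
      unfolding g_def by (simp_all only: m) simp_all
    show "g (f a) = a" for a
      using form[of a] by (elim exE disjE) (simp_all only: f g)
  qed
  then have inj: "inj \<phi>" by (auto simp: \<phi>_def inj_def split: node.splits)
  have f': "f (3 * k) = 3 * (3 * k)" "f (3 * k + 2) = 3 * (3 * k + 2)" "f (3 * (3 * k + 1) + 1) = 3 * k + 1"
    "f (3 * (3 * k + 2) + 1) = 3 * k + 2" "f (3 * (3 * k) + 1) = 3 * (3 * k + 1)" for k
    using f[of k] by (simp_all add: algebra_simps)
  have 1: "\<phi> (in_upper (in_upper v)) = in_upper v" for v
    by (cases v) (simp_all only: \<phi>_def in_upper.simps in_lower.simps node.case f')
  have 2: "\<phi> (in_upper (in_lower v)) = in_lower (in_upper v)" for v
    by (cases v) (simp_all only: \<phi>_def in_upper.simps in_lower.simps node.case f')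
  have 3: "\<phi> (in_lower v) = in_lower (in_lower v)" for v
    by (cases v) (simp_all only: \<phi>_def in_upper.simps in_lower.simps node.case f')
  have eq: "graph_comp A (graph_comp B C) = rename \<phi> (graph_comp (graph_comp A B) C)"
    unfolding graph_comp_def by (simp add: rename_rename 1 2 3 add.assoc)
  show ?thesis unfolding eq
    by (rule graph_class_rename[OF open_graph_comp[OF open_graph_comp[OF A B] C]
          open_graph_comp[OF A open_graph_comp[OF B C], unfolded eq] inj_on_subset[OF inj subset_UNIV]])
       (simp_all add: \<phi>_def)
qed


section \<open>Composition with marked points smoothed\<close>

lemma nodes_image_mset [simp]:
  "finite S \<Longrightarrow> nodes (image_mset e (mset_set S)) = fst ` e ` S \<union> snd ` e ` S"
  unfolding nodes_def by simp

text \<open>The targets lie outside \<open>S\<close>, so no step destroys an end that is still to be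
  glued. Distinct ends may share a target, as two strands entering the same sink do.\<close>

lemma smooths_glue_many_in:
  assumes "finite S" "\<And>s. s \<in> S \<Longrightarrow> r s \<notin> S \<and> indeg G s = 1 \<and> outdeg G s = 0"
  shows "smooths (G + image_mset (\<lambda>s. (s, r s)) (mset_set S)) (rename (\<lambda>v. if v \<in> S then r v else v) G)"
  using assms
proof (induction S arbitrary: G rule: finite_induct)
  case empty
  then show ?case by (simp add: rename_ident smooths_refl)
next
  case (insert s S)
  let ?K = "image_mset (\<lambda>s. (s, r s)) (mset_set S)" and ?G = "rename (id(s := r s)) G"
  have "s \<notin> nodes ?K" using insert.hyps insert.prems by force
  then have "smooths (G + ?K + {#(s, r s)#}) (?G + ?K)"
    using insert.prems[of s] by (intro smooths_glue_in') auto
  moreover have "indeg ?G t = 1 \<and> outdeg ?G t = 0" if "t \<in> S" for t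
  proof -
    have "isolates (id(s := r s)) G t" using that insert.hyps insert.prems by (auto simp: isolates_def)
    moreover have "(id(s := r s)) t = t" using that insert.hyps by auto
    ultimately show ?thesis using deg_rename[of "id(s := r s)" G t] that insert.prems[of t] by simp
  qed
  then have "smooths (?G + ?K) (rename (\<lambda>v. if v \<in> S then r v else v) ?G)"
    using insert.prems by (intro insert.IH) auto
  moreover have "rename (\<lambda>v. if v \<in> S then r v else v) ?G = rename (\<lambda>v. if v \<in> insert s S then r v else v) G"
    unfolding rename_rename using insert.hyps insert.prems by (intro rename_cong) auto
  ultimately show ?case using insert.hyps by (auto intro: smooths_trans)
qed

lemma smooths_glue_many_out:
  assumes "finite S" "\<And>s. s \<in> S \<Longrightarrow> r s \<notin> S \<and> outdeg G s = 1 \<and> indeg G s = 0"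
  shows "smooths (G + image_mset (\<lambda>s. (r s, s)) (mset_set S)) (rename (\<lambda>v. if v \<in> S then r v else v) G)"
  using assms
proof (induction S arbitrary: G rule: finite_induct)
  case empty
  then show ?case by (simp add: rename_ident smooths_refl)
next
  case (insert s S)
  let ?K = "image_mset (\<lambda>s. (r s, s)) (mset_set S)" and ?G = "rename (id(s := r s)) G"
  have "s \<notin> nodes ?K" using insert.hyps insert.prems by force
  then have "smooths (G + ?K + {#(r s, s)#}) (?G + ?K)"
    using insert.prems[of s] by (intro smooths_glue_out') auto
  moreover have "outdeg ?G t = 1 \<and> indeg ?G t = 0" if "t \<in> S" for t
  proof -
    have "isolates (id(s := r s)) G t" using that insert.hyps insert.prems by (auto simp: isolates_def)
    moreover have "(id(s := r s)) t = t" using that insert.hyps by auto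
    ultimately show ?thesis using deg_rename[of "id(s := r s)" G t] that insert.prems[of t] by simp
  qed
  then have "smooths (?G + ?K) (rename (\<lambda>v. if v \<in> S then r v else v) ?G)"
    using insert.prems by (intro insert.IH) auto
  moreover have "rename (\<lambda>v. if v \<in> S then r v else v) ?G = rename (\<lambda>v. if v \<in> insert s S then r v else v) G"
    unfolding rename_rename using insert.hyps insert.prems by (intro rename_cong) auto
  ultimately show ?case using insert.hyps by (auto intro: smooths_trans)
qed

definition graph_elt :: "nat \<Rightarrow> node dgraph \<Rightarrow> (node dgraph \<Rightarrow>\<^sub>0 laurent) set" where
  "graph_elt n G = graph_class n n (Poly_Mapping.single G 1)"

text \<open>A form that lists the target of every lower strand, with the rest of the graph in
  \<open>F\<close>. Composition with such a graph on top then amounts to substituting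
  \<open>f\<close>.\<close>

definition strands :: "nat \<Rightarrow> (nat \<Rightarrow> node) \<Rightarrow> node dgraph \<Rightarrow> node dgraph" where
  "strands n f F = image_mset (\<lambda>j. (Low j, f j)) (mset_set {1..n}) + F"

lemma strands_cong:
  "(\<And>j. j \<in> {1..n} \<Longrightarrow> f j = g j) \<Longrightarrow> F = F' \<Longrightarrow> strands n f F = strands n g F'"
  unfolding strands_def by (auto intro!: image_mset_cong)

lemma strands_degrees:
  "outdeg (strands n f F) v = card {j \<in> {1..n}. Low j = v} + outdeg F v"
  "indeg (strands n f F) v = card {j \<in> {1..n}. f j = v} + indeg F v"
  unfolding strands_def by (simp_all add: outdeg_simps deg_image)

text \<open>The strand that starts at a lower end uses up its only edge.\<close>

lemma open_strands_low:
  assumes "open_graph m n (strands p f F)"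
  shows "j \<in> {1..p} \<Longrightarrow> f j \<noteq> Low l" "p = m \<Longrightarrow> Low l \<notin> nodes F"
proof -
  have "{j \<in> {1..p}. f j = Low l} = {}" and F: "indeg F (Low l) = 0"
    using open_graph_degrees(2)[OF assms, of l] by (auto simp: strands_degrees)
  then show "j \<in> {1..p} \<Longrightarrow> f j \<noteq> Low l" by blast
  assume "p = m"
  have "{j. Suc 0 \<le> j \<and> j \<le> m \<and> j = l} = (if l \<in> {1..m} then {l} else {})" by auto
  then have "outdeg F (Low l) = 0"
    using open_graph_outdeg_low[OF assms, of l] \<open>p = m\<close> by (auto simp: strands_degrees split: if_splits)
  with F show "Low l \<notin> nodes F" by (simp add: nodes_deg)
qed

text \<open>The effect of smoothing all joints: an upper end of the lower factor continues at the
  target of the corresponding strand above it.\<close>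

definition attach :: "(nat \<Rightarrow> node) \<Rightarrow> node \<Rightarrow> node" where
  "attach f v = (case v of Up j \<Rightarrow> in_upper (f j) | _ \<Rightarrow> in_lower v)"

lemma attach_simps [simp]:
  "attach f (Up j) = in_upper (f j)" "attach f (Low j) = Low j" "attach f (Inner k) = Inner (3 * k)"
  unfolding attach_def by simp_all

text \<open>The only edge leaving the joint \<open>Inner (3 * j + 2)\<close> is the strand of the
  upper factor starting at \<open>Low j\<close>, so every joint can be merged with the target of its
  strand.\<close>

lemma smooths_comp_strands:
  assumes F: "open_graph n n (strands n f F)" and G: "open_graph n n G"
  shows "smooths (graph_comp (strands n f F) G) (rename in_upper F + rename (attach f) G)"
proof -
  let ?p = "\<lambda>j. Inner (3 * j + 2)"
  \<comment> \<open>Division by 3 recovers j from the name 3 * j + 2 of a joint.\<close>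
  let ?r = "\<lambda>v. case v of Inner k \<Rightarrow> in_upper (f (k div 3)) | _ \<Rightarrow> v"
  let ?S = "?p ` {1..n}" and ?H = "rename in_upper F + rename in_lower G"
  let ?s = "\<lambda>v. if v \<in> ?S then ?r v else v"
  have inj: "inj_on ?p {1..n}" by (simp add: inj_on_def)
  have "graph_comp (strands n f F) G = ?H + image_mset (\<lambda>j. (?p j, in_upper (f j))) (mset_set {1..n})"
    unfolding graph_comp_def strands_def by simp
  also have "image_mset (\<lambda>j. (?p j, in_upper (f j))) (mset_set {1..n}) = image_mset (\<lambda>s. (s, ?r s)) (mset_set ?S)"
    unfolding image_mset_mset_set[OF inj, symmetric] by (simp add: multiset.map_comp comp_def mod_3_simps)
  finally have eq: "graph_comp (strands n f F) G = ?H + image_mset (\<lambda>s. (s, ?r s)) (mset_set ?S)" .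
  have no_p: "?p j \<notin> in_upper ` A" if "\<And>l. Low l \<notin> A" for j A
    using that by (auto elim!: in_upper.elims[OF HOL.sym]) presburger+
  have F0: "Low l \<notin> nodes F" for l using open_strands_low(2)[OF F] by simp
  have "smooths (?H + image_mset (\<lambda>s. (s, ?r s)) (mset_set ?S)) (rename ?s ?H)"
  proof (rule smooths_glue_many_in)
    fix s assume "s \<in> ?S"
    then obtain j where j: "j \<in> {1..n}" "s = ?p j" by blast
    have "?r s = in_upper (f j)" using j by (simp add: mod_3_simps)
    moreover have "in_upper (f j) \<noteq> ?p l" for l
      using no_p[of "{f j}" l] open_strands_low(1)[OF F j(1), symmetric] by auto
    then have "in_upper (f j) \<notin> ?S" by blast
    moreover have "s \<notin> nodes (rename in_upper F)" using no_p[of "nodes F" j] F0 j(2) by simp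
    moreover have "indeg G (Up j) = 1" "outdeg G (Up j) = 0" using open_graph_degrees(3,4)[OF G] j(1) by auto
    then have "indeg (rename in_lower G) s = 1" "outdeg (rename in_lower G) s = 0"
      using deg_rename_inj[OF inj_in_lower, of G "Up j"] j(2) by simp_all
    ultimately show "?r s \<notin> ?S \<and> indeg ?H s = 1 \<and> outdeg ?H s = 0"
      by (simp add: outdeg_simps deg_notin_nodes)
  qed simp
  moreover have "rename ?s (rename in_upper F) = rename in_upper F"
  proof (rule rename_ident)
    fix v assume "v \<in> nodes (rename in_upper F)"
    then have "v \<in> in_upper ` nodes F" by simp
    then have "v \<notin> ?S" using no_p[of "nodes F", OF F0] by blast
    then show "?s v = v" by (rule if_not_P)
  qed
  moreover have "rename ?s (rename in_lower G) = rename (attach f) G"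
    unfolding rename_rename
  proof (rule rename_cong)
    fix v assume v: "v \<in> nodes G"
    show "?s (in_lower v) = attach f v"
    proof (cases v)
      case (Inner k)
      have "3 * k \<noteq> 3 * j + 2" for j :: nat by presburger
      then have "in_lower v \<notin> ?S" using Inner by auto
      then show ?thesis using Inner by simp
    next
      case (Up j)
      then show ?thesis using v open_graph_up[OF G, of j] by (simp add: mod_3_simps)
    qed auto
  qed
  ultimately show ?thesis unfolding eq by simp
qed

lemma graph_elt_rename:
  assumes G: "open_graph n n G" and inj: "inj \<phi>" and fixed: "\<And>j. \<phi> (Low j) = Low j" "\<And>j. \<phi> (Up j) = Up j"
  shows "open_graph n n (rename \<phi> G)" "graph_elt n (rename \<phi> G) = graph_elt n G"
proof -
  have d: "outdeg (rename \<phi> G) (\<phi> v) = outdeg G v" "indeg (rename \<phi> G) (\<phi> v) = indeg G v" for v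
    by (rule deg_rename_inj[OF inj])+
  show o: "open_graph n n (rename \<phi> G)"
  proof (rule open_graphI)
    fix k assume "Inner k \<in> nodes (rename \<phi> G)"
    then obtain v where v: "v \<in> nodes G" "Inner k = \<phi> v" by auto
    then obtain k' where "v = Inner k'" using fixed by (cases v) auto
    then show "trivalent_or_point (rename \<phi> G) (Inner k)"
      using open_graph_inner[OF G, of k'] v by (simp add: trivalent_defs d)
  qed (use d[of "Low _", unfolded fixed] d[of "Up _", unfolded fixed] open_graph_outdeg_low[OF G]
      open_graph_indeg_up[OF G] open_graph_degrees[OF G] in simp_all)
  show "graph_elt n (rename \<phi> G) = graph_elt n G"
    unfolding graph_elt_def
    by (rule graph_class_rename[OF G o inj_on_subset[OF inj subset_UNIV], symmetric]) (simp_all add: fixed)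
qed

lemma vertical_strands: "vertical {1..n} = strands n Up {#}"
  unfolding vertical_def strands_def by simp

lemma graph_comp_identity_left:
  assumes G: "open_graph n n G" shows "graph_elt n (graph_comp (vertical {1..n}) G) = graph_elt n G"
proof -
  have o: "open_graph n n (strands n Up {#})" using open_graph_identity[of n] unfolding vertical_strands .
  have "graph_elt n (graph_comp (vertical {1..n}) G) = graph_elt n (rename (attach Up) G)"
    unfolding graph_elt_def vertical_strands
    using smooths_open_graph(2)[OF smooths_comp_strands[OF o G] open_graph_comp[OF o G]] by simp
  also have "\<dots> = graph_elt n G"
    by (rule graph_elt_rename(2)[OF G]) (auto simp: inj_def attach_def split: node.splits)
  finally show ?thesis .
qed

text \<open>Now the identity is the lower factor, so each joint is entered by a vertical strand and
  is merged with the lower end where that strand starts.\<close>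

lemma graph_comp_identity_right:
  assumes G: "open_graph n n G" shows "graph_elt n (graph_comp G (vertical {1..n})) = graph_elt n G"
proof -
  let ?p = "\<lambda>j. Inner (3 * j + 2)"
  let ?r = "\<lambda>v. case v of Inner k \<Rightarrow> Low (k div 3) | _ \<Rightarrow> v"
  let ?S = "?p ` {1..n}"
  let ?s = "\<lambda>v. if v \<in> ?S then ?r v else v"
  define \<phi> where "\<phi> v = (case v of Inner k \<Rightarrow> Inner (3 * k + 1) | _ \<Rightarrow> v)" for v
  have inj: "inj_on ?p {1..n}" by (simp add: inj_on_def)
  have "image_mset (\<lambda>j. (Low j, ?p j)) (mset_set {1..n}) = image_mset (\<lambda>s. (?r s, s)) (mset_set ?S)"
    unfolding image_mset_mset_set[OF inj, symmetric] by (simp add: multiset.map_comp comp_def mod_3_simps)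
  then have eq: "graph_comp G (vertical {1..n}) = rename in_upper G + image_mset (\<lambda>s. (?r s, s)) (mset_set ?S)"
    unfolding graph_comp_def vertical_def by simp
  have sm: "smooths (graph_comp G (vertical {1..n})) (rename ?s (rename in_upper G))"
    unfolding eq
  proof (rule smooths_glue_many_out)
    fix s assume "s \<in> ?S"
    then obtain j where j: "j \<in> {1..n}" "s = in_upper (Low j)" by auto
    then show "?r s \<notin> ?S \<and> outdeg (rename in_upper G) s = 1 \<and> indeg (rename in_upper G) s = 0"
      using deg_rename_inj[OF inj_in_upper, of G "Low j"] open_graph_degrees(1,2)[OF G] by auto
  qed simp
  have "rename ?s (rename in_upper G) = rename \<phi> G"
    unfolding rename_rename
  proof (rule rename_cong)
    fix v assume v: "v \<in> nodes G"
    show "?s (in_upper v) = \<phi> v"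
    proof (cases v)
      case (Inner k)
      have "3 * k + 1 \<noteq> 3 * j + 2" for j :: nat by presburger
      then have "in_upper v \<notin> ?S" using Inner by auto
      then show ?thesis using Inner by (simp add: \<phi>_def)
    next
      case (Low j)
      then show ?thesis using v open_graph_low[OF G, of j] by (simp add: \<phi>_def mod_3_simps)
    qed (auto simp: \<phi>_def)
  qed
  then have "graph_elt n (graph_comp G (vertical {1..n})) = graph_elt n (rename \<phi> G)"
    unfolding graph_elt_def
    using smooths_open_graph(2)[OF sm open_graph_comp[OF G open_graph_identity]] by simp
  also have "\<dots> = graph_elt n G"
    by (rule graph_elt_rename(2)[OF G]) (auto simp: inj_def \<phi>_def split: node.splits)
  finally show ?thesis .
qed

section \<open>Relations between double-Y graphs and permutations of strands\<close>

lemma rename_strands: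
  assumes "\<And>j. \<phi> (Low j) = Low j"
  shows "rename \<phi> (strands n f F) = strands n (\<lambda>j. \<phi> (f j)) (rename \<phi> F)"
  unfolding strands_def by (simp add: assms)

lemma strands_comp:
  assumes F: "open_graph n n (strands n f F)" and G: "open_graph n n (strands n g G)"
    and H: "H = strands n (\<lambda>j. attach f (g j)) (rename in_upper F + rename (attach f) G)"
  shows "open_graph n n H" "graph_elt n (graph_comp (strands n f F) (strands n g G)) = graph_elt n H"
proof -
  have "smooths (graph_comp (strands n f F) (strands n g G)) H"
    using smooths_comp_strands[OF F G] unfolding H rename_strands[of "attach f", OF attach_simps(2)]
    by (simp add: strands_def ac_simps)
  from smooths_open_graph[OF this open_graph_comp[OF F G]]
  show "open_graph n n H" "graph_elt n (graph_comp (strands n f F) (strands n g G)) = graph_elt n H"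
    unfolding graph_elt_def by blast+
qed

definition permute_graph :: "nat \<Rightarrow> (nat \<Rightarrow> nat) \<Rightarrow> node dgraph" where
  "permute_graph n \<sigma> = strands n (\<lambda>j. Up (\<sigma> j)) {#}"

text \<open>The double-Y at an arbitrary pair of positions; conjugating by a permutation of the
  strands then stays inside the family.\<close>

definition YY :: "nat \<Rightarrow> nat \<Rightarrow> nat \<Rightarrow> node dgraph" where
  "YY n a b = strands n (\<lambda>j. if j \<in> {a, b} then Inner 0 else Up j)
     {#(Inner 1, Up a), (Inner 1, Up b), (Inner 1, Inner 0)#}"

lemma YY_sym: "YY n a b = YY n b a"
  unfolding YY_def by (auto simp: add_mset_commute intro!: strands_cong)

lemma strands_split:
  assumes "c \<in> {1..n}"
  shows "strands n f F = image_mset (\<lambda>j. (Low j, f j)) (mset_set ({1..n} - {c})) + F + {#(Low c, f c)#}"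
  using mset_set.remove[of "{1..n}" c] assms unfolding strands_def by simp

lemma double_Y_eq_YY:
  assumes "i \<in> {1..<n}" shows "double_Y n i = YY n i (i + 1)"
proof -
  let ?f = "\<lambda>j. if j \<in> {i, i + 1} then Inner 0 else Up j"
  have J: "{1..n} = insert i (insert (i + 1) ({1..n} - {i, i + 1}))" using assms by auto
  have "image_mset (\<lambda>j. (Low j, ?f j)) (mset_set ({1..n} - {i, i + 1})) = vertical ({1..n} - {i, i + 1})"
    unfolding vertical_def by (auto intro!: image_mset_cong)
  then have "image_mset (\<lambda>j. (Low j, ?f j)) (mset_set {1..n}) =
      vertical ({1..n} - {i, i + 1}) + {#(Low i, Inner 0), (Low (i + 1), Inner 0)#}"
    by (subst J) simp
  then show ?thesis unfolding double_Y_def YY_def strands_def by simp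
qed

abbreviation swap :: "nat \<Rightarrow> nat \<Rightarrow> nat" where
  "swap i \<equiv> id(i := i + 1, i + 1 := i)"

lemma virtual_crossing_eq_permute_graph:
  assumes "i \<in> {1..<n}" shows "virtual_crossing n i = permute_graph n (swap i)"
proof -
  have J: "{1..n} = insert i (insert (i + 1) ({1..n} - {i, i + 1}))" using assms by auto
  have "image_mset (\<lambda>j. (Low j, Up (swap i j))) (mset_set ({1..n} - {i, i + 1})) = vertical ({1..n} - {i, i + 1})"
    unfolding vertical_def by (auto intro!: image_mset_cong)
  then have "image_mset (\<lambda>j. (Low j, Up (swap i j))) (mset_set {1..n}) =
      vertical ({1..n} - {i, i + 1}) + {#(Low i, Up (i + 1)), (Low (i + 1), Up i)#}"
    by (subst J) simp
  then show ?thesis unfolding virtual_crossing_def permute_graph_def strands_def by simp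
qed

lemma permute_graph_comp:
  assumes "open_graph n n (permute_graph n \<sigma>)" "open_graph n n (permute_graph n \<tau>)"
  shows "open_graph n n (permute_graph n (\<sigma> \<circ> \<tau>))"
    "graph_elt n (graph_comp (permute_graph n \<sigma>) (permute_graph n \<tau>)) = graph_elt n (permute_graph n (\<sigma> \<circ> \<tau>))"
  using strands_comp[OF assms[unfolded permute_graph_def] HOL.refl] unfolding permute_graph_def by (simp_all add: comp_def)

lemma inj_Inner_perm:
  assumes "inj f" shows "inj (\<lambda>v. case v of Inner k \<Rightarrow> Inner (f k) | _ \<Rightarrow> v)"
  using assms by (auto simp: inj_def split: node.splits)

text \<open>The inner nodes \<open>1, 4\<close> and \<open>0, 3\<close> (and \<open>9, 12\<close> for three factors) below are the images of the
  vertices \<open>0, 1\<close> of the upper and of the lower factor under \<open>in_upper\<close> and \<open>in_lower\<close>; permutations of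
  these names bring the result back to a standard form.\<close>

lemma permute_YY:
  assumes V: "open_graph n n (permute_graph n \<sigma>)" and Y: "open_graph n n (YY n a b)" and ab: "a \<noteq> b"
  shows "graph_elt n (graph_comp (permute_graph n \<sigma>) (YY n a b)) =
      graph_elt n (strands n (\<lambda>j. if j \<in> {a, b} then Inner 0 else Up (\<sigma> j))
        {#(Inner 1, Up (\<sigma> a)), (Inner 1, Up (\<sigma> b)), (Inner 1, Inner 0)#})" (is "_ = graph_elt n ?H")
proof -
  define \<phi> where "\<phi> v = (case v of Inner k \<Rightarrow> Inner ((id(1 := 3, 3 := 1)) k) | _ \<Rightarrow> v)" for v
  have inj: "inj \<phi>" unfolding \<phi>_def by (rule inj_Inner_perm) (auto simp: inj_def)
  let ?K = "strands n (\<lambda>j. if j \<in> {a, b} then Inner 0 else Up (\<sigma> j))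
        {#(Inner 3, Up (\<sigma> a)), (Inner 3, Up (\<sigma> b)), (Inner 3, Inner 0)#}"
  have "?K = strands n (\<lambda>j. attach (\<lambda>j. Up (\<sigma> j)) (if j \<in> {a, b} then Inner 0 else Up j))
      (rename in_upper {#} + rename (attach (\<lambda>j. Up (\<sigma> j))) {#(Inner 1, Up a), (Inner 1, Up b), (Inner 1, Inner 0)#})"
    by (rule strands_cong) auto
  note K = strands_comp[OF V[unfolded permute_graph_def] Y[unfolded YY_def] this]
  have "?H = rename \<phi> ?K"
    by (subst rename_strands) (auto simp: \<phi>_def intro!: strands_cong)
  then show ?thesis
    using K(2) graph_elt_rename(2)[OF K(1) inj] unfolding permute_graph_def YY_def by (simp add: \<phi>_def)
qed

lemma YY_permute:
  assumes V: "open_graph n n (permute_graph n \<sigma>)" and Y: "open_graph n n (YY n a b)"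
  shows "graph_elt n (graph_comp (YY n a b) (permute_graph n \<sigma>)) =
      graph_elt n (strands n (\<lambda>j. if \<sigma> j \<in> {a, b} then Inner 0 else Up (\<sigma> j))
        {#(Inner 1, Up a), (Inner 1, Up b), (Inner 1, Inner 0)#})" (is "_ = graph_elt n ?H")
proof -
  define \<phi> where "\<phi> v = (case v of Inner k \<Rightarrow> Inner ((id(0 := 1, 1 := 0) \<circ> id(4 := 0, 0 := 4)) k) | _ \<Rightarrow> v)" for v
  have inj: "inj \<phi>" unfolding \<phi>_def by (rule inj_Inner_perm) (auto simp: inj_def split: if_splits)
  let ?K = "strands n (\<lambda>j. if \<sigma> j \<in> {a, b} then Inner 1 else Up (\<sigma> j))
        {#(Inner 4, Up a), (Inner 4, Up b), (Inner 4, Inner 1)#}"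
  have "?K = strands n (\<lambda>j. attach (\<lambda>j. if j \<in> {a, b} then Inner 0 else Up j) (Up (\<sigma> j)))
      (rename in_upper {#(Inner 1, Up a), (Inner 1, Up b), (Inner 1, Inner 0)#} + rename (attach (\<lambda>j. if j \<in> {a, b} then Inner 0 else Up j)) {#})"
    by (rule strands_cong) auto
  note K = strands_comp[OF Y[unfolded YY_def] V[unfolded permute_graph_def] this]
  have "?H = rename \<phi> ?K"
    by (subst rename_strands) (auto simp: \<phi>_def intro!: strands_cong)
  then show ?thesis
    using K(2) graph_elt_rename(2)[OF K(1) inj] unfolding permute_graph_def YY_def by (simp add: \<phi>_def)
qed

text \<open>A permutation of strands carries the double-Y along to the images of its positions. The
  mixed braid relation and far commutation with virtual crossings both come from this.\<close>

lemma permute_YY_commute: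
  assumes V: "open_graph n n (permute_graph n \<sigma>)" and Y: "open_graph n n (YY n a b)" "open_graph n n (YY n (\<sigma> a) (\<sigma> b))"
    and "a \<noteq> b" "inj \<sigma>"
  shows "graph_elt n (graph_comp (permute_graph n \<sigma>) (YY n a b)) =
    graph_elt n (graph_comp (YY n (\<sigma> a) (\<sigma> b)) (permute_graph n \<sigma>))"
proof -
  have "\<sigma> j \<in> {\<sigma> a, \<sigma> b} \<longleftrightarrow> j \<in> {a, b}" for j using assms(5) by (auto simp: inj_eq)
  then show ?thesis unfolding permute_YY[OF V Y(1) assms(4)] YY_permute[OF V Y(2)] by simp
qed

text \<open>A sink or source does not distinguish its incident strands, so it absorbs a virtual
  crossing of two of them.\<close>

lemma YY_swap:
  assumes V: "open_graph n n (permute_graph n (swap i))" and Y: "open_graph n n (YY n i (i + 1))"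
  shows "graph_elt n (graph_comp (permute_graph n (swap i)) (YY n i (i + 1))) = graph_elt n (YY n i (i + 1))"
    "graph_elt n (graph_comp (YY n i (i + 1)) (permute_graph n (swap i))) = graph_elt n (YY n i (i + 1))"
  unfolding permute_YY[OF V Y n_not_Suc_n[unfolded Suc_eq_plus1]] YY_permute[OF V Y]
  by (auto simp: YY_def add_mset_commute intro!: arg_cong[of _ _ "graph_elt n"] strands_cong)


section \<open>The endomorphism ring\<close>

lemma GraphEnd_simps:
  "carrier (GraphEnd n) = GraphCat n n" "\<zero>\<^bsub>GraphEnd n\<^esub> = graph_class n n 0"
  "\<one>\<^bsub>GraphEnd n\<^esub> = graph_elt n (vertical {1..n})"
  "graph_class n n x \<oplus>\<^bsub>GraphEnd n\<^esub> graph_class n n y = graph_class n n (x + y)"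
  "x \<in> graph_combs n n \<Longrightarrow> y \<in> graph_combs n n \<Longrightarrow>
    graph_class n n x \<otimes>\<^bsub>GraphEnd n\<^esub> graph_class n n y = graph_class n n (bilin_ext graph_comp x y)"
  by (simp_all add: GraphEnd_def graph_elt_def GraphCat_add_class GraphCat_comp_class)

lemma GraphEnd_carrierE:
  assumes "X \<in> carrier (GraphEnd n)"
  obtains x where "x \<in> graph_combs n n" "X = graph_class n n x"
  using assms unfolding GraphEnd_simps GraphCat_def by blast

lemma graph_class_carrier: "x \<in> graph_combs n n \<Longrightarrow> graph_class n n x \<in> carrier (GraphEnd n)"
  unfolding GraphEnd_simps GraphCat_def by blast

text \<open>Basis graphs associate up to the renaming of \<open>graph_comp_assoc\<close>, hence as
  classes, and this extends to combinations by trilinearity.\<close>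

lemma graph_comp_assoc_class:
  assumes x: "x \<in> graph_combs n n" and y: "y \<in> graph_combs n n" and z: "z \<in> graph_combs n n"
  shows "graph_class n n (bilin_ext graph_comp (bilin_ext graph_comp x y) z) =
    graph_class n n (bilin_ext graph_comp x (bilin_ext graph_comp y z))"
proof (rule graph_class_linear_eq[where x = x and F = "\<lambda>x. bilin_ext graph_comp (bilin_ext graph_comp x y) z"])
  fix A assume "A \<in> Poly_Mapping.keys x"
  then have A: "open_graph n n A" using x by (simp add: graph_combs_def)
  show "graph_class n n (bilin_ext graph_comp (bilin_ext graph_comp (Poly_Mapping.single A 1) y) z) =
      graph_class n n (bilin_ext graph_comp (Poly_Mapping.single A 1) (bilin_ext graph_comp y z))"
  proof (rule graph_class_linear_eq[where x = y and F = "\<lambda>y. bilin_ext graph_comp (bilin_ext graph_comp (Poly_Mapping.single A 1) y) z"])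
    fix B assume "B \<in> Poly_Mapping.keys y"
    then have B: "open_graph n n B" using y by (simp add: graph_combs_def)
    show "graph_class n n (bilin_ext graph_comp (bilin_ext graph_comp (Poly_Mapping.single A 1) (Poly_Mapping.single B 1)) z) =
      graph_class n n (bilin_ext graph_comp (Poly_Mapping.single A 1) (bilin_ext graph_comp (Poly_Mapping.single B 1) z))"
      by (rule graph_class_linear_eq[where x = z])
         (use z graph_comp_assoc[OF A B] in \<open>auto simp: graph_combs_def laurent_linear_def
            bilin_ext_add_right bilin_ext_lscale_right\<close>)
  qed (auto simp: laurent_linear_def bilin_ext_add_left bilin_ext_lscale_left bilin_ext_add_right bilin_ext_lscale_right)
qed (auto simp: laurent_linear_def bilin_ext_add_left bilin_ext_lscale_left)

lemma graph_comp_identity_class: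
  assumes x: "x \<in> graph_combs n n"
  shows "graph_class n n (bilin_ext graph_comp (Poly_Mapping.single (vertical {1..n}) 1) x) = graph_class n n x"
    "graph_class n n (bilin_ext graph_comp x (Poly_Mapping.single (vertical {1..n}) 1)) = graph_class n n x"
proof -
  show "graph_class n n (bilin_ext graph_comp (Poly_Mapping.single (vertical {1..n}) 1) x) = graph_class n n x"
    by (rule graph_class_linear_eq[OF laurent_linear_bilin_ext_right laurent_linear_id])
       (use x graph_comp_identity_left in \<open>auto simp: graph_combs_def graph_elt_def\<close>)
  show "graph_class n n (bilin_ext graph_comp x (Poly_Mapping.single (vertical {1..n}) 1)) = graph_class n n x"
    by (rule graph_class_linear_eq[OF laurent_linear_bilin_ext_left laurent_linear_id])
       (use x graph_comp_identity_right in \<open>auto simp: graph_combs_def graph_elt_def\<close>)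
qed

lemmas identity_combs = graph_combs_single[OF open_graph_identity]

lemma ring_GraphEnd: "ring (GraphEnd n)"
proof (rule ringI)
  let ?R = "GraphEnd n"
  show "abelian_group ?R"
  proof (rule abelian_groupI)
    fix X assume "X \<in> carrier ?R"
    then obtain x where x: "x \<in> graph_combs n n" "X = graph_class n n x" by (rule GraphEnd_carrierE)
    then show "\<exists>Y\<in>carrier ?R. Y \<oplus>\<^bsub>?R\<^esub> X = \<zero>\<^bsub>?R\<^esub>"
      using graph_class_carrier[OF graph_combs_minus[OF x(1)]]
      by (intro bexI[of _ "graph_class n n (- x)"]) (simp_all add: GraphEnd_simps)
  qed (auto elim!: GraphEnd_carrierE simp: GraphEnd_simps(2,4) ac_simps
      intro!: graph_class_carrier graph_combs_add graph_combs_0)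
  show "monoid ?R"
  proof (rule monoidI)
    show "\<one>\<^bsub>?R\<^esub> \<in> carrier ?R"
      unfolding GraphEnd_simps(3) graph_elt_def by (rule graph_class_carrier[OF identity_combs])
    fix X assume X: "X \<in> carrier ?R"
    then obtain x where x: "x \<in> graph_combs n n" "X = graph_class n n x" by (rule GraphEnd_carrierE)
    show "\<one>\<^bsub>?R\<^esub> \<otimes>\<^bsub>?R\<^esub> X = X" "X \<otimes>\<^bsub>?R\<^esub> \<one>\<^bsub>?R\<^esub> = X"
      unfolding x(2) GraphEnd_simps(3) graph_elt_def GraphEnd_simps(5)[OF identity_combs x(1)]
        GraphEnd_simps(5)[OF x(1) identity_combs] graph_comp_identity_class[OF x(1)] by (rule HOL.refl)+
    fix Y assume Y: "Y \<in> carrier ?R"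
    show "X \<otimes>\<^bsub>?R\<^esub> Y \<in> carrier ?R"
      using X Y by (auto elim!: GraphEnd_carrierE simp: GraphEnd_simps(5) intro!: graph_class_carrier bilin_ext_combs)
    fix Z assume Z: "Z \<in> carrier ?R"
    show "X \<otimes>\<^bsub>?R\<^esub> Y \<otimes>\<^bsub>?R\<^esub> Z = X \<otimes>\<^bsub>?R\<^esub> (Y \<otimes>\<^bsub>?R\<^esub> Z)"
      using X Y Z by (auto elim!: GraphEnd_carrierE simp: GraphEnd_simps(5) bilin_ext_combs graph_comp_assoc_class)
  qed
qed (auto elim!: GraphEnd_carrierE
    simp: GraphEnd_simps(4,5) graph_combs_add bilin_ext_combs bilin_ext_add_left bilin_ext_add_right)

lemma graph_elt_carrier: "open_graph n n G \<Longrightarrow> graph_elt n G \<in> carrier (GraphEnd n)"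
  unfolding graph_elt_def by (intro graph_class_carrier graph_combs_single)

lemma graph_elt_mult:
  assumes "open_graph n n F" "open_graph n n G"
  shows "graph_elt n F \<otimes>\<^bsub>GraphEnd n\<^esub> graph_elt n G = graph_elt n (graph_comp F G)"
  unfolding graph_elt_def using assms by (simp add: GraphEnd_simps(5) graph_combs_single)

section \<open>Products of double-Y graphs\<close>

lemma nodes_strands [simp]: "nodes (strands n f F) = Low ` {1..n} \<union> f ` {1..n} \<union> nodes F"
  unfolding strands_def by (auto simp: image_image)

text \<open>The source 3 of the lower factor sends two edges to the sink 1 of the upper one, a
  bigon. After its removal the path 4, 1, 3, 0 is smoothed to the middle edge of a single
  double-Y.\<close>

lemma YY_square:
  assumes Y: "open_graph n n (YY n a b)"
  shows "graph_elt n (YY n a b) \<otimes>\<^bsub>GraphEnd n\<^esub> graph_elt n (YY n a b) =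
    GraphCat_scale n n (Apow 3 + Apow (-3)) (graph_elt n (YY n a b))"
proof -
  let ?f = "\<lambda>j. if j \<in> {a, b} then Inner 0 else Up j"
  let ?G = "strands n ?f {#(Inner 4, Up a), (Inner 4, Up b), (Inner 4, Inner 1), (Inner 3, Inner 0)#}"
  let ?H = "strands n ?f {#(Inner 4, Up a), (Inner 4, Up b), (Inner 4, Inner 1),
    (Inner 3, Inner 1), (Inner 3, Inner 1), (Inner 3, Inner 0)#}"
  let ?K = "strands n ?f {#(Inner 4, Up a), (Inner 4, Up b), (Inner 4, Inner 0)#}"
  have H: "open_graph n n ?H" "graph_elt n (graph_comp (YY n a b) (YY n a b)) = graph_elt n ?H"
    unfolding YY_def
    by (rule strands_comp[OF Y[unfolded YY_def] Y[unfolded YY_def]]; rule strands_cong; auto)+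
  have HG: "?H = ?G + {#(Inner 3, Inner 1), (Inner 3, Inner 1)#}"
    unfolding strands_def by (simp add: add_mset_commute)
  have no: "{j \<in> {1..n}. ?f j = Inner k} = {}" if "k \<noteq> 0" for k using that by auto
  have "is_source ?H (Inner 3)" "is_sink ?H (Inner 1)"
    by (auto simp: is_source_def is_sink_def strands_degrees outdeg_simps no)
  note rel = local_rel.bigon[OF HG this]
  have "smooths (strands n ?f {#(Inner 4, Up a), (Inner 4, Up b)#} + {#(Inner 4, Inner 1), (Inner 1, Inner 3), (Inner 3, Inner 0)#})
      (strands n ?f {#(Inner 4, Up a), (Inner 4, Up b)#} + {#(Inner 4, Inner 0)#})"
    by (rule smooths_two) (auto split: if_splits)
  then have sm: "smooths (?G + {#(Inner 1, Inner 3)#}) ?K" by (simp add: strands_def add_mset_commute)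
  have G: "open_graph n n (?G + {#(Inner 1, Inner 3)#})"
    using local_rel_open_graph[OF rel _ H(1)] by (simp add: bigon_coeff_nonzero)
  define \<phi> where "\<phi> v = (case v of Inner k \<Rightarrow> Inner ((id(1 := 4, 4 := 1)) k) | _ \<Rightarrow> v)" for v
  have inj: "inj \<phi>" unfolding \<phi>_def by (rule inj_Inner_perm) (auto simp: inj_def)
  have "rename \<phi> ?K = YY n a b" unfolding YY_def
    by (subst rename_strands) (auto simp: \<phi>_def intro!: strands_cong)
  then have K: "graph_elt n ?K = graph_elt n (YY n a b)"
    using graph_elt_rename(2)[OF smooths_open_graph(1)[OF sm G] inj] by (simp add: \<phi>_def)
  have "graph_elt n ?H = GraphCat_scale n n (Apow 3 + Apow (-3)) (graph_elt n (?G + {#(Inner 1, Inner 3)#}))"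
    unfolding graph_elt_def GraphCat_scale_class using graph_class_local_rel[OF H(1) rel] by simp
  then show ?thesis
    using H(2) K smooths_open_graph(2)[OF sm G] unfolding graph_elt_mult[OF Y Y] by (simp add: graph_elt_def)
qed

lemma YY_commute:
  assumes Y: "open_graph n n (YY n a b)" "open_graph n n (YY n c d)" and dist: "distinct [a, b, c, d]"
  shows "graph_elt n (YY n a b) \<otimes>\<^bsub>GraphEnd n\<^esub> graph_elt n (YY n c d) =
    graph_elt n (YY n c d) \<otimes>\<^bsub>GraphEnd n\<^esub> graph_elt n (YY n a b)"
proof -
  let ?H = "\<lambda>a b c d. strands n (\<lambda>j. if j \<in> {c, d} then Inner 0 else if j \<in> {a, b} then Inner 1 else Up j)
    {#(Inner 4, Up a), (Inner 4, Up b), (Inner 4, Inner 1), (Inner 3, Up c), (Inner 3, Up d), (Inner 3, Inner 0)#}"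
  have H: "open_graph n n (?H a b c d)"
      "graph_elt n (graph_comp (YY n a b) (YY n c d)) = graph_elt n (?H a b c d)"
    if Y: "open_graph n n (YY n a b)" "open_graph n n (YY n c d)" and dist: "distinct [a, b, c, d]" for a b c d
    unfolding YY_def
    by (rule strands_comp[OF Y[unfolded YY_def]]; rule strands_cong; use dist in auto)+
  have dist': "distinct [c, d, a, b]" using dist by auto
  define \<phi> where "\<phi> v = (case v of Inner k \<Rightarrow> Inner ((id(0 := 1, 1 := 0, 3 := 4, 4 := 3)) k) | _ \<Rightarrow> v)" for v
  have inj: "inj \<phi>" unfolding \<phi>_def by (rule inj_Inner_perm) (auto simp: inj_def)
  have "rename \<phi> (?H a b c d) = ?H c d a b"
    by (subst rename_strands) (use dist in \<open>auto simp: \<phi>_def add_mset_commute intro!: strands_cong\<close>)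
  then have "graph_elt n (?H a b c d) = graph_elt n (?H c d a b)"
    using graph_elt_rename(2)[OF H(1)[OF Y dist] inj] by (simp add: \<phi>_def)
  then show ?thesis
    using H(2)[OF Y dist] H(2)[OF Y(2,1) dist'] by (simp add: graph_elt_mult Y)
qed

text \<open>The source keeps the name 4 that it has in the triple product, so the smoothed product
  is this graph without a further renaming.\<close>

definition YYY :: "nat \<Rightarrow> nat \<Rightarrow> nat \<Rightarrow> nat \<Rightarrow> node dgraph" where
  "YYY n a b c = strands n (\<lambda>j. if j \<in> {a, b, c} then Inner 0 else Up j)
     {#(Inner 4, Up a), (Inner 4, Up b), (Inner 4, Up c)#}"

text \<open>The sink 1 of the top factor, the source 12 and the sink 3 of the middle factor and the
  source 9 of the bottom factor form a quadrilateral. One glueing frees strand \<open>c\<close> and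
  joins 4 to 0, which gives a double-Y; the other leads strand \<open>c\<close> into the bottom sink
  0 and out of the top source 4.\<close>

lemma YY_triple:
  assumes Y: "open_graph n n (YY n a b)" "open_graph n n (YY n b c)" and dist: "distinct [a, b, c]"
    and c: "c \<in> {1..n}"
  shows "graph_elt n (YY n a b) \<otimes>\<^bsub>GraphEnd n\<^esub> (graph_elt n (YY n b c) \<otimes>\<^bsub>GraphEnd n\<^esub> graph_elt n (YY n a b)) =
    graph_elt n (YY n a b) \<oplus>\<^bsub>GraphEnd n\<^esub> graph_elt n (YYY n a b c)" and "open_graph n n (YYY n a b c)"
proof -
  let ?g = "\<lambda>w j. if j \<in> {a, b} then Inner 0 else if j = c then w else Up j"
  let ?Q = "strands n (?g (Inner 1))
    {#(Inner 4, Up b), (Inner 4, Up c), (Inner 4, Inner 1), (Inner 3, Up a), (Inner 3, Inner 1), (Inner 3, Inner 0)#}"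
  have Q: "open_graph n n ?Q" "graph_elt n (graph_comp (YY n b c) (YY n a b)) = graph_elt n ?Q"
    unfolding YY_def
    by (rule strands_comp[OF Y(2,1)[unfolded YY_def]]; rule strands_cong; use dist in auto)+
  let ?G = "strands n (?g (Inner 3)) {#(Inner 4, Up a), (Inner 4, Up b), (Inner 4, Inner 1),
    (Inner 12, Up c), (Inner 9, Inner 0)#}"
  let ?F = "{#(Inner 4, Up a), (Inner 4, Up b), (Inner 4, Inner 1), (Inner 12, Inner 1), (Inner 12, Up c),
    (Inner 12, Inner 3), (Inner 9, Inner 1), (Inner 9, Inner 3), (Inner 9, Inner 0)#}"
  let ?H = "strands n (?g (Inner 3)) ?F"
  have H: "open_graph n n ?H" "graph_elt n (graph_comp (YY n a b) ?Q) = graph_elt n ?H"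
    unfolding YY_def
    by (rule strands_comp[OF Y(1)[unfolded YY_def] Q(1)]; rule strands_cong; use dist in auto)+
  have HG: "?H = ?G + {#(Inner 9, Inner 1), (Inner 12, Inner 1), (Inner 12, Inner 3), (Inner 9, Inner 3)#}"
    unfolding strands_def by (simp add: add_mset_commute)
  have no: "{j \<in> {1..n}. ?g (Inner 3) j = Inner k} = (if k = 3 then {c} else {})" if "k \<noteq> 0" for k
    using that c dist by auto
  have deg: "outdeg ?H (Inner k) = outdeg ?F (Inner k)"
    "indeg ?H (Inner k) = (if k = 3 then 1 else 0) + indeg ?F (Inner k)" if "k \<noteq> 0" for k
    unfolding strands_degrees no[OF that] by simp_all
  have "is_source ?H (Inner 9)" "is_sink ?H (Inner 1)" "is_source ?H (Inner 12)" "is_sink ?H (Inner 3)"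
    unfolding is_source_def is_sink_def deg[OF zero_neq_numeral[symmetric]] deg[OF one_neq_zero]
    by (simp_all add: outdeg_simps)
  note rel = local_rel.quadrilateral[OF HG _ this]
  let ?G1 = "?G + {#(Inner 1, Inner 9), (Inner 3, Inner 12)#}" and ?G2 = "?G + {#(Inner 1, Inner 12), (Inner 3, Inner 9)#}"
  have G: "open_graph n n ?G1" "open_graph n n ?G2" if "?G1 \<noteq> ?G2"
    by (rule local_rel_open_graph[OF rel _ H(1)];
      use that in \<open>simp add: in_keys_iff lookup_add lookup_single when_def\<close>)+
  \<comment> \<open>The two glueings are different graphs, so both are keys of the relation and
    thereby inherit openness.\<close>
  have "(Inner 1, Inner 9) \<in># {#(Inner 1, Inner 9), (Inner 3, Inner 12)#}"
    "(Inner 1, Inner 9) \<notin># {#(Inner 1, Inner 12), (Inner 3, Inner 9)#}" by simp_all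
  then have ne: "?G1 \<noteq> ?G2" unfolding add_left_cancel by metis
  let ?K1 = "strands n (?g (Up c)) {#(Inner 4, Up a), (Inner 4, Up b), (Inner 4, Inner 0)#}"
  let ?B = "\<lambda>F. image_mset (\<lambda>j. (Low j, ?g (Inner 3) j)) (mset_set ({1..n} - {c})) + F"
  have split: "strands n (?g w) F = ?B F + {#(Low c, w)#}" for w F
    unfolding strands_split[OF c] using dist by (auto intro!: image_mset_cong)
  have "smooths (?B {#(Inner 4, Up a), (Inner 4, Up b)#} + {#(Low c, Inner 3), (Inner 3, Inner 12), (Inner 12, Up c)#}
        + {#(Inner 4, Inner 1), (Inner 1, Inner 9), (Inner 9, Inner 0)#})
      (?B {#(Inner 4, Up a), (Inner 4, Up b)#} + {#(Low c, Inner 3), (Inner 3, Inner 12), (Inner 12, Up c)#}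
        + {#(Inner 4, Inner 0)#})"
    by (rule smooths_two) (auto split: if_splits)
  then have "smooths ?G1 (?B {#(Inner 4, Up a), (Inner 4, Up b), (Inner 4, Inner 0)#} +
      {#(Low c, Inner 3), (Inner 3, Inner 12), (Inner 12, Up c)#})"
    unfolding split by (simp add: add_mset_commute)
  moreover have "smooths \<dots> (?B {#(Inner 4, Up a), (Inner 4, Up b), (Inner 4, Inner 0)#} + {#(Low c, Up c)#})"
    by (rule smooths_two) (auto split: if_splits)
  ultimately have s1: "smooths ?G1 ?K1" unfolding split by (rule smooths_trans)
  have YYY: "YYY n a b c = strands n (?g (Inner 0)) {#(Inner 4, Up a), (Inner 4, Up b), (Inner 4, Up c)#}"
    unfolding YYY_def by (rule strands_cong) auto
  have "smooths (?B {#(Inner 4, Up a), (Inner 4, Up b)#} + {#(Low c, Inner 3), (Inner 3, Inner 9), (Inner 9, Inner 0)#}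
        + {#(Inner 4, Inner 1), (Inner 1, Inner 12), (Inner 12, Up c)#})
      (?B {#(Inner 4, Up a), (Inner 4, Up b)#} + {#(Low c, Inner 3), (Inner 3, Inner 9), (Inner 9, Inner 0)#}
        + {#(Inner 4, Up c)#})"
    by (rule smooths_two) (auto split: if_splits)
  then have "smooths ?G2 (?B {#(Inner 4, Up a), (Inner 4, Up b), (Inner 4, Up c)#} +
      {#(Low c, Inner 3), (Inner 3, Inner 9), (Inner 9, Inner 0)#})"
    unfolding split by (simp add: add_mset_commute)
  moreover have "smooths \<dots> (?B {#(Inner 4, Up a), (Inner 4, Up b), (Inner 4, Up c)#} + {#(Low c, Inner 0)#})"
    by (rule smooths_two) (auto split: if_splits)
  ultimately have s2: "smooths ?G2 (YYY n a b c)" unfolding YYY split by (rule smooths_trans)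
  show o: "open_graph n n (YYY n a b c)" by (rule smooths_open_graph(1)[OF s2 G(2)[OF ne]])
  define \<phi> where "\<phi> v = (case v of Inner k \<Rightarrow> Inner ((id(1 := 4, 4 := 1)) k) | _ \<Rightarrow> v)" for v
  have inj: "inj \<phi>" unfolding \<phi>_def by (rule inj_Inner_perm) (auto simp: inj_def)
  have "rename \<phi> ?K1 = YY n a b" unfolding YY_def
    by (subst rename_strands) (use dist in \<open>auto simp: \<phi>_def intro!: strands_cong\<close>)
  then have K: "graph_elt n ?K1 = graph_elt n (YY n a b)"
    using graph_elt_rename(2)[OF smooths_open_graph(1)[OF s1 G(1)[OF ne]] inj] by (simp add: \<phi>_def)
  have "graph_elt n ?H = graph_elt n ?G1 \<oplus>\<^bsub>GraphEnd n\<^esub> graph_elt n ?G2"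
    unfolding graph_elt_def GraphEnd_simps(4) by (rule graph_class_local_rel[OF H(1) rel]) simp
  then have "graph_elt n ?H = graph_elt n (YY n a b) \<oplus>\<^bsub>GraphEnd n\<^esub> graph_elt n (YYY n a b c)"
    using K smooths_open_graph(2)[OF s1 G(1)[OF ne]] smooths_open_graph(2)[OF s2 G(2)[OF ne]]
    by (simp add: graph_elt_def)
  then show "graph_elt n (YY n a b) \<otimes>\<^bsub>GraphEnd n\<^esub> (graph_elt n (YY n b c) \<otimes>\<^bsub>GraphEnd n\<^esub> graph_elt n (YY n a b)) =
    graph_elt n (YY n a b) \<oplus>\<^bsub>GraphEnd n\<^esub> graph_elt n (YYY n a b c)"
    using Q H(2) by (simp add: graph_elt_mult Y)
qed

lemma YYY_reverse: "YYY n a b c = YYY n c b a"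
  unfolding YYY_def by (auto simp: add_mset_commute intro!: strands_cong)


section \<open>The images of the braid generators\<close>

declare One_nat_def [simp del]

abbreviation gscale :: "nat \<Rightarrow> laurent \<Rightarrow> (node dgraph \<Rightarrow>\<^sub>0 laurent) set \<Rightarrow> (node dgraph \<Rightarrow>\<^sub>0 laurent) set" where
  "gscale n \<equiv> GraphCat_scale n n"

lemma gscale_closed: "X \<in> carrier (GraphEnd n) \<Longrightarrow> gscale n c X \<in> carrier (GraphEnd n)"
  by (auto elim!: GraphEnd_carrierE simp: GraphCat_scale_class intro!: graph_class_carrier graph_combs_lscale)

lemma gscale_add:
  "X \<in> carrier (GraphEnd n) \<Longrightarrow> Y \<in> carrier (GraphEnd n) \<Longrightarrow>
    gscale n c (X \<oplus>\<^bsub>GraphEnd n\<^esub> Y) = gscale n c X \<oplus>\<^bsub>GraphEnd n\<^esub> gscale n c Y"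
  by (elim GraphEnd_carrierE) (simp add: GraphCat_scale_class GraphEnd_simps(4) lscale_add_right)

lemma gscale_add_coeff:
  "X \<in> carrier (GraphEnd n) \<Longrightarrow> gscale n c X \<oplus>\<^bsub>GraphEnd n\<^esub> gscale n d X = gscale n (c + d) X"
  by (elim GraphEnd_carrierE) (simp add: GraphCat_scale_class GraphEnd_simps(4) lscale_add_left)

lemma gscale_mult:
  "X \<in> carrier (GraphEnd n) \<Longrightarrow> Y \<in> carrier (GraphEnd n) \<Longrightarrow>
    gscale n c X \<otimes>\<^bsub>GraphEnd n\<^esub> Y = gscale n c (X \<otimes>\<^bsub>GraphEnd n\<^esub> Y)"
  "X \<in> carrier (GraphEnd n) \<Longrightarrow> Y \<in> carrier (GraphEnd n) \<Longrightarrow>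
    X \<otimes>\<^bsub>GraphEnd n\<^esub> gscale n c Y = gscale n c (X \<otimes>\<^bsub>GraphEnd n\<^esub> Y)"
  by (auto elim!: GraphEnd_carrierE simp: GraphCat_scale_class GraphEnd_simps(5) graph_combs_lscale
      bilin_ext_lscale_left bilin_ext_lscale_right)

lemma gscale_gscale: "X \<in> carrier (GraphEnd n) \<Longrightarrow> gscale n c (gscale n d X) = gscale n (c * d) X"
  by (elim GraphEnd_carrierE) (simp add: GraphCat_scale_class)

lemma gscale_1: "X \<in> carrier (GraphEnd n) \<Longrightarrow> gscale n 1 X = X"
  and gscale_0: "X \<in> carrier (GraphEnd n) \<Longrightarrow> gscale n 0 X = \<zero>\<^bsub>GraphEnd n\<^esub>"
  by (auto elim!: GraphEnd_carrierE simp: GraphCat_scale_class GraphEnd_simps(2))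

section \<open>Crossings as combinations of the identity and a double-Y\<close>

context
  fixes n :: nat
begin

interpretation R: ring "GraphEnd n" by (rule ring_GraphEnd)

lemmas gscale_rules = gscale_closed gscale_add gscale_mult gscale_gscale R.l_distr R.r_distr

definition crossing_elt :: "laurent \<Rightarrow> laurent \<Rightarrow> (node dgraph \<Rightarrow>\<^sub>0 laurent) set \<Rightarrow> (node dgraph \<Rightarrow>\<^sub>0 laurent) set" where
  "crossing_elt a b p = gscale n a \<one>\<^bsub>GraphEnd n\<^esub> \<oplus>\<^bsub>GraphEnd n\<^esub> gscale n b p"

lemma crossing_elt_closed: "p \<in> carrier (GraphEnd n) \<Longrightarrow> crossing_elt a b p \<in> carrier (GraphEnd n)"
  unfolding crossing_elt_def by (simp add: gscale_closed)

lemma crossing_elt_commute: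
  assumes "p \<in> carrier (GraphEnd n)" "x \<in> carrier (GraphEnd n)"
    "y \<in> carrier (GraphEnd n)" "p \<otimes>\<^bsub>GraphEnd n\<^esub> x = x \<otimes>\<^bsub>GraphEnd n\<^esub> y" "y \<in> carrier (GraphEnd n)"
  shows "crossing_elt a b p \<otimes>\<^bsub>GraphEnd n\<^esub> x = x \<otimes>\<^bsub>GraphEnd n\<^esub> crossing_elt a b y"
  using assms unfolding crossing_elt_def by (simp add: gscale_rules)

text \<open>In the product the coefficient of \<open>p\<close> is
  \<open>a * d + b * c + b * d * \<delta>\<close>. For a crossing and its inverse this is -A^3 -
  A^-3 + \<delta>, hence zero.\<close>

lemma crossing_elt_inverse:
  assumes p: "p \<in> carrier (GraphEnd n)" "p \<otimes>\<^bsub>GraphEnd n\<^esub> p = gscale n \<delta> p"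
    and "a * c = 1" "a * d + b * c + b * d * \<delta> = 0"
  shows "crossing_elt a b p \<otimes>\<^bsub>GraphEnd n\<^esub> crossing_elt c d p = \<one>\<^bsub>GraphEnd n\<^esub>"
proof -
  have "gscale n (a * d) p \<oplus>\<^bsub>GraphEnd n\<^esub> (gscale n (b * c) p \<oplus>\<^bsub>GraphEnd n\<^esub> gscale n (b * d * \<delta>) p) = \<zero>\<^bsub>GraphEnd n\<^esub>"
    using p assms(4) by (simp add: gscale_add_coeff gscale_0 add.assoc[symmetric])
  moreover have "crossing_elt a b p \<otimes>\<^bsub>GraphEnd n\<^esub> crossing_elt c d p =
      gscale n (a * c) \<one>\<^bsub>GraphEnd n\<^esub> \<oplus>\<^bsub>GraphEnd n\<^esub>
      (gscale n (a * d) p \<oplus>\<^bsub>GraphEnd n\<^esub> (gscale n (b * c) p \<oplus>\<^bsub>GraphEnd n\<^esub> gscale n (b * d * \<delta>) p))"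
    using p unfolding crossing_elt_def by (simp add: gscale_rules R.a_ac ac_simps)
  ultimately show ?thesis using assms(3) by (simp add: gscale_1)
qed

text \<open>Expansion produces \<open>a * a * b\<close> times \<open>p\<close> twice. One copy
  cancels against the terms from \<open>p\<close> squared and from the summand \<open>p\<close> of
  the triple product, and what remains is symmetric in \<open>p\<close> and
  \<open>q\<close>.\<close>

lemma crossing_elt_triple:
  assumes p: "p \<in> carrier (GraphEnd n)" "q \<in> carrier (GraphEnd n)" "t \<in> carrier (GraphEnd n)"
    and pp: "p \<otimes>\<^bsub>GraphEnd n\<^esub> p = gscale n \<delta> p"
    and pqp: "p \<otimes>\<^bsub>GraphEnd n\<^esub> (q \<otimes>\<^bsub>GraphEnd n\<^esub> p) = p \<oplus>\<^bsub>GraphEnd n\<^esub> t"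
    and ab: "a * a * b + a * b * b * \<delta> + b * b * b = 0"
  shows "crossing_elt a b p \<otimes>\<^bsub>GraphEnd n\<^esub> (crossing_elt a b q \<otimes>\<^bsub>GraphEnd n\<^esub> crossing_elt a b p) =
    gscale n (a * a * a) \<one>\<^bsub>GraphEnd n\<^esub> \<oplus>\<^bsub>GraphEnd n\<^esub> (gscale n (b * b * b) t \<oplus>\<^bsub>GraphEnd n\<^esub>
      ((gscale n (a * a * b) p \<oplus>\<^bsub>GraphEnd n\<^esub> gscale n (a * a * b) q) \<oplus>\<^bsub>GraphEnd n\<^esub>
      (gscale n (a * b * b) (p \<otimes>\<^bsub>GraphEnd n\<^esub> q) \<oplus>\<^bsub>GraphEnd n\<^esub> gscale n (a * b * b) (q \<otimes>\<^bsub>GraphEnd n\<^esub> p))))" (is "_ = ?rhs")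
proof -
  let ?z = "gscale n (a * a * b) p \<oplus>\<^bsub>GraphEnd n\<^esub> (gscale n (a * b * b * \<delta>) p \<oplus>\<^bsub>GraphEnd n\<^esub> gscale n (b * b * b) p)"
  have z: "?z = \<zero>\<^bsub>GraphEnd n\<^esub>"
    using p ab by (simp add: gscale_add_coeff gscale_0 add.assoc[symmetric])
  have "crossing_elt a b p \<otimes>\<^bsub>GraphEnd n\<^esub> (crossing_elt a b q \<otimes>\<^bsub>GraphEnd n\<^esub> crossing_elt a b p) = ?rhs \<oplus>\<^bsub>GraphEnd n\<^esub> ?z"
    using p unfolding crossing_elt_def by (simp add: gscale_rules pp pqp R.a_ac ac_simps)
  then show ?thesis unfolding z using p by (simp add: gscale_closed)
qed


section \<open>Relations between the generators\<close>

abbreviation gmult (infixl "\<odot>" 70) where "x \<odot> y \<equiv> x \<otimes>\<^bsub>GraphEnd n\<^esub> y"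

abbreviation P_gen :: "nat \<Rightarrow> (node dgraph \<Rightarrow>\<^sub>0 laurent) set" where
  "P_gen i \<equiv> graph_elt n (double_Y n i)"

abbreviation V_gen :: "nat \<Rightarrow> (node dgraph \<Rightarrow>\<^sub>0 laurent) set" where
  "V_gen i \<equiv> graph_elt n (virtual_crossing n i)"

lemma open_YY: "i \<in> {1..<n} \<Longrightarrow> open_graph n n (YY n i (i + 1))"
  using open_graph_generators(1)[of i n] double_Y_eq_YY[of i n] by simp

lemma open_permute_swap: "i \<in> {1..<n} \<Longrightarrow> open_graph n n (permute_graph n (swap i))"
  using open_graph_generators(2)[of i n] virtual_crossing_eq_permute_graph[of i n] by simp

lemma P_gen_closed: "i \<in> {1..<n} \<Longrightarrow> P_gen i \<in> carrier (GraphEnd n)"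
  and V_gen_closed: "i \<in> {1..<n} \<Longrightarrow> V_gen i \<in> carrier (GraphEnd n)"
  using open_graph_generators[of i n] by (auto intro: graph_elt_carrier)

lemma P_gen_square: "i \<in> {1..<n} \<Longrightarrow> P_gen i \<odot> P_gen i = gscale n (Apow 3 + Apow (-3)) (P_gen i)"
  by (simp add: double_Y_eq_YY YY_square[OF open_YY, simplified])

lemma V_P_gen: "i \<in> {1..<n} \<Longrightarrow> V_gen i \<odot> P_gen i = P_gen i"
  and P_V_gen: "i \<in> {1..<n} \<Longrightarrow> P_gen i \<odot> V_gen i = P_gen i"
  using YY_swap[OF open_permute_swap open_YY, of i]
  by (simp_all only: graph_elt_mult open_YY open_permute_swap double_Y_eq_YY virtual_crossing_eq_permute_graph)

lemma permute_elt_mult: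
  assumes "open_graph n n (permute_graph n \<sigma>)" "open_graph n n (permute_graph n \<tau>)" "\<And>j. \<rho> j = \<sigma> (\<tau> j)"
  shows "graph_elt n (permute_graph n \<sigma>) \<odot> graph_elt n (permute_graph n \<tau>) = graph_elt n (permute_graph n \<rho>)"
    and "open_graph n n (permute_graph n \<rho>)"
proof -
  have "\<rho> = \<sigma> \<circ> \<tau>" using assms(3) by auto
  then show "graph_elt n (permute_graph n \<sigma>) \<odot> graph_elt n (permute_graph n \<tau>) = graph_elt n (permute_graph n \<rho>)"
    "open_graph n n (permute_graph n \<rho>)"
    using permute_graph_comp[OF assms(1,2)] by (simp_all add: graph_elt_mult assms(1,2))
qed

lemma V_gen_square: "i \<in> {1..<n} \<Longrightarrow> V_gen i \<odot> V_gen i = \<one>\<^bsub>GraphEnd n\<^esub>"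
  using permute_elt_mult(1)[OF open_permute_swap open_permute_swap, of i i "\<lambda>j. j"]
  by (simp add: virtual_crossing_eq_permute_graph GraphEnd_simps(3) vertical_strands permute_graph_def)

lemma V_gen_braid:
  assumes i: "i \<in> {1..<n}" "i + 1 \<in> {1..<n}"
  shows "V_gen i \<odot> (V_gen (i + 1) \<odot> V_gen i) = V_gen (i + 1) \<odot> (V_gen i \<odot> V_gen (i + 1))"
proof -
  note o = open_permute_swap[OF i(1)] open_permute_swap[OF i(2)]
  note m = permute_elt_mult[OF o(2,1) HOL.refl] permute_elt_mult[OF o(1,2) HOL.refl]
  show ?thesis
    unfolding virtual_crossing_eq_permute_graph[OF i(1)] virtual_crossing_eq_permute_graph[OF i(2)] m
      permute_elt_mult(1)[OF o(1) m(2) HOL.refl] permute_elt_mult(1)[OF o(2) m(4) HOL.refl]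
    by (intro arg_cong[where f = "\<lambda>\<sigma>. graph_elt n (permute_graph n \<sigma>)"]) auto
qed

lemma V_V_P_gen:
  assumes i: "i \<in> {1..<n}" "i + 1 \<in> {1..<n}"
  shows "V_gen i \<odot> (V_gen (i + 1) \<odot> P_gen i) = P_gen (i + 1) \<odot> (V_gen i \<odot> V_gen (i + 1))"
proof -
  \<comment> \<open>The permutation of \<open>v\<^sub>i v\<^sub>i\<^sub>+\<^sub>1\<close> carries
    the positions i, i + 1 to i + 1, i + 2, so it shifts the double-Y by one.\<close>
  define \<sigma> where "\<sigma> j = swap i (swap (i + 1) j)" for j
  have \<sigma>: "\<sigma> i = i + 1" "\<sigma> (i + 1) = i + 1 + 1" "inj \<sigma>" by (auto simp: \<sigma>_def inj_def split: if_splits)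
  note m = permute_elt_mult[OF open_permute_swap[OF i(1)] open_permute_swap[OF i(2)] \<sigma>_def]
  have "graph_elt n (permute_graph n \<sigma>) \<odot> P_gen i = P_gen (i + 1) \<odot> graph_elt n (permute_graph n \<sigma>)"
    using permute_YY_commute[OF m(2) open_YY[OF i(1)] _ _ \<sigma>(3)] open_YY[OF i(1)] open_YY[OF i(2)] m(2)
    unfolding double_Y_eq_YY[OF i(1)] double_Y_eq_YY[OF i(2)] \<sigma>(1,2) by (simp add: graph_elt_mult)
  then show ?thesis
    using i by (simp only: m(1)[symmetric] virtual_crossing_eq_permute_graph[symmetric] R.m_assoc V_gen_closed P_gen_closed)
qed

lemma far_generators:
  assumes ij: "i \<in> {1..<n}" "j \<in> {1..<n}" "i + 1 < j \<or> j + 1 < i"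
  shows "P_gen i \<odot> P_gen j = P_gen j \<odot> P_gen i" "V_gen i \<odot> V_gen j = V_gen j \<odot> V_gen i"
    "V_gen i \<odot> P_gen j = P_gen j \<odot> V_gen i"
proof -
  show "P_gen i \<odot> P_gen j = P_gen j \<odot> P_gen i"
    using YY_commute[OF open_YY[OF ij(1)] open_YY[OF ij(2)]] ij by (auto simp: double_Y_eq_YY)
  note o = open_permute_swap[OF ij(1)] open_permute_swap[OF ij(2)]
  show "V_gen i \<odot> V_gen j = V_gen j \<odot> V_gen i"
    unfolding virtual_crossing_eq_permute_graph[OF ij(1)] virtual_crossing_eq_permute_graph[OF ij(2)]
      permute_elt_mult(1)[OF o HOL.refl] permute_elt_mult(1)[OF o(2,1) HOL.refl]
    using ij(3) by (intro arg_cong[where f = "\<lambda>\<sigma>. graph_elt n (permute_graph n \<sigma>)"]) auto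
  have "swap i j = j" "swap i (j + 1) = j + 1" "inj (swap i)" using ij(3) by (auto simp: inj_def)
  then show "V_gen i \<odot> P_gen j = P_gen j \<odot> V_gen i"
    using permute_YY_commute[OF o(1) open_YY[OF ij(2)]] open_YY[OF ij(2)] o(1) ij
    by (simp add: graph_elt_mult double_Y_eq_YY virtual_crossing_eq_permute_graph)
qed

text \<open>\<open>YY_triple\<close> is applied to the positions i, i + 1, i + 2 in this and in the
  opposite order. Reversal does not change \<open>YYY\<close>, so both products have the same
  remainder \<open>t\<close>.\<close>

lemma P_gen_triple:
  assumes i: "i \<in> {1..<n}" "i + 1 \<in> {1..<n}"
  obtains t where "t \<in> carrier (GraphEnd n)"
    "P_gen i \<odot> (P_gen (i + 1) \<odot> P_gen i) = P_gen i \<oplus>\<^bsub>GraphEnd n\<^esub> t"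
    "P_gen (i + 1) \<odot> (P_gen i \<odot> P_gen (i + 1)) = P_gen (i + 1) \<oplus>\<^bsub>GraphEnd n\<^esub> t"
proof -
  let ?k = "i + 1" and ?l = "i + 1 + 1"
  note o = open_YY[OF i(1)] open_YY[OF i(2)]
  have 1: "distinct [i, ?k, ?l]" "?l \<in> {1..n}" and 2: "distinct [?l, ?k, i]" "i \<in> {1..n}"
    using i by auto
  have s: "YY n ?l ?k = YY n ?k ?l" "YY n ?k i = YY n i ?k" "YYY n ?l ?k i = YYY n i ?k ?l"
    by (rule YY_sym YYY_reverse)+
  have o': "open_graph n n (YY n ?l ?k)" "open_graph n n (YY n ?k i)" unfolding s by (rule o)+
  show ?thesis
  proof (rule that)
    show "graph_elt n (YYY n i ?k ?l) \<in> carrier (GraphEnd n)" by (rule graph_elt_carrier[OF YY_triple(2)[OF o 1]])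
  qed (unfold double_Y_eq_YY[OF i(1)] double_Y_eq_YY[OF i(2)],
      rule YY_triple(1)[OF o 1], rule YY_triple(1)[OF o' 2, unfolded s])
qed

section \<open>Images of braid words and the braid relations\<close>

definition letter_comb :: "kind \<times> nat \<Rightarrow> node dgraph \<Rightarrow>\<^sub>0 laurent" where
  "letter_comb l = (if fst l = Virt then Poly_Mapping.single (virtual_crossing n (snd l)) 1
     else Poly_Mapping.single (vertical {1..n}) (Apow (2 * crossing_sign (fst l))) +
       Poly_Mapping.single (double_Y n (snd l)) (- Apow (- crossing_sign (fst l))))"

text \<open>Kept as a combination of graphs rather than a class, because expanding this product
  yields one basis graph for each state.\<close>

primrec word_comb :: "bword \<Rightarrow> node dgraph \<Rightarrow>\<^sub>0 laurent" where
  "word_comb [] = Poly_Mapping.single (vertical {1..n}) 1"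
| "word_comb (l # w) = bilin_ext graph_comp (letter_comb l) (word_comb w)"

abbreviation "letter_elt l \<equiv> graph_class n n (letter_comb l)"
abbreviation "word_elt w \<equiv> graph_class n n (word_comb w)"

lemma letter_comb_closed: "snd l \<in> {1..<n} \<Longrightarrow> letter_comb l \<in> graph_combs n n"
  using open_graph_generators[of "snd l" n]
  by (auto simp: letter_comb_def intro!: graph_combs_add graph_combs_single open_graph_identity)

lemma word_comb_closed: "w \<in> bwords n \<Longrightarrow> word_comb w \<in> graph_combs n n"
  by (induction w) (auto simp: bwords_def intro!: identity_combs bilin_ext_combs letter_comb_closed)

lemma letter_elt_closed: "snd l \<in> {1..<n} \<Longrightarrow> letter_elt l \<in> carrier (GraphEnd n)"
  by (intro graph_class_carrier letter_comb_closed)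

lemma word_elt_closed: "w \<in> bwords n \<Longrightarrow> word_elt w \<in> carrier (GraphEnd n)"
  by (intro graph_class_carrier word_comb_closed)

lemma word_elt_Nil: "word_elt [] = \<one>\<^bsub>GraphEnd n\<^esub>"
  by (simp add: GraphEnd_simps(3) graph_elt_def)

lemma word_elt_Cons:
  "l # w \<in> bwords n \<Longrightarrow> word_elt (l # w) = letter_elt l \<odot> word_elt w"
  by (simp add: GraphEnd_simps(5) letter_comb_closed word_comb_closed bwords_def)

lemma bwords_append: "u @ v \<in> bwords n \<longleftrightarrow> u \<in> bwords n \<and> v \<in> bwords n"
  unfolding bwords_def by auto

lemma word_elt_append:
  assumes "u @ v \<in> bwords n" shows "word_elt (u @ v) = word_elt u \<odot> word_elt v"
  using assms
proof (induction u)
  case Nil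
  then show ?case unfolding word_elt_Nil by (simp add: word_elt_closed)
next
  case (Cons l u)
  have *: "snd l \<in> {1..<n}" "u \<in> bwords n" "v \<in> bwords n" "u @ v \<in> bwords n" "l # u \<in> bwords n"
    using Cons.prems by (auto simp: bwords_def)
  then show ?case using Cons
    by (simp only: append_Cons word_elt_Cons R.m_assoc letter_elt_closed word_elt_closed)
qed

lemma letter_elt_Virt: "letter_elt (Virt, i) = V_gen i"
  unfolding letter_comb_def graph_elt_def by simp

lemma letter_elt_classical:
  "\<kappa> \<noteq> Virt \<Longrightarrow> letter_elt (\<kappa>, i) =
    crossing_elt (Apow (2 * crossing_sign \<kappa>)) (- Apow (- crossing_sign \<kappa>)) (P_gen i)"
  unfolding letter_comb_def crossing_elt_def
  by (simp add: GraphEnd_simps(3,4) graph_elt_def GraphCat_scale_class)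

lemma letter_elt_commute:
  assumes i: "i \<in> {1..<n}" and x: "x \<in> carrier (GraphEnd n)"
    and "P_gen i \<odot> x = x \<odot> P_gen i" "V_gen i \<odot> x = x \<odot> V_gen i"
  shows "letter_elt (\<kappa>, i) \<odot> x = x \<odot> letter_elt (\<kappa>, i)"
  using assms P_gen_closed[OF i]
  by (cases "\<kappa> = Virt") (simp_all add: letter_elt_Virt letter_elt_classical crossing_elt_commute del: One_nat_def)

lemma far_letters:
  assumes ij: "i \<in> {1..<n}" "j \<in> {1..<n}" "i + 1 < j \<or> j + 1 < i"
  shows "letter_elt (\<kappa>, i) \<odot> letter_elt (\<kappa>', j) = letter_elt (\<kappa>', j) \<odot> letter_elt (\<kappa>, i)"
proof (rule letter_elt_commute[OF ij(1) letter_elt_closed])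
  have ji: "j + 1 < i \<or> i + 1 < j" using ij(3) by blast
  note c = far_generators[OF ij] far_generators[OF ij(2,1) ji]
  show "P_gen i \<odot> letter_elt (\<kappa>', j) = letter_elt (\<kappa>', j) \<odot> P_gen i"
    by (rule letter_elt_commute[OF ij(2) P_gen_closed[OF ij(1)], symmetric]) (rule c)+
  show "V_gen i \<odot> letter_elt (\<kappa>', j) = letter_elt (\<kappa>', j) \<odot> V_gen i"
    by (rule letter_elt_commute[OF ij(2) V_gen_closed[OF ij(1)], symmetric]) (rule c c[symmetric])+
qed (use ij in simp)

lemma classical_inverse:
  assumes i: "i \<in> {1..<n}"
  shows "letter_elt (Pos, i) \<odot> letter_elt (Neg, i) = \<one>\<^bsub>GraphEnd n\<^esub>"
    "letter_elt (Neg, i) \<odot> letter_elt (Pos, i) = \<one>\<^bsub>GraphEnd n\<^esub>"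
  unfolding letter_elt_classical[OF kind.distinct(3)] letter_elt_classical[OF kind.distinct(5)]
  by (rule crossing_elt_inverse[OF P_gen_closed[OF i] P_gen_square[OF i]];
      simp add: crossing_sign_def Apow_mult Apow_0 algebra_simps)+

lemma classical_braid:
  assumes i: "i \<in> {1..<n}" "i + 1 \<in> {1..<n}"
  shows "letter_elt (Pos, i) \<odot> (letter_elt (Pos, i + 1) \<odot> letter_elt (Pos, i)) =
    letter_elt (Pos, i + 1) \<odot> (letter_elt (Pos, i) \<odot> letter_elt (Pos, i + 1))"
proof -
  obtain t where t: "t \<in> carrier (GraphEnd n)"
    "P_gen i \<odot> (P_gen (i + 1) \<odot> P_gen i) = P_gen i \<oplus>\<^bsub>GraphEnd n\<^esub> t"
    "P_gen (i + 1) \<odot> (P_gen i \<odot> P_gen (i + 1)) = P_gen (i + 1) \<oplus>\<^bsub>GraphEnd n\<^esub> t"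
    by (rule P_gen_triple[OF i])
  \<comment> \<open>The three terms are -A^3, A^3 + A^-3 and -A^-3.\<close>
  have ab: "a * a * b + a * b * b * (Apow 3 + Apow (-3)) + b * b * b = 0"
    if "a = Apow 2" "b = - Apow (- 1)" for a b
    unfolding that by (simp add: Apow_mult algebra_simps)
  note p = P_gen_closed[OF i(1)] P_gen_closed[OF i(2)]
  show ?thesis
    unfolding letter_elt_classical[OF kind.distinct(3)] crossing_sign_def kind.case mult_1_right
      crossing_elt_triple[OF p t(1) P_gen_square[OF i(1)] t(2) ab[OF HOL.refl HOL.refl]]
      crossing_elt_triple[OF p(2,1) t(1) P_gen_square[OF i(2)] t(3) ab[OF HOL.refl HOL.refl]]
    using p by (simp add: R.a_comm gscale_closed)
qed

lemma word_elt_relator: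
  assumes "vb_relator l r" "l \<in> bwords n" "r \<in> bwords n" shows "word_elt l = word_elt r"
proof -
  have 2: "word_elt [x, y] = letter_elt x \<odot> letter_elt y" if "[x, y] \<in> bwords n" for x y
    using that word_elt_Cons[of x "[y]"] word_elt_Cons[of y "[]"] R.r_one[OF letter_elt_closed[of y]]
    unfolding word_elt_Nil by (simp add: bwords_def)
  have 3: "word_elt [x, y, z] = letter_elt x \<odot> (letter_elt y \<odot> letter_elt z)" if "[x, y, z] \<in> bwords n" for x y z
    using that word_elt_Cons[of x "[y, z]"] 2[of y z] by (simp add: bwords_def)
  from assms show ?thesis
  proof cases
    case (1 i)
    then show ?thesis using assms(2) classical_inverse(1)[of i] 2 by (simp add: word_elt_Nil bwords_def del: word_comb.simps)
  next
    case (2 i)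
    then show ?thesis using assms(2) classical_inverse(2)[of i] \<open>\<And>x y. _ \<Longrightarrow> word_elt [x, y] = _\<close>
      by (simp add: word_elt_Nil bwords_def del: word_comb.simps)
  next
    case (3 i)
    then show ?thesis using assms(2) V_gen_square[of i] 2
      by (simp add: word_elt_Nil letter_elt_Virt bwords_def del: word_comb.simps)
  next
    case (4 i)
    then show ?thesis using assms(2,3) classical_braid[of i] \<open>\<And>x y z. _ \<Longrightarrow> word_elt [x, y, z] = _\<close>
      by (simp add: bwords_def del: word_comb.simps)
  next
    case (5 i)
    then show ?thesis using assms(2,3) V_gen_braid[of i] 3
      by (simp add: letter_elt_Virt bwords_def del: word_comb.simps)
  next
    case (6 i)
    then have i: "i \<in> {1..<n}" "i + 1 \<in> {1..<n}" using assms(2) by (auto simp: bwords_def)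
    note cl = P_gen_closed[OF i(1)] P_gen_closed[OF i(2)] V_gen_closed[OF i(1)] V_gen_closed[OF i(2)]
    \<comment> \<open>Only the double-Y part of the crossing has to pass the two virtual crossings;
      its identity part commutes with everything.\<close>
    have "P_gen (i + 1) \<odot> (V_gen i \<odot> V_gen (i + 1)) = (V_gen i \<odot> V_gen (i + 1)) \<odot> P_gen i"
      using V_V_P_gen[OF i] cl by (simp only: R.m_assoc)
    from crossing_elt_commute[OF cl(2) _ cl(1) this cl(1)]
    show ?thesis using 6 assms(2,3) 3 cl i
      by (simp only: letter_elt_Virt letter_elt_classical[OF kind.distinct(3)] R.m_closed R.m_assoc crossing_elt_closed)
  next
    case (7 i j \<kappa> \<kappa>')
    then show ?thesis using assms(2,3) far_letters[of i j \<kappa> \<kappa>'] 2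
      by (simp add: bwords_def del: word_comb.simps)
  qed
qed

lemma vb_eq_bwords: "(u, v) \<in> vb_eq n \<Longrightarrow> u \<in> bwords n \<and> v \<in> bwords n"
  by (induction rule: vb_eq.induct) auto

lemma word_elt_vb_eq: "(u, v) \<in> vb_eq n \<Longrightarrow> word_elt u = word_elt v"
proof (induction rule: vb_eq.induct)
  case (step l r u v)
  then show ?case
    using word_elt_relator[of l r] by (simp only: word_elt_append bwords_append)
qed simp_all

end


section \<open>The group algebra and its quotient\<close>

lemma vb_eq_equiv: "equiv (bwords n) (vb_eq n)"
  by (rule equivI) (auto simp: refl_on_def sym_def trans_def intro: vb_eq.intros dest: vb_eq_bwords)

lemma vb_eq_append:
  assumes "(u, u') \<in> vb_eq n" "(v, v') \<in> vb_eq n" shows "(u @ v, u' @ v') \<in> vb_eq n"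
proof -
  have "(x @ u @ y, x @ u' @ y) \<in> vb_eq n" if "(u, u') \<in> vb_eq n" "x \<in> bwords n" "y \<in> bwords n" for u u' x y
    using that
  proof (induction rule: vb_eq.induct)
    case (step l r a b)
    then show ?case using vb_eq.step[of l r "x @ a" "b @ y" n] by (simp add: bwords_append)
  qed (auto intro: vb_eq.intros simp: bwords_append)
  from this[OF assms(1), of "[]" v] this[OF assms(2), of u' "[]"]
  show ?thesis using vb_eq_bwords[OF assms(1)] vb_eq_bwords[OF assms(2)]
    by (auto simp: bwords_def intro: vb_eq.trans)
qed

lemma vb_class_eq_iff:
  "u \<in> bwords n \<Longrightarrow> v \<in> bwords n \<Longrightarrow> vb_class n u = vb_class n v \<longleftrightarrow> (u, v) \<in> vb_eq n"
  unfolding vb_class_def by (rule eq_equiv_class_iff[OF vb_eq_equiv])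

lemma VB_carrierE:
  assumes "b \<in> carrier (VB n)"
  obtains w where "w \<in> bwords n" "b = vb_class n w"
  using assms unfolding VB_def vb_class_def by (auto elim: quotientE)

lemma VB_carrierI: "w \<in> bwords n \<Longrightarrow> vb_class n w \<in> carrier (VB n)"
  unfolding VB_def vb_class_def by (simp add: quotientI)

lemma VB_mult:
  assumes "u \<in> bwords n" "v \<in> bwords n"
  shows "vb_class n u \<otimes>\<^bsub>VB n\<^esub> vb_class n v = vb_class n (u @ v)"
proof -
  have "vb_class n (u' @ v') = vb_class n (u @ v)" if "u' \<in> vb_class n u" "v' \<in> vb_class n v" for u' v'
    using that vb_eq_append[of u u' n v v'] vb_class_eq_iff[of "u @ v" n "u' @ v'"] vb_eq_bwords
    unfolding vb_class_def Image_singleton_iff by (metis bwords_append)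
  then have "vb_class n u \<otimes>\<^bsub>VB n\<^esub> vb_class n v =
      (\<Union>u'\<in>vb_class n u. \<Union>v'\<in>vb_class n v. vb_class n (u @ v))"
    unfolding VB_def monoid.simps by (intro SUP_cong HOL.refl)
  moreover have "u \<in> vb_class n u" "v \<in> vb_class n v"
    using assms unfolding vb_class_def by (simp_all add: vb_eq.refl)
  ultimately show ?thesis by auto
qed

lemma monoid_VB: "monoid (VB n)"
proof (rule monoidI)
  have one: "\<one>\<^bsub>VB n\<^esub> = vb_class n []" by (simp add: VB_def)
  show "\<one>\<^bsub>VB n\<^esub> \<in> carrier (VB n)" unfolding one by (rule VB_carrierI) (simp add: bwords_def)
  have nil: "[] \<in> bwords n" by (simp add: bwords_def)
  fix x assume "x \<in> carrier (VB n)"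
  then obtain u where u: "u \<in> bwords n" "x = vb_class n u" by (rule VB_carrierE)
  show "\<one>\<^bsub>VB n\<^esub> \<otimes>\<^bsub>VB n\<^esub> x = x" "x \<otimes>\<^bsub>VB n\<^esub> \<one>\<^bsub>VB n\<^esub> = x"
    using u(1) nil by (simp_all add: one u(2) VB_mult)
  fix y assume "y \<in> carrier (VB n)"
  then obtain v where v: "v \<in> bwords n" "y = vb_class n v" by (rule VB_carrierE)
  show "x \<otimes>\<^bsub>VB n\<^esub> y \<in> carrier (VB n)" using u v by (simp add: VB_mult VB_carrierI bwords_append)
  fix z assume "z \<in> carrier (VB n)"
  then obtain w where "w \<in> bwords n" "z = vb_class n w" by (rule VB_carrierE)
  then show "x \<otimes>\<^bsub>VB n\<^esub> y \<otimes>\<^bsub>VB n\<^esub> z = x \<otimes>\<^bsub>VB n\<^esub> (y \<otimes>\<^bsub>VB n\<^esub> z)"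
    using u v by (simp add: VB_mult bwords_append)
qed

section \<open>Ring structure of the group algebra\<close>

lemma group_algebra_simps:
  "x \<in> carrier (group_algebra G) \<longleftrightarrow> Poly_Mapping.keys x \<subseteq> carrier G"
  "x \<otimes>\<^bsub>group_algebra G\<^esub> y = bilin_ext (mult G) x y"
  "\<one>\<^bsub>group_algebra G\<^esub> = Poly_Mapping.single \<one>\<^bsub>G\<^esub> 1"
  "\<zero>\<^bsub>group_algebra G\<^esub> = 0" "x \<oplus>\<^bsub>group_algebra G\<^esub> y = x + y"
  by (simp_all add: group_algebra_def)

lemma bilin_ext_assoc:
  assumes "\<And>a b c. a \<in> Poly_Mapping.keys x \<Longrightarrow> b \<in> Poly_Mapping.keys y \<Longrightarrow> c \<in> Poly_Mapping.keys z \<Longrightarrow>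
    m (m a b) c = m a (m b c)"
  shows "bilin_ext m (bilin_ext m x y) z = bilin_ext m x (bilin_ext m y z)"
proof (rule laurent_linear_eq[where x = x and F = "\<lambda>x. bilin_ext m (bilin_ext m x y) z"])
  fix a assume a: "a \<in> Poly_Mapping.keys x"
  show "bilin_ext m (bilin_ext m (Poly_Mapping.single a 1) y) z =
      bilin_ext m (Poly_Mapping.single a 1) (bilin_ext m y z)"
  proof (rule laurent_linear_eq[where x = y and F = "\<lambda>y. bilin_ext m (bilin_ext m (Poly_Mapping.single a 1) y) z"])
    fix b assume b: "b \<in> Poly_Mapping.keys y"
    show "bilin_ext m (bilin_ext m (Poly_Mapping.single a 1) (Poly_Mapping.single b 1)) z =
      bilin_ext m (Poly_Mapping.single a 1) (bilin_ext m (Poly_Mapping.single b 1) z)"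
      by (rule laurent_linear_eq[where x = z])
         (use assms[OF a b] in \<open>auto simp: laurent_linear_def bilin_ext_add_right bilin_ext_lscale_right\<close>)
  qed (auto simp: laurent_linear_def bilin_ext_add_left bilin_ext_lscale_left bilin_ext_add_right bilin_ext_lscale_right)
qed (auto simp: laurent_linear_def bilin_ext_add_left bilin_ext_lscale_left)

text \<open>Scalars act as multiples of the unit, so an ideal of the ring is closed under scaling.
  This makes \<open>VH_scale\<close> well defined on cosets.\<close>

lemma group_algebra_scalar_mult:
  assumes "monoid G" "x \<in> carrier (group_algebra G)"
  shows "bilin_ext (mult G) (Poly_Mapping.single \<one>\<^bsub>G\<^esub> c) x = lscale c x"
    and "bilin_ext (mult G) x (Poly_Mapping.single \<one>\<^bsub>G\<^esub> c) = lscale c x"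
proof -
  interpret monoid G by (rule assms(1))
  have lin: "laurent_linear (lscale c)" for c
    by (simp add: laurent_linear_def lscale_add_right mult.commute)
  show "bilin_ext (mult G) (Poly_Mapping.single \<one>\<^bsub>G\<^esub> c) x = lscale c x"
    by (rule laurent_linear_eq[OF laurent_linear_bilin_ext_right lin])
       (use assms(2) in \<open>auto simp: group_algebra_simps\<close>)
  show "bilin_ext (mult G) x (Poly_Mapping.single \<one>\<^bsub>G\<^esub> c) = lscale c x"
    by (rule laurent_linear_eq[OF laurent_linear_bilin_ext_left lin])
       (use assms(2) in \<open>auto simp: group_algebra_simps\<close>)
qed

lemma ring_group_algebra:
  assumes "monoid G" shows "ring (group_algebra G)"
proof (rule ringI)
  interpret monoid G by (rule assms)
  let ?R = "group_algebra G"
  show "abelian_group ?R"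
  proof (rule abelian_groupI)
    fix x assume "x \<in> carrier ?R"
    then show "\<exists>y\<in>carrier ?R. y \<oplus>\<^bsub>?R\<^esub> x = \<zero>\<^bsub>?R\<^esub>"
      by (intro bexI[of _ "- x"]) (simp_all add: group_algebra_simps)
  qed (auto simp: group_algebra_simps ac_simps dest!: subsetD[OF keys_add])
  show "monoid ?R"
    by (rule monoidI)
       (use group_algebra_scalar_mult[OF assms, of _ 1] in \<open>auto simp: group_algebra_simps m_assoc subset_iff
         intro!: bilin_ext_assoc dest!: subsetD[OF keys_bilin_ext]\<close>)
qed (auto simp: group_algebra_simps bilin_ext_add_left bilin_ext_add_right)

lemma ring_ZVB: "ring (ZVB n)"
  by (rule ring_group_algebra[OF monoid_VB])

lemma lscale_ZVB_closed: "x \<in> carrier (ZVB n) \<Longrightarrow> lscale c x \<in> carrier (ZVB n)"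
  using keys_lscale[of c x] by (auto simp: group_algebra_simps)

lemma diff_ZVB_closed:
  "x \<in> carrier (ZVB n) \<Longrightarrow> y \<in> carrier (ZVB n) \<Longrightarrow> x - y \<in> carrier (ZVB n)"
  using keys_add[of x "- y"] by (auto simp: group_algebra_simps)

lemma braid_elt_closed: "w \<in> bwords n \<Longrightarrow> braid_elt n w \<in> carrier (ZVB n)"
  by (simp add: braid_elt_def group_algebra_simps VB_carrierI)

lemma braid_elt_mult:
  "u \<in> bwords n \<Longrightarrow> v \<in> bwords n \<Longrightarrow> braid_elt n u \<otimes>\<^bsub>ZVB n\<^esub> braid_elt n v = braid_elt n (u @ v)"
  by (simp add: braid_elt_def group_algebra_simps VB_mult)

lemma braid_elt_Nil: "braid_elt n [] = \<one>\<^bsub>ZVB n\<^esub>"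
  by (simp add: braid_elt_def group_algebra_simps VB_def)

lemma P_elt_closed: "i \<in> {1..<n} \<Longrightarrow> P_elt n i \<in> carrier (ZVB n)"
  unfolding P_elt_def by (intro diff_ZVB_closed lscale_ZVB_closed braid_elt_closed) (auto simp: bwords_def)

section \<open>The Hecke ideal and its cosets\<close>

lemma hecke_relators_closed: "hecke_relators n \<subseteq> carrier (ZVB n)"
proof -
  interpret ring "ZVB n" by (rule ring_ZVB)
  show ?thesis unfolding hecke_relators_def
    by (auto simp: bwords_def intro!: diff_ZVB_closed lscale_ZVB_closed m_closed P_elt_closed braid_elt_closed)
qed

lemma ideal_hecke: "ideal (hecke_ideal n) (ZVB n)"
  unfolding hecke_ideal_def by (rule ring.genideal_ideal[OF ring_ZVB hecke_relators_closed])

lemma ring_VH: "ring (VH n)"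
  unfolding VH_def by (rule ideal.quotient_is_ring[OF ideal_hecke])

lemma VH_proj_hom: "VH_proj n \<in> ring_hom (ZVB n) (VH n)"
  unfolding VH_def VH_proj_def using ideal.rcos_ring_hom[OF ideal_hecke] .

lemma VH_carrierE:
  assumes "X \<in> carrier (VH n)"
  obtains x where "x \<in> carrier (ZVB n)" "X = VH_proj n x"
  using assms unfolding VH_def VH_proj_def FactRing_def A_RCOSETS_def' by auto

lemma VH_proj_closed: "x \<in> carrier (ZVB n) \<Longrightarrow> VH_proj n x \<in> carrier (VH n)"
  by (rule ring_hom_closed[OF VH_proj_hom])

lemma VH_proj_mem: "y \<in> VH_proj n x \<longleftrightarrow> (\<exists>i\<in>hecke_ideal n. y = i + x)"
  unfolding VH_proj_def a_r_coset_def' by (simp add: group_algebra_simps)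

lemma VH_proj_scale:
  assumes x: "x \<in> carrier (ZVB n)" shows "VH_scale n c (VH_proj n x) = VH_proj n (lscale c x)"
proof -
  interpret ideal "hecke_ideal n" "ZVB n" by (rule ideal_hecke)
  have "VH_proj n (lscale c y) = VH_proj n (lscale c x)" if "y \<in> VH_proj n x" for y
  proof -
    from that obtain i where i: "i \<in> hecke_ideal n" "y = i + x" unfolding VH_proj_mem by blast
    have cl: "i \<in> carrier (ZVB n)" using i(1) by (rule a_Hcarr)
    have "Poly_Mapping.single \<one>\<^bsub>VB n\<^esub> c \<in> carrier (ZVB n)"
      using monoid.one_closed[OF monoid_VB] by (simp add: group_algebra_simps)
    from I_l_closed[OF i(1) this] have i': "lscale c i \<in> hecke_ideal n"
      using group_algebra_scalar_mult(1)[OF monoid_VB cl] by (simp add: group_algebra_simps)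
    have "VH_proj n (lscale c i) = \<zero>\<^bsub>VH n\<^esub>"
      using a_rcos_zero[OF ideal_hecke i'] by (simp add: VH_proj_def VH_def FactRing_def)
    moreover have "VH_proj n (lscale c i + lscale c x) = VH_proj n (lscale c i) \<oplus>\<^bsub>VH n\<^esub> VH_proj n (lscale c x)"
      using ring_hom_add[OF VH_proj_hom a_Hcarr[OF i'] lscale_ZVB_closed[OF x]] by (simp add: group_algebra_simps)
    ultimately show ?thesis
      using VH_proj_closed[OF lscale_ZVB_closed[OF x]] ring.ring_simprules(8)[OF ring_VH]
      by (simp add: i(2) lscale_add_right)
  qed
  then have "VH_scale n c (VH_proj n x) = (\<Union>y\<in>VH_proj n x. VH_proj n (lscale c x))"
    unfolding VH_scale_def by (intro SUP_cong HOL.refl)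
  moreover have "x \<in> VH_proj n x" 
    unfolding VH_proj_mem using additive_subgroup.zero_closed[OF is_additive_subgroup] by (auto simp: group_algebra_simps)
  ultimately show ?thesis by auto
qed

section \<open>The representation\<close>

text \<open>One word is chosen from each braid class. Another choice would change this combination,
  but not its class in \<open>GraphEnd n\<close>.\<close>

definition braid_comb :: "nat \<Rightarrow> bword set \<Rightarrow> node dgraph \<Rightarrow>\<^sub>0 laurent" where
  "braid_comb n b = word_comb n (SOME w. w \<in> b)"

definition ZVB_rep :: "nat \<Rightarrow> (bword set \<Rightarrow>\<^sub>0 laurent) \<Rightarrow> (node dgraph \<Rightarrow>\<^sub>0 laurent) set" where
  "ZVB_rep n x = graph_class n n (lin_ext (braid_comb n) x)"

text \<open>An element of \<open>VH n\<close> is a coset, on which \<open>ZVB_rep n\<close> is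
  constant by \<open>ZVB_rep_hecke_ideal\<close>.\<close>

definition VH_rep :: "nat \<Rightarrow> (bword set \<Rightarrow>\<^sub>0 laurent) set \<Rightarrow> (node dgraph \<Rightarrow>\<^sub>0 laurent) set" where
  "VH_rep n X = the_elem (ZVB_rep n ` X)"

lemma VB_member_bwords: "b \<in> carrier (VB n) \<Longrightarrow> w \<in> b \<Longrightarrow> w \<in> bwords n \<and> b = vb_class n w"
  by (metis VB_carrierE vb_class_def vb_class_eq_iff Image_singleton_iff vb_eq_bwords)

lemma braid_comb:
  assumes "b \<in> carrier (VB n)"
  shows "braid_comb n b \<in> graph_combs n n" and "w \<in> b \<Longrightarrow> graph_class n n (braid_comb n b) = word_elt n w"
proof -
  obtain u where u: "u \<in> bwords n" "b = vb_class n u" using assms by (rule VB_carrierE)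
  then have "u \<in> b" by (simp add: vb_class_def vb_eq.refl)
  then have s: "(SOME w. w \<in> b) \<in> b" by (rule someI)
  then show "braid_comb n b \<in> graph_combs n n"
    unfolding braid_comb_def using VB_member_bwords[OF assms] word_comb_closed by blast
  show "graph_class n n (braid_comb n b) = word_elt n w" if "w \<in> b"
    unfolding braid_comb_def
    by (rule word_elt_vb_eq) (use VB_member_bwords[OF assms s] VB_member_bwords[OF assms that] vb_class_eq_iff in blast)
qed

lemma ZVB_rep_combs: "x \<in> carrier (ZVB n) \<Longrightarrow> lin_ext (braid_comb n) x \<in> graph_combs n n"
  by (rule graph_combs_lin_ext) (use braid_comb(1) in \<open>auto simp: group_algebra_simps\<close>)

lemma ZVB_rep_single:
  assumes "b \<in> carrier (VB n)" "w \<in> b" shows "ZVB_rep n (Poly_Mapping.single b 1) = word_elt n w"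
  unfolding ZVB_rep_def using braid_comb(2)[OF assms] by simp

lemma ZVB_rep_braid_elt: "w \<in> bwords n \<Longrightarrow> ZVB_rep n (braid_elt n w) = word_elt n w"
  unfolding braid_elt_def by (rule ZVB_rep_single[OF VB_carrierI]) (simp_all add: vb_class_def vb_eq.refl)

lemma ZVB_rep_add: "ZVB_rep n (x + y) = ZVB_rep n x \<oplus>\<^bsub>GraphEnd n\<^esub> ZVB_rep n y"
  unfolding ZVB_rep_def by (simp add: lin_ext_add GraphEnd_simps(4))

lemma ZVB_rep_lscale: "ZVB_rep n (lscale c x) = gscale n c (ZVB_rep n x)"
  unfolding ZVB_rep_def by (simp add: lin_ext_lscale GraphCat_scale_class)

lemma ZVB_rep_mult:
  assumes x: "x \<in> carrier (ZVB n)" and y: "y \<in> carrier (ZVB n)"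
  shows "ZVB_rep n (x \<otimes>\<^bsub>ZVB n\<^esub> y) = ZVB_rep n x \<otimes>\<^bsub>GraphEnd n\<^esub> ZVB_rep n y"
proof -
  let ?W = "lin_ext (braid_comb n)"
  have "graph_class n n (?W (bilin_ext (mult (VB n)) x y)) = graph_class n n (bilin_ext graph_comp (?W x) (?W y))"
  proof (rule graph_class_linear_eq[where x = x and F = "\<lambda>x. ?W (bilin_ext (mult (VB n)) x y)"])
    fix a assume "a \<in> Poly_Mapping.keys x"
    then have a: "a \<in> carrier (VB n)" using x by (auto simp: group_algebra_simps)
    then obtain u where u: "u \<in> bwords n" "a = vb_class n u" by (rule VB_carrierE)
    show "graph_class n n (?W (bilin_ext (mult (VB n)) (Poly_Mapping.single a 1) y)) =
        graph_class n n (bilin_ext graph_comp (?W (Poly_Mapping.single a 1)) (?W y))"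
    proof (rule graph_class_linear_eq[where x = y and F = "\<lambda>y. ?W (bilin_ext (mult (VB n)) (Poly_Mapping.single a 1) y)"])
      fix b assume "b \<in> Poly_Mapping.keys y"
      then have b: "b \<in> carrier (VB n)" using y by (auto simp: group_algebra_simps)
      then obtain v where v: "v \<in> bwords n" "b = vb_class n v" by (rule VB_carrierE)
      have "graph_class n n (braid_comb n (a \<otimes>\<^bsub>VB n\<^esub> b)) = word_elt n (u @ v)"
        unfolding u(2) v(2) VB_mult[OF u(1) v(1)]
        by (rule braid_comb(2)[OF VB_carrierI]) (use u v in \<open>simp_all add: bwords_append vb_class_def vb_eq.refl\<close>)
      also have "\<dots> = graph_class n n (braid_comb n a) \<otimes>\<^bsub>GraphEnd n\<^esub> graph_class n n (braid_comb n b)"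
        using word_elt_append[of u v n] braid_comb(2)[OF a, of u] braid_comb(2)[OF b, of v] u v
        by (simp add: bwords_append vb_class_def vb_eq.refl)
      finally show "graph_class n n (?W (bilin_ext (mult (VB n)) (Poly_Mapping.single a 1) (Poly_Mapping.single b 1))) =
        graph_class n n (bilin_ext graph_comp (?W (Poly_Mapping.single a 1)) (?W (Poly_Mapping.single b 1)))"
        using braid_comb(1)[OF a] braid_comb(1)[OF b] by (simp add: GraphEnd_simps(5))
    qed (auto simp: laurent_linear_def bilin_ext_add_right bilin_ext_lscale_right lin_ext_add lin_ext_lscale)
  qed (auto simp: laurent_linear_def bilin_ext_add_left bilin_ext_lscale_left lin_ext_add lin_ext_lscale)
  then show ?thesis
    unfolding ZVB_rep_def group_algebra_simps(2) GraphEnd_simps(5)[OF ZVB_rep_combs[OF x] ZVB_rep_combs[OF y]] .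
qed

lemma ZVB_rep_hom: "ring_hom_ring (ZVB n) (GraphEnd n) (ZVB_rep n)"
proof (rule ring_hom_ringI[OF ring_ZVB ring_GraphEnd])
  fix x y assume x: "x \<in> carrier (ZVB n)" and y: "y \<in> carrier (ZVB n)"
  show "ZVB_rep n x \<in> carrier (GraphEnd n)"
    unfolding ZVB_rep_def by (rule graph_class_carrier[OF ZVB_rep_combs[OF x]])
  show "ZVB_rep n (x \<otimes>\<^bsub>ZVB n\<^esub> y) = ZVB_rep n x \<otimes>\<^bsub>GraphEnd n\<^esub> ZVB_rep n y" by (rule ZVB_rep_mult[OF x y])
  show "ZVB_rep n (x \<oplus>\<^bsub>ZVB n\<^esub> y) = ZVB_rep n x \<oplus>\<^bsub>GraphEnd n\<^esub> ZVB_rep n y"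
    by (simp add: group_algebra_simps ZVB_rep_add)
qed (simp add: braid_elt_Nil[symmetric] ZVB_rep_braid_elt bwords_def word_elt_Nil del: word_comb.simps)


lemma word_elt_single: "snd l \<in> {1..<n} \<Longrightarrow> word_elt n [l] = letter_elt n l"
  using word_elt_Cons[of l "[]" n] monoid.r_one[OF ring.is_monoid[OF ring_GraphEnd] letter_elt_closed[of l n]]
  unfolding word_elt_Nil by (simp add: bwords_def)

text \<open>With P for the double-Y, A^3 - A (A^2 - A^-1 P) = P.\<close>

lemma ZVB_rep_P_elt:
  assumes i: "i \<in> {1..<n}" shows "ZVB_rep n (P_elt n i) = graph_elt n (double_Y n i)"
proof -
  have w: "[] \<in> bwords n" "[(Pos, i)] \<in> bwords n" using i by (auto simp: bwords_def)
  have "P_elt n i = lscale (Apow 3) (braid_elt n []) + lscale (- Apow 1) (braid_elt n [(Pos, i)])"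
    unfolding P_elt_def by (simp add: lscale_minus_left)
  then have "ZVB_rep n (P_elt n i) = graph_class n n (lscale (Apow 3) (word_comb n []) + lscale (- Apow 1) (letter_comb n (Pos, i)))"
    using word_elt_single[of "(Pos, i)" n] i w
    by (simp only: ZVB_rep_add ZVB_rep_lscale ZVB_rep_braid_elt snd_conv GraphCat_scale_class GraphEnd_simps(4))
  also have "lscale (Apow 3) (word_comb n []) + lscale (- Apow 1) (letter_comb n (Pos, i)) = Poly_Mapping.single (double_Y n i) 1"
    by (simp add: letter_comb_def crossing_sign_def lscale_diff_right lscale_minus_left Apow_mult Apow_0 single_uminus)
  finally show ?thesis by (simp add: graph_elt_def)
qed

lemma ZVB_rep_Virt: "i \<in> {1..<n} \<Longrightarrow> ZVB_rep n (braid_elt n [(Virt, i)]) = graph_elt n (virtual_crossing n i)"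
  using word_elt_single[of "(Virt, i)" n]
  by (simp add: ZVB_rep_braid_elt bwords_def letter_elt_Virt del: word_comb.simps)

lemma ZVB_rep_diff_eq_0: "ZVB_rep n x = ZVB_rep n y \<Longrightarrow> ZVB_rep n (x - y) = \<zero>\<^bsub>GraphEnd n\<^esub>"
  unfolding ZVB_rep_def GraphEnd_simps(2) graph_class_eq_iff by (simp add: lin_ext_diff)

text \<open>The kernel of a ring homomorphism is an ideal, so it suffices that it contains the
  relators, which hold between double-Y graphs and virtual crossings.\<close>

lemma ZVB_rep_hecke_ideal:
  assumes "x \<in> hecke_ideal n" shows "ZVB_rep n x = \<zero>\<^bsub>GraphEnd n\<^esub>"
proof -
  interpret R: ring "ZVB n" by (rule ring_ZVB)
  have v: "[(Virt, i)] \<in> bwords n" if "i \<in> {1..<n}" for i using that by (auto simp: bwords_def)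
  have "ZVB_rep n r = \<zero>\<^bsub>GraphEnd n\<^esub>" if rel: "r \<in> hecke_relators n" for r
  proof -
    obtain i where i: "i \<in> {1..<n}"
      and "r = P_elt n i \<otimes>\<^bsub>ZVB n\<^esub> P_elt n i - lscale (Apow 3 + Apow (-3)) (P_elt n i) \<or>
        r = braid_elt n [(Virt, i)] \<otimes>\<^bsub>ZVB n\<^esub> P_elt n i - P_elt n i \<or>
        r = P_elt n i \<otimes>\<^bsub>ZVB n\<^esub> braid_elt n [(Virt, i)] - P_elt n i"
      using rel unfolding hecke_relators_def by blast
    then show ?thesis
      by (elim disjE; hypsubst; intro ZVB_rep_diff_eq_0; simp only: ZVB_rep_mult ZVB_rep_lscale P_elt_closed
          braid_elt_closed v ZVB_rep_P_elt ZVB_rep_Virt P_gen_square V_P_gen P_V_gen)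
  qed
  then have "hecke_relators n \<subseteq> a_kernel (ZVB n) (GraphEnd n) (ZVB_rep n)"
    using hecke_relators_closed unfolding a_kernel_def' by blast
  from R.genideal_minimal[OF ring_hom_ring.kernel_is_ideal[OF ZVB_rep_hom] this] assms
  show ?thesis unfolding hecke_ideal_def a_kernel_def' by blast
qed

lemma VH_rep_proj:
  assumes "x \<in> carrier (ZVB n)" shows "VH_rep n (VH_proj n x) = ZVB_rep n x"
proof -
  interpret R: ring "GraphEnd n" by (rule ring_GraphEnd)
  have cl: "ZVB_rep n x \<in> carrier (GraphEnd n)"
    unfolding ZVB_rep_def by (rule graph_class_carrier[OF ZVB_rep_combs[OF assms]])
  have "ZVB_rep n y = ZVB_rep n x" if y: "y \<in> VH_proj n x" for y
  proof -
    obtain i where "i \<in> hecke_ideal n" "y = i + x" using y unfolding VH_proj_mem by blast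
    then show ?thesis using cl by (simp add: ZVB_rep_add ZVB_rep_hecke_ideal)
  qed
  moreover have "x \<in> VH_proj n x"
    unfolding VH_proj_mem using additive_subgroup.zero_closed[OF ideal.axioms(1)[OF ideal_hecke]]
    by (auto simp: group_algebra_simps)
  ultimately have "ZVB_rep n ` VH_proj n x = {ZVB_rep n x}" by blast
  then show ?thesis unfolding VH_rep_def by simp
qed

lemma graph_representation_VH_rep: "graph_representation n (VH_rep n)"
  unfolding graph_representation_def
proof (intro conjI allI ballI)
  note cl = ring_hom_ring.homh[OF ZVB_rep_hom, of n]
  show "ring_hom_ring (VH n) (GraphEnd n) (VH_rep n)"
  proof (rule ring_hom_ringI[OF ring_VH ring_GraphEnd])
    fix X assume "X \<in> carrier (VH n)"
    then obtain x where x: "x \<in> carrier (ZVB n)" "X = VH_proj n x" by (rule VH_carrierE)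
    show "VH_rep n X \<in> carrier (GraphEnd n)"
      unfolding x(2) VH_rep_proj[OF x(1)] by (rule ring_hom_closed[OF cl x(1)])
    fix Y assume "Y \<in> carrier (VH n)"
    then obtain y where y: "y \<in> carrier (ZVB n)" "Y = VH_proj n y" by (rule VH_carrierE)
    interpret R: ring "ZVB n" by (rule ring_ZVB)
    show "VH_rep n (X \<otimes>\<^bsub>VH n\<^esub> Y) = VH_rep n X \<otimes>\<^bsub>GraphEnd n\<^esub> VH_rep n Y"
      unfolding x(2) y(2) ring_hom_mult[OF VH_proj_hom x(1) y(1), symmetric]
        VH_rep_proj[OF x(1)] VH_rep_proj[OF y(1)] VH_rep_proj[OF R.m_closed[OF x(1) y(1)]]
      by (rule ring_hom_mult[OF cl x(1) y(1)])
    show "VH_rep n (X \<oplus>\<^bsub>VH n\<^esub> Y) = VH_rep n X \<oplus>\<^bsub>GraphEnd n\<^esub> VH_rep n Y"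
      unfolding x(2) y(2) ring_hom_add[OF VH_proj_hom x(1) y(1), symmetric]
        VH_rep_proj[OF x(1)] VH_rep_proj[OF y(1)] VH_rep_proj[OF R.a_closed[OF x(1) y(1)]]
      by (rule ring_hom_add[OF cl x(1) y(1)])
  next
    interpret R: ring "ZVB n" by (rule ring_ZVB)
    show "VH_rep n \<one>\<^bsub>VH n\<^esub> = \<one>\<^bsub>GraphEnd n\<^esub>"
      unfolding ring_hom_one[OF VH_proj_hom, symmetric] VH_rep_proj[OF R.one_closed] by (rule ring_hom_one[OF cl])
  qed
  fix c X assume "X \<in> carrier (VH n)"
  then obtain x where x: "x \<in> carrier (ZVB n)" "X = VH_proj n x" by (rule VH_carrierE)
  show "VH_rep n (VH_scale n c X) = gscale n c (VH_rep n X)"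
    unfolding x(2) VH_proj_scale[OF x(1)] VH_rep_proj[OF x(1)] VH_rep_proj[OF lscale_ZVB_closed[OF x(1)]]
    by (rule ZVB_rep_lscale)
next
  fix i assume i: "i \<in> {1..<n}"
  then have "[(Virt, i)] \<in> bwords n" by (auto simp: bwords_def)
  then show "VH_rep n (VH_proj n (P_elt n i)) = graph_class n n (Poly_Mapping.single (double_Y n i) 1)"
    "VH_rep n (VH_proj n (braid_elt n [(Virt, i)])) = graph_class n n (Poly_Mapping.single (virtual_crossing n i) 1)"
    using i by (simp_all add: VH_rep_proj P_elt_closed braid_elt_closed ZVB_rep_P_elt ZVB_rep_Virt graph_elt_def)
qed

section \<open>Uniqueness of the representation\<close>

lemma braid_elt_Pos:
  "braid_elt n [(Pos, i)] = lscale (Apow 2) (braid_elt n []) + lscale (- Apow (-1)) (P_elt n i)"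
  unfolding P_elt_def by (simp add: lscale_diff_right lscale_minus_left Apow_mult Apow_0)

lemma braid_elt_inverse:
  assumes "i \<in> {1..<n}"
  shows "braid_elt n [(Pos, i)] \<otimes>\<^bsub>ZVB n\<^esub> braid_elt n [(Neg, i)] = \<one>\<^bsub>ZVB n\<^esub>"
    "braid_elt n [(Neg, i)] \<otimes>\<^bsub>ZVB n\<^esub> braid_elt n [(Pos, i)] = \<one>\<^bsub>ZVB n\<^esub>"
proof -
  have w: "[] \<in> bwords n" "[(Pos, i)] \<in> bwords n" "[(Neg, i)] \<in> bwords n"
    "[(Pos, i), (Neg, i)] \<in> bwords n" "[(Neg, i), (Pos, i)] \<in> bwords n"
    using assms by (auto simp: bwords_def)
  have "vb_class n [(Pos, i), (Neg, i)] = vb_class n []" "vb_class n [(Neg, i), (Pos, i)] = vb_class n []"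
    unfolding vb_class_eq_iff[OF w(4,1)] vb_class_eq_iff[OF w(5,1)]
    using vb_eq.step[OF vb_relator.intros(1)[of i], of "[]" "[]" n] vb_eq.step[OF vb_relator.intros(2)[of i], of "[]" "[]" n] w
    by simp_all
  then show "braid_elt n [(Pos, i)] \<otimes>\<^bsub>ZVB n\<^esub> braid_elt n [(Neg, i)] = \<one>\<^bsub>ZVB n\<^esub>"
    "braid_elt n [(Neg, i)] \<otimes>\<^bsub>ZVB n\<^esub> braid_elt n [(Pos, i)] = \<one>\<^bsub>ZVB n\<^esub>"
    unfolding braid_elt_mult[OF w(2,3)] braid_elt_mult[OF w(3,2)] braid_elt_Nil[symmetric] by (simp_all add: braid_elt_def)
qed

text \<open>Both maps send \<open>\<sigma>\<^sub>i\<close> to the same element, hence also its inverse.\<close>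

lemma graph_representation_unique:
  assumes k: "graph_representation n k" "graph_representation n k'" and X: "X \<in> carrier (VH n)"
  shows "k' X = k X"
proof -
  interpret Z: ring "ZVB n" by (rule ring_ZVB)
  interpret G: ring "GraphEnd n" by (rule ring_GraphEnd)
  \<comment> \<open>\<open>S\<close> is closed under sums, scalars and products, so it is the whole
    group algebra as soon as it contains the letters.\<close>
  define S where "S = {x \<in> carrier (ZVB n). k' (VH_proj n x) = k (VH_proj n x)}"
  have hom: "(\<lambda>x. f (VH_proj n x)) \<in> ring_hom (ZVB n) (GraphEnd n)"
    and scale: "x \<in> carrier (ZVB n) \<Longrightarrow> f (VH_proj n (lscale c x)) = gscale n c (f (VH_proj n x))"
    if "graph_representation n f" for f c x
  proof -
    have "f \<in> ring_hom (VH n) (GraphEnd n)"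
      using that unfolding graph_representation_def by (blast intro: ring_hom_ring.homh)
    from ring_hom_trans[OF VH_proj_hom this] show "(\<lambda>x. f (VH_proj n x)) \<in> ring_hom (ZVB n) (GraphEnd n)"
      by (simp add: comp_def)
    show "x \<in> carrier (ZVB n) \<Longrightarrow> f (VH_proj n (lscale c x)) = gscale n c (f (VH_proj n x))"
      using that unfolding graph_representation_def by (metis VH_proj_scale VH_proj_closed)
  qed
  note h = hom[OF k(1)] and h' = hom[OF k(2)]
  have add: "x + y \<in> S" if "x \<in> S" "y \<in> S" for x y
    using that ring_hom_add[OF h, of x y] ring_hom_add[OF h', of x y] Z.a_closed[of x y]
    by (simp add: S_def group_algebra_simps(5))
  have sc: "lscale c x \<in> S" if "x \<in> S" for c x
    using that scale[OF k(1)] scale[OF k(2)] by (simp add: S_def lscale_ZVB_closed)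
  have mult: "x \<otimes>\<^bsub>ZVB n\<^esub> y \<in> S" if "x \<in> S" "y \<in> S" for x y
    using that ring_hom_mult[OF h, of x y] ring_hom_mult[OF h', of x y] by (simp add: S_def)
  have one: "\<one>\<^bsub>ZVB n\<^esub> \<in> S" using ring_hom_one[OF h] ring_hom_one[OF h'] by (simp add: S_def)
  have letter: "braid_elt n [l] \<in> S" if l: "snd l \<in> {1..<n}" for l
  proof -
    obtain \<kappa> i where li: "l = (\<kappa>, i)" by (cases l)
    have i: "i \<in> {1..<n}" using l li by simp
    then have w: "[(\<kappa>, i)] \<in> bwords n" for \<kappa> by (auto simp: bwords_def)
    have P: "P_elt n i \<in> S" and V: "braid_elt n [(Virt, i)] \<in> S"
      using k i P_elt_closed[OF i] braid_elt_closed[OF w] unfolding graph_representation_def S_def by simp_all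
    have pos: "braid_elt n [(Pos, i)] \<in> S"
      unfolding braid_elt_Pos braid_elt_Nil by (intro add sc one P)
    have neg: "braid_elt n [(Neg, i)] \<in> S"
    proof -
      let ?x = "braid_elt n [(Pos, i)]" and ?y = "braid_elt n [(Neg, i)]"
      note c = braid_elt_closed[OF w[of Pos]] braid_elt_closed[OF w[of Neg]]
      have "k' (VH_proj n ?y) = k (VH_proj n ?y)"
      proof (rule G.inv_unique)
        show "k' (VH_proj n ?y) \<otimes>\<^bsub>GraphEnd n\<^esub> k (VH_proj n ?x) = \<one>\<^bsub>GraphEnd n\<^esub>"
          using ring_hom_mult[OF h' c(2,1)] ring_hom_one[OF h'] braid_elt_inverse(2)[OF i] pos by (simp add: S_def)
        show "k (VH_proj n ?x) \<otimes>\<^bsub>GraphEnd n\<^esub> k (VH_proj n ?y) = \<one>\<^bsub>GraphEnd n\<^esub>"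
          using ring_hom_mult[OF h c] ring_hom_one[OF h] braid_elt_inverse(1)[OF i] by simp
      qed (use ring_hom_closed[OF h] ring_hom_closed[OF h'] c in auto)
      then show ?thesis using c by (simp add: S_def)
    qed
    show ?thesis unfolding li by (cases \<kappa>) (simp_all add: pos neg V)
  qed
  have word: "braid_elt n w \<in> S" if "w \<in> bwords n" for w
    using that
  proof (induction w)
    case (Cons l w)
    then have "[l] \<in> bwords n" "w \<in> bwords n" "snd l \<in> {1..<n}" by (auto simp: bwords_def)
    with mult[OF letter[of l] Cons.IH] braid_elt_mult[of "[l]" n w] show ?case by simp
  qed (simp add: braid_elt_Nil one)
  obtain x where x: "x \<in> carrier (ZVB n)" "X = VH_proj n x" using X by (rule VH_carrierE)
  have "x \<in> S"
  proof (rule laurent_linear_in_submodule[OF laurent_linear_id _ add sc])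
    show "0 \<in> S" using sc[OF one, of 0] by simp
    fix b assume "b \<in> Poly_Mapping.keys x"
    then have "b \<in> carrier (VB n)" using x(1) by (auto simp: group_algebra_simps)
    then show "Poly_Mapping.single b 1 \<in> S" using word by (auto simp: braid_elt_def elim!: VB_carrierE)
  qed
  then show ?thesis using x(2) by (simp add: S_def)
qed

section \<open>Properties of the trace\<close>

text \<open>In the closure of a composite the inner joints \<open>Inner (3 * j + 2)\<close> and the
  outer joints \<open>Low j\<close> have equal status. Exchanging them, together with the residues 0
  and 1 of the two factors, is an involution that carries one closure to the other.\<close>

lemma closure_eval_comp_commute: "closure_eval (graph_comp F G) = closure_eval (graph_comp G F)"
proof -
  define \<phi> where "\<phi> v = (case v of Low j \<Rightarrow> Inner (3 * j + 2)
    | Inner m \<Rightarrow> if m mod 3 = 0 then Inner (m + 1) else if m mod 3 = 1 then Inner (m - 1) else Low (m div 3) | Up j \<Rightarrow> Up j)" for v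
  have \<phi>: "\<phi> (Low j) = Inner (3 * j + 2)" "\<phi> (Inner (3 * k)) = Inner (3 * k + 1)"
    "\<phi> (Inner (3 * k + 1)) = Inner (3 * k)" "\<phi> (Inner (3 * k + 2)) = Low k" for j k
    by (simp_all add: \<phi>_def mod_3_simps One_nat_def)
  have "\<phi> (\<phi> v) = v" for v
  proof (cases v)
    case (Inner m)
    show ?thesis by (cases m rule: nat_mod_3_cases) (simp_all only: Inner \<phi>)
  qed (simp_all only: \<phi>, simp add: \<phi>_def)
  then have inj: "inj_on \<phi> A" for A by (rule inj_on_inverseI)
  have "\<phi> (identify_ends (in_upper v)) = identify_ends (in_lower v)"
    "\<phi> (identify_ends (in_lower v)) = identify_ends (in_upper v)" for v
    by (cases v; simp only: in_upper.simps in_lower.simps identify_ends.simps \<phi>)+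
  then have "graph_closure (graph_comp G F) = rename \<phi> (graph_closure (graph_comp F G))"
    unfolding graph_closure_def graph_comp_def by (simp add: rename_rename add.commute)
  then show ?thesis using web_eval_rename[OF inj] by simp
qed

lemma Trace_add:
  "X \<in> carrier (GraphEnd n) \<Longrightarrow> Y \<in> carrier (GraphEnd n) \<Longrightarrow> Trace (X \<oplus>\<^bsub>GraphEnd n\<^esub> Y) = Trace X + Trace Y"
  by (elim GraphEnd_carrierE) (simp add: GraphEnd_simps(4) Trace_graph_class lin_ext_add)

lemma Trace_gscale: "X \<in> carrier (GraphEnd n) \<Longrightarrow> Trace (gscale n c X) = lscale c (Trace X)"
  by (elim GraphEnd_carrierE) (simp add: GraphCat_scale_class Trace_graph_class lin_ext_lscale)

lemma Trace_mult_commute: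
  assumes "X \<in> carrier (GraphEnd n)" "Y \<in> carrier (GraphEnd n)"
  shows "Trace (X \<otimes>\<^bsub>GraphEnd n\<^esub> Y) = Trace (Y \<otimes>\<^bsub>GraphEnd n\<^esub> X)"
proof -
  obtain x where x: "x \<in> graph_combs n n" "X = graph_class n n x" using assms(1) by (rule GraphEnd_carrierE)
  obtain y where y: "y \<in> graph_combs n n" "Y = graph_class n n y" using assms(2) by (rule GraphEnd_carrierE)
  have "lin_ext closure_eval (bilin_ext graph_comp x y) = lin_ext closure_eval (bilin_ext graph_comp y x)"
  proof (rule laurent_linear_eq[where x = x and F = "\<lambda>x. lin_ext closure_eval (bilin_ext graph_comp x y)"])
    fix a
    show "lin_ext closure_eval (bilin_ext graph_comp (Poly_Mapping.single a 1) y) =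
        lin_ext closure_eval (bilin_ext graph_comp y (Poly_Mapping.single a 1))"
      by (rule laurent_linear_eq[where x = y])
         (auto simp: laurent_linear_def bilin_ext_add_left bilin_ext_lscale_left bilin_ext_add_right
           bilin_ext_lscale_right lin_ext_add lin_ext_lscale closure_eval_comp_commute)
  qed (auto simp: laurent_linear_def bilin_ext_add_left bilin_ext_lscale_left bilin_ext_add_right
      bilin_ext_lscale_right lin_ext_add lin_ext_lscale)
  then show ?thesis unfolding x(2) y(2) GraphEnd_simps(5)[OF x(1) y(1)] GraphEnd_simps(5)[OF y(1) x(1)]
    by (simp add: Trace_graph_class)
qed


section \<open>The bracket of a closed braid as a trace\<close>

text \<open>The \<open>k\<close>-th letter of a braid word sits at position \<open>k\<close>; suffixes of the word therefore start at
  a position \<open>k\<close>, which the following functions carry along.\<close>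

definition letter_graph :: "nat \<Rightarrow> kind \<times> nat \<Rightarrow> bool \<Rightarrow> node dgraph" where
  "letter_graph n l u = (if fst l = Virt then virtual_crossing n (snd l)
     else if u then double_Y n (snd l) else vertical {1..n})"

definition letter_weight :: "kind \<times> nat \<Rightarrow> bool \<Rightarrow> laurent" where
  "letter_weight l u = (if fst l = Virt then 1 else if u then - Apow (- crossing_sign (fst l))
     else Apow (2 * crossing_sign (fst l)))"

fun word_graph :: "nat \<Rightarrow> bword \<Rightarrow> nat \<Rightarrow> nat set \<Rightarrow> node dgraph" where
  "word_graph n [] k U = vertical {1..n}"
| "word_graph n (l # w) k U = graph_comp (letter_graph n l (k \<in> U)) (word_graph n w (Suc k) U)"

fun word_weight :: "bword \<Rightarrow> nat \<Rightarrow> nat set \<Rightarrow> laurent" where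
  "word_weight [] k U = 1"
| "word_weight (l # w) k U = letter_weight l (k \<in> U) * word_weight w (Suc k) U"

definition classical_from :: "bword \<Rightarrow> nat \<Rightarrow> nat set" where
  "classical_from w k = (\<lambda>j. k + j) ` {j. j < length w \<and> fst (w ! j) \<noteq> Virt}"

lemma classical_from_Cons:
  "classical_from (l # w) k = (if fst l = Virt then {} else {k}) \<union> classical_from w (Suc k)"
proof -
  have "{j. j < length (l # w) \<and> fst ((l # w) ! j) \<noteq> Virt} =
      (if fst l = Virt then {} else {0}) \<union> Suc ` {j. j < length w \<and> fst (w ! j) \<noteq> Virt}"
    by (auto simp: less_Suc_eq_0_disj)
  then show ?thesis unfolding classical_from_def by (auto simp: image_image)
qed

lemma finite_classical_from [simp]: "finite (classical_from w k)"
  unfolding classical_from_def by simp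

lemma classical_from_ge: "j \<in> classical_from w k \<Longrightarrow> k \<le> j"
  unfolding classical_from_def by auto

lemma word_cong:
  assumes "\<And>j. k \<le> j \<Longrightarrow> j \<in> U \<longleftrightarrow> j \<in> U'"
  shows "word_graph n w k U = word_graph n w k U'" "word_weight w k U = word_weight w k U'"
  using assms by (induction w arbitrary: k) simp_all

text \<open>A set of positions contains \<open>k\<close> or not, which selects one of the two terms
  of a classical letter. A virtual letter has a single term, and its position belongs to no
  set.\<close>

lemma word_comb_states:
  "word_comb n w = (\<Sum>U\<in>Pow (classical_from w k). Poly_Mapping.single (word_graph n w k U) (word_weight w k U))"
proof (induction w arbitrary: k)
  case Nil
  show ?case by (simp add: classical_from_def)
next
  case (Cons l w)
  let ?S = "classical_from w (Suc k)"
  let ?g = "\<lambda>U. Poly_Mapping.single (word_graph n (l # w) k U) (word_weight (l # w) k U)"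
  have k: "k \<notin> ?S" using classical_from_ge by fastforce
  have expand: "bilin_ext graph_comp (Poly_Mapping.single (letter_graph n l u) (letter_weight l u)) (word_comb n w) =
      (\<Sum>U\<in>Pow ?S. ?g (if u then insert k U else U))" for u
    unfolding Cons.IH[of "Suc k"] bilin_ext_sum_right
  proof (rule sum.cong[OF HOL.refl])
    fix U assume "U \<in> Pow ?S"
    then have "k \<in> (if u then insert k U else U) \<longleftrightarrow> u" using k by auto
    moreover have "word_graph n w (Suc k) (if u then insert k U else U) = word_graph n w (Suc k) U"
      "word_weight w (Suc k) (if u then insert k U else U) = word_weight w (Suc k) U"
      by (rule word_cong; auto)+
    ultimately show "bilin_ext graph_comp (Poly_Mapping.single (letter_graph n l u) (letter_weight l u))
        (Poly_Mapping.single (word_graph n w (Suc k) U) (word_weight w (Suc k) U)) = ?g (if u then insert k U else U)"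
      by simp
  qed
  show ?case
  proof (cases "fst l = Virt")
    case True
    then have "letter_comb n l = Poly_Mapping.single (letter_graph n l False) (letter_weight l False)"
      by (simp add: letter_comb_def letter_graph_def letter_weight_def)
    then show ?thesis using expand[of False] True by (simp add: classical_from_Cons)
  next
    case False
    then have "letter_comb n l = Poly_Mapping.single (letter_graph n l False) (letter_weight l False) +
        Poly_Mapping.single (letter_graph n l True) (letter_weight l True)"
      by (simp add: letter_comb_def letter_graph_def letter_weight_def)
    then have "word_comb n (l # w) = (\<Sum>U\<in>Pow ?S. ?g U) + (\<Sum>U\<in>Pow ?S. ?g (insert k U))"
      using expand[of False] expand[of True] by (simp add: bilin_ext_add_left)
    also have "(\<Sum>U\<in>Pow ?S. ?g (insert k U)) = (\<Sum>U\<in>insert k ` Pow ?S. ?g U)"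
    proof (rule sum.reindex[unfolded comp_def, symmetric])
      show "inj_on (insert k) (Pow ?S)" using k by (auto simp: inj_on_def)
    qed
    also have "(\<Sum>U\<in>Pow ?S. ?g U) + \<dots> = (\<Sum>U\<in>Pow ?S \<union> insert k ` Pow ?S. ?g U)"
      by (rule sum.union_disjoint[symmetric]) (use k in auto)
    finally show ?thesis using False by (simp add: classical_from_Cons Pow_insert)
  qed
qed

lemma word_weight_prod:
  "word_weight w k U = (\<Prod>c\<in>classical_from w k. letter_weight (w ! (c - k)) (c \<in> U))"
proof (induction w arbitrary: k)
  case (Cons l w)
  let ?S = "classical_from w (Suc k)"
  have k: "k \<notin> ?S" using classical_from_ge by fastforce
  have "(\<Prod>c\<in>?S. letter_weight ((l # w) ! (c - k)) (c \<in> U)) = (\<Prod>c\<in>?S. letter_weight (w ! (c - Suc k)) (c \<in> U))"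
  proof (rule prod.cong[OF HOL.refl])
    fix c assume "c \<in> ?S"
    then have "Suc k \<le> c" by (rule classical_from_ge)
    then have "c - k = Suc (c - Suc k)" by simp
    then show "letter_weight ((l # w) ! (c - k)) (c \<in> U) = letter_weight (w ! (c - Suc k)) (c \<in> U)" by simp
  qed
  then show ?case using k by (simp add: classical_from_Cons Cons.IH letter_weight_def)
qed (simp add: classical_from_def)

section \<open>State sum and state graphs of a closed braid\<close>

lemma bracket_braid_closure:
  "bracket (braid_closure n w) = (\<Sum>U\<in>Pow (classical_from w 0). lscale (word_weight w 0 U)
     (web_eval (state_graph (braid_closure n w) U)))"
proof -
  have cl: "classical (braid_closure n w) = classical_from w 0"
    unfolding classical_def classical_from_def braid_closure_def by (auto simp: image_def)
  have "state_weight (braid_closure n w) U = word_weight w 0 U" for U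
    unfolding state_weight_def word_weight_prod cl
  proof (rule prod.cong[OF HOL.refl])
    fix c assume "c \<in> classical_from w 0"
    then have "c < length w" "fst (w ! c) \<noteq> Virt" by (auto simp: classical_from_def)
    then show "(if c \<in> U then - Apow (- crossing_sign (kinds (braid_closure n w) ! c))
        else Apow (2 * crossing_sign (kinds (braid_closure n w) ! c))) = letter_weight (w ! (c - 0)) (c \<in> U)"
      by (simp add: letter_weight_def braid_closure_def)
  qed
  then show ?thesis unfolding bracket_def cl by simp
qed

text \<open>Levels are counted downwards, so lower ends get the larger number. Letter graphs have no
  inner nodes except the sink 0 and the source 1.\<close>

fun level :: "nat \<Rightarrow> node \<Rightarrow> dnode" where
  "level k (Low j) = Pt (Suc k) j"
| "level k (Up j) = Pt k j"
| "level k (Inner m) = (if m = 0 then Sink k else Source k)"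

definition local_state :: "kind \<times> nat \<Rightarrow> nat \<Rightarrow> nat set \<Rightarrow> dnode dgraph" where
  "local_state l k U = (if fst l = Virt then virtual_state k
     else if k \<in> U then unoriented_state k else oriented_state k)"

fun diagram_layers :: "nat \<Rightarrow> bword \<Rightarrow> nat \<Rightarrow> nat set \<Rightarrow> dnode dgraph" where
  "diagram_layers n [] k U = {#}"
| "diagram_layers n (l # w) k U = layer n k (snd l) + local_state l k U + diagram_layers n w (Suc k) U"

fun graph_layers :: "nat \<Rightarrow> bword \<Rightarrow> nat \<Rightarrow> nat set \<Rightarrow> dnode dgraph" where
  "graph_layers n [] k U = {#}"
| "graph_layers n (l # w) k U = rename (level k) (letter_graph n l (k \<in> U)) + graph_layers n w (Suc k) U"

lemma diagram_layers_sum: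
  "diagram_layers n w k U = (\<Sum>j<length w. layer n (k + j) (snd (w ! j)) + local_state (w ! j) (k + j) U)"
  by (induction w arbitrary: k) (simp_all add: sum.lessThan_Suc_shift del: sum.lessThan_Suc)

lemma state_graph_braid_closure:
  "state_graph (braid_closure n w) U =
    diagram_layers n w 0 U + image_mset (\<lambda>j. (Pt 0 j, Pt (length w) j)) (mset_set {1..n})"
proof -
  have "(if kinds (braid_closure n w) ! c = Virt then virtual_state c
     else if c \<in> U then unoriented_state c else oriented_state c) = local_state (w ! c) c U" if "c < length w" for c
    using that by (simp add: local_state_def braid_closure_def)
  then show ?thesis
    unfolding state_graph_def diagram_layers_sum
    by (simp add: braid_closure_def sum.distrib ac_simps)
qed

lemma nodes_layer:
  "v \<in> nodes (layer n k i) \<Longrightarrow> (\<exists>j. v = Pt (Suc k) j \<or> v = Pt k j) \<or> v \<in> {Inc k 1, Inc k 2, Outg k 1, Outg k 2}"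
  unfolding layer_def by auto

lemma nodes_local_state:
  "v \<in> nodes (local_state l k U) \<Longrightarrow> v \<in> {Inc k 1, Inc k 2, Outg k 1, Outg k 2, Sink k, Source k}"
  unfolding local_state_def virtual_state_def unoriented_state_def oriented_state_def by (auto split: if_splits)

text \<open>Once a local state is chosen, the four crossing ends are marked points. Since
  \<open>Outg k 1\<close> is on the right and \<open>Outg k 2\<close> on the left, the oriented
  state straightens to vertical strands and the virtual one to a crossing. The context
  \<open>K\<close> allows layers to be treated one at a time.\<close>

lemma smooths_layer:
  assumes i: "i \<in> {1..<n}" "snd l = i" and K: "\<And>v. v \<in> nodes K \<Longrightarrow> \<not> (\<exists>s. v = Inc k s \<or> v = Outg k s)"
  shows "smooths (layer n k (snd l) + local_state l k U + K) (rename (level k) (letter_graph n l (k \<in> U)) + K)"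
proof -
  let ?J = "{1..n} - {i, i + 1}"
  let ?V = "image_mset (\<lambda>j. (Pt (Suc k) j, Pt k j)) (mset_set ?J)"
  have KV: "Inc k s \<notin> nodes (?V + K)" "Outg k s \<notin> nodes (?V + K)" for s using K by auto
  have vert: "rename (level k) (vertical ?J) = ?V" by (simp add: vertical_def)
  have J: "{1..n} = insert i (insert (i + 1) ?J)" using i(1) by auto
  have vert': "rename (level k) (vertical {1..n}) = ?V + {#(Pt (Suc k) i, Pt k i), (Pt (Suc k) (i + 1), Pt k (i + 1))#}"
    by (subst J) (simp add: vertical_def)
  consider "fst l = Virt" | "fst l \<noteq> Virt" "k \<notin> U" | "fst l \<noteq> Virt" "k \<in> U" by blast
  then show ?thesis
  proof cases
    case 1
    have "smooths (?V + K + {#(Pt (Suc k) (i + 1), Inc k 2), (Inc k 2, Outg k 2), (Outg k 2, Pt k i)#}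
        + {#(Pt (Suc k) i, Inc k 1), (Inc k 1, Outg k 1), (Outg k 1, Pt k (i + 1))#})
      (?V + K + {#(Pt (Suc k) (i + 1), Inc k 2), (Inc k 2, Outg k 2), (Outg k 2, Pt k i)#} + {#(Pt (Suc k) i, Pt k (i + 1))#})"
      by (rule smooths_two) (use KV in auto)
    moreover have "smooths (?V + K + {#(Pt (Suc k) i, Pt k (i + 1))#} + {#(Pt (Suc k) (i + 1), Inc k 2), (Inc k 2, Outg k 2), (Outg k 2, Pt k i)#})
      (?V + K + {#(Pt (Suc k) i, Pt k (i + 1))#} + {#(Pt (Suc k) (i + 1), Pt k i)#})"
      by (rule smooths_two) (use KV in auto)
    ultimately have "smooths (?V + K + {#(Pt (Suc k) (i + 1), Inc k 2), (Inc k 2, Outg k 2), (Outg k 2, Pt k i)#}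
        + {#(Pt (Suc k) i, Inc k 1), (Inc k 1, Outg k 1), (Outg k 1, Pt k (i + 1))#})
      (?V + K + {#(Pt (Suc k) i, Pt k (i + 1))#} + {#(Pt (Suc k) (i + 1), Pt k i)#})"
      by (auto simp: add_mset_commute intro: smooths_trans)
    then show ?thesis
      using 1 i(2) unfolding layer_def local_state_def virtual_state_def letter_graph_def virtual_crossing_def
      by (simp add: vertical_def Suc_eq_plus1 ac_simps add_mset_commute)
  next
    case 2
    have "smooths (?V + K + {#(Pt (Suc k) (i + 1), Inc k 2), (Inc k 2, Outg k 1), (Outg k 1, Pt k (i + 1))#}
        + {#(Pt (Suc k) i, Inc k 1), (Inc k 1, Outg k 2), (Outg k 2, Pt k i)#})
      (?V + K + {#(Pt (Suc k) (i + 1), Inc k 2), (Inc k 2, Outg k 1), (Outg k 1, Pt k (i + 1))#} + {#(Pt (Suc k) i, Pt k i)#})"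
      by (rule smooths_two) (use KV in auto)
    moreover have "smooths (?V + K + {#(Pt (Suc k) i, Pt k i)#} + {#(Pt (Suc k) (i + 1), Inc k 2), (Inc k 2, Outg k 1), (Outg k 1, Pt k (i + 1))#})
      (?V + K + {#(Pt (Suc k) i, Pt k i)#} + {#(Pt (Suc k) (i + 1), Pt k (i + 1))#})"
      by (rule smooths_two) (use KV in auto)
    ultimately have "smooths (?V + K + {#(Pt (Suc k) (i + 1), Inc k 2), (Inc k 2, Outg k 1), (Outg k 1, Pt k (i + 1))#}
        + {#(Pt (Suc k) i, Inc k 1), (Inc k 1, Outg k 2), (Outg k 2, Pt k i)#})
      (?V + K + {#(Pt (Suc k) i, Pt k i)#} + {#(Pt (Suc k) (i + 1), Pt k (i + 1))#})"
      by (auto simp: add_mset_commute intro: smooths_trans)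
    then show ?thesis
      using 2 i(2) unfolding layer_def local_state_def oriented_state_def letter_graph_def
      by (simp add: vert' Suc_eq_plus1 ac_simps add_mset_commute)
  next
    case 3
    have "smooths (?V + K + {#(Source k, Sink k), (Pt (Suc k) (i + 1), Inc k 2), (Inc k 2, Sink k),
          (Source k, Outg k 1), (Outg k 1, Pt k (i + 1)), (Source k, Outg k 2), (Outg k 2, Pt k i)#} + {#(Pt (Suc k) i, Inc k 1), (Inc k 1, Sink k)#})
      (?V + K + {#(Source k, Sink k), (Pt (Suc k) (i + 1), Inc k 2), (Inc k 2, Sink k),
          (Source k, Outg k 1), (Outg k 1, Pt k (i + 1)), (Source k, Outg k 2), (Outg k 2, Pt k i)#} + {#(Pt (Suc k) i, Sink k)#})"
      by (rule smooths_one) (use KV in auto)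
    moreover have "smooths (?V + K + {#(Source k, Sink k), (Pt (Suc k) i, Sink k),
          (Source k, Outg k 1), (Outg k 1, Pt k (i + 1)), (Source k, Outg k 2), (Outg k 2, Pt k i)#} + {#(Pt (Suc k) (i + 1), Inc k 2), (Inc k 2, Sink k)#})
      (?V + K + {#(Source k, Sink k), (Pt (Suc k) i, Sink k),
          (Source k, Outg k 1), (Outg k 1, Pt k (i + 1)), (Source k, Outg k 2), (Outg k 2, Pt k i)#} + {#(Pt (Suc k) (i + 1), Sink k)#})"
      by (rule smooths_one) (use KV in auto)
    moreover have "smooths (?V + K + {#(Source k, Sink k), (Pt (Suc k) i, Sink k), (Pt (Suc k) (i + 1), Sink k),
          (Source k, Outg k 2), (Outg k 2, Pt k i)#} + {#(Source k, Outg k 1), (Outg k 1, Pt k (i + 1))#})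
      (?V + K + {#(Source k, Sink k), (Pt (Suc k) i, Sink k), (Pt (Suc k) (i + 1), Sink k),
          (Source k, Outg k 2), (Outg k 2, Pt k i)#} + {#(Source k, Pt k (i + 1))#})"
      by (rule smooths_one) (use KV in auto)
    moreover have "smooths (?V + K + {#(Source k, Sink k), (Pt (Suc k) i, Sink k), (Pt (Suc k) (i + 1), Sink k),
          (Source k, Pt k (i + 1))#} + {#(Source k, Outg k 2), (Outg k 2, Pt k i)#})
      (?V + K + {#(Source k, Sink k), (Pt (Suc k) i, Sink k), (Pt (Suc k) (i + 1), Sink k),
          (Source k, Pt k (i + 1))#} + {#(Source k, Pt k i)#})"
      by (rule smooths_one) (use KV in auto)
    ultimately have "smooths (?V + K + {#(Source k, Sink k), (Pt (Suc k) (i + 1), Inc k 2), (Inc k 2, Sink k),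
          (Source k, Outg k 1), (Outg k 1, Pt k (i + 1)), (Source k, Outg k 2), (Outg k 2, Pt k i)#} + {#(Pt (Suc k) i, Inc k 1), (Inc k 1, Sink k)#})
      (?V + K + {#(Source k, Sink k), (Pt (Suc k) i, Sink k), (Pt (Suc k) (i + 1), Sink k),
          (Source k, Pt k (i + 1))#} + {#(Source k, Pt k i)#})"
      by (auto simp: add_mset_commute intro: smooths_trans)
    then show ?thesis
      using 3 i(2) unfolding layer_def local_state_def unoriented_state_def letter_graph_def double_Y_def
      by (simp add: vertical_def Suc_eq_plus1 ac_simps add_mset_commute)
  qed
qed

lemma nodes_diagram_layers: "v \<in> nodes (diagram_layers n w k U) \<Longrightarrow> v = Inc c s \<or> v = Outg c s \<Longrightarrow> k \<le> c"
  by (induction w arbitrary: k) (auto dest!: nodes_layer nodes_local_state, fastforce+)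

text \<open>Proceeds from the top layer downwards; layers already smoothed move into the context
  \<open>K\<close>, where they contain no crossing ends.\<close>

lemma smooths_layers:
  assumes "w \<in> bwords n" "\<And>v. v \<in> nodes K \<Longrightarrow> \<not> (\<exists>c s. k \<le> c \<and> (v = Inc c s \<or> v = Outg c s))"
  shows "smooths (diagram_layers n w k U + K) (graph_layers n w k U + K)"
  using assms
proof (induction w arbitrary: k K)
  case (Cons l w)
  let ?A = "layer n k (snd l) + local_state l k U" and ?B = "rename (level k) (letter_graph n l (k \<in> U))"
  have l: "snd l \<in> {1..<n}" "w \<in> bwords n" using Cons.prems(1) by (auto simp: bwords_def)
  have B: "v \<in> nodes ?B \<Longrightarrow> \<not> (\<exists>c s. v = Inc c s \<or> v = Outg c s)" for v
    by (auto elim!: level.elims[OF HOL.sym] split: if_splits)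
  have "smooths (?A + (diagram_layers n w (Suc k) U + K)) (?B + (diagram_layers n w (Suc k) U + K))"
    by (rule smooths_layer[OF l(1) HOL.refl]) (use Cons.prems(2) nodes_diagram_layers in fastforce)
  moreover have "smooths (diagram_layers n w (Suc k) U + (?B + K)) (graph_layers n w (Suc k) U + (?B + K))"
  proof (rule Cons.IH[OF l(2)])
    fix v assume "v \<in> nodes (?B + K)"
    then show "\<not> (\<exists>c s. Suc k \<le> c \<and> (v = Inc c s \<or> v = Outg c s))"
      using B[of v] Cons.prems(2)[of v] by (auto simp: Suc_le_eq dest: less_imp_le)
  qed
  ultimately show ?case by (auto simp: ac_simps intro: smooths_trans)
qed (simp add: smooths_refl)

text \<open>The nodes of a composed graph, as nodes of the state graph. The nodes \<open>Inc 0 j\<close>, which smoothing has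
  made available, serve as lower ends.\<close>

fun place :: "nat \<Rightarrow> nat \<Rightarrow> node \<Rightarrow> dnode" where
  "place L k (Low j) = Inc 0 j"
| "place L k (Up j) = Pt k j"
| "place 0 k (Inner m) = Sink k"
| "place (Suc L) k (Inner m) = (if m mod 3 = 0 then place L (Suc k) (Inner (m div 3))
     else if m mod 3 = 1 then level k (Inner (m div 3)) else Pt (Suc k) (m div 3))"

lemma place_in_upper: "place (Suc L) k (in_upper v) = level k v"
  by (cases v) (simp_all add: mod_3_simps One_nat_def)

lemma place_in_lower: "place (Suc L) k (in_lower v) = place L (Suc k) v"
  by (cases v) (simp_all add: mod_3_simps One_nat_def)

text \<open>Keeps the factors apart: apart from the auxiliary lower ends, everything placed from
  position \<open>k\<close> on lies on level \<open>k\<close> or below.\<close>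

lemma place_position:
  "place L k v = Pt a j \<Longrightarrow> k \<le> a" "place L k v = Sink a \<Longrightarrow> k \<le> a" "place L k v = Source a \<Longrightarrow> k \<le> a"
  by (induction L k v rule: place.induct) (auto split: if_splits dest: Suc_leD)

lemma place_Inner: "place L k (Inner m) \<noteq> Inc c j"
  by (induction L arbitrary: k m) auto

lemma open_letter_graph: "snd l \<in> {1..<n} \<Longrightarrow> open_graph n n (letter_graph n l u)"
  using open_graph_generators[of "snd l" n] open_graph_identity[of n] by (simp add: letter_graph_def)

lemma open_word_graph: "w \<in> bwords n \<Longrightarrow> open_graph n n (word_graph n w k U)"
proof (induction w arbitrary: k)
  case (Cons l w)
  then have "snd l \<in> {1..<n}" "w \<in> bwords n" by (auto simp: bwords_def)
  then show ?case using open_graph_comp[OF open_letter_graph Cons.IH] by simp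
qed (use open_graph_identity[of n] in simp)

text \<open>The additional strands come from the identity graph of the empty word at the bottom;
  identifying their starting points with the top level will turn them into the closing arcs.\<close>

lemma rename_place:
  "rename (place (length w) k) (word_graph n w k U) =
    graph_layers n w k U + image_mset (\<lambda>j. (Inc 0 j, Pt (k + length w) j)) (mset_set {1..n})"
proof (induction w arbitrary: k)
  case (Cons l w)
  then show ?case
    by (simp add: graph_comp_def rename_rename place_in_upper place_in_lower add.assoc del: place.simps)
qed (simp add: vertical_def)

lemma inj_level: "inj_on (level k) (nodes (letter_graph n l u))"
proof -
  have "v \<in> range Low \<union> range Up \<union> {Inner 0, Inner 1}" if "v \<in> nodes (letter_graph n l u)" for v
    using that by (auto simp: letter_graph_def double_Y_def virtual_crossing_def vertical_def split: if_splits)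
  then have "nodes (letter_graph n l u) \<subseteq> range Low \<union> range Up \<union> {Inner 0, Inner 1}" by blast
  moreover have "inj_on (level k) (range Low \<union> range Up \<union> {Inner 0, Inner 1})" by (auto simp: inj_on_def)
  ultimately show ?thesis by (rule inj_on_subset[rotated])
qed

lemma inj_place: "w \<in> bwords n \<Longrightarrow> inj_on (place (length w) k) (nodes (word_graph n w k U))"
proof (induction w arbitrary: k)
  case Nil
  then show ?case by (auto simp: inj_on_def vertical_def)
next
  case (Cons l w)
  let ?e = "place (Suc (length w)) k" and ?F = "letter_graph n l (k \<in> U)" and ?G = "word_graph n w (Suc k) U"
  have l: "snd l \<in> {1..<n}" "w \<in> bwords n" using Cons.prems by (auto simp: bwords_def)
  note IH = Cons.IH[OF l(2), of "Suc k"]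
  \<comment> \<open>The lower factor occupies the levels from \<open>Suc k\<close> on, so its image
    can meet the upper factor only in the points of that level. There the induction hypothesis
    identifies the lower node as the upper end glued to \<open>u\<close>.\<close>
  have ul: "in_upper u = in_lower v"
    if u: "u \<in> nodes ?F" and v: "v \<in> nodes ?G" and eq: "level k u = place (length w) (Suc k) v" for u v
  proof (cases u)
    case (Low j)
    then have "Up j \<in> nodes ?G"
      using u open_graph_low[OF open_letter_graph[OF l(1)], of j] open_graph_up[OF open_word_graph[OF l(2)], of j] by blast
    then have "v = Up j" using inj_onD[OF IH _ v, of "Up j"] eq Low by simp
    then show ?thesis using Low by simp
  next
    case (Up j)
    then show ?thesis using place_position(1)[of "length w" "Suc k" v k j] eq by simp
  next
    case (Inner m)
    then show ?thesis using place_position(2,3)[of "length w" "Suc k" v k] eq by (simp split: if_splits)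
  qed
  have "inj_on ?e (in_upper ` nodes ?F)"
    using inj_level[of k n l "k \<in> U"] by (auto simp: inj_on_def place_in_upper simp del: place.simps)
  moreover have "inj_on ?e (in_lower ` nodes ?G)"
    using IH by (auto simp: inj_on_def place_in_lower simp del: place.simps)
  moreover have "x = y" if "x \<in> in_upper ` nodes ?F" "y \<in> in_lower ` nodes ?G" "?e x = ?e y" for x y
    using that ul by (auto simp: place_in_upper place_in_lower simp del: place.simps)
  ultimately have "inj_on ?e (in_upper ` nodes ?F \<union> in_lower ` nodes ?G)"
    unfolding inj_on_Un by blast
  then show ?case by (simp add: graph_comp_def del: place.simps)
qed

lemma closed_web_rename:
  assumes "closed_web G" "inj_on \<phi> (nodes G)" shows "closed_web (rename \<phi> G)"
  using assms deg_rename[OF isolates_inj[OF assms(2)]] unfolding closed_web_def by (auto simp: trivalent_defs)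

lemma web_eval_state_graph:
  assumes w: "w \<in> bwords n"
  shows "web_eval (state_graph (braid_closure n w) U) = closure_eval (word_graph n w 0 U)"
proof -
  let ?G = "word_graph n w 0 U" and ?e = "place (length w) 0"
  let ?K = "image_mset (\<lambda>j. (Pt 0 j, Pt (length w) j)) (mset_set {1..n})"
  \<comment> \<open>In the closure both ends of a strand are called \<open>Low j\<close>, which is
    placed at the top point \<open>Pt 0 j\<close>. The map \<eta> makes the same identification
    after placing, so that the strands from \<open>Inc 0 j\<close> become the arcs from
    \<open>Pt 0 j\<close> to \<open>Pt (length w) j\<close>.\<close>
  define \<psi> where "\<psi> v = (case v of Low j \<Rightarrow> Pt 0 j | _ \<Rightarrow> ?e v)" for v
  define \<eta> where "\<eta> v = (case v of Inc c j \<Rightarrow> Pt 0 j | _ \<Rightarrow> v)" for v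
  note G = open_word_graph[OF w, of 0 U]
  have "\<psi> (identify_ends v) = \<eta> (?e v)" for v
  proof (cases v)
    case (Inner m)
    then show ?thesis using place_Inner[of "length w" 0 m]
      by (cases "?e v") (simp_all add: \<psi>_def \<eta>_def)
  qed (simp_all add: \<psi>_def \<eta>_def)
  then have "rename \<psi> (graph_closure ?G) = rename \<eta> (rename ?e ?G)"
    unfolding graph_closure_def rename_rename by simp
  also have "\<dots> = graph_layers n w 0 U + ?K"
  proof -
    have "rename \<eta> (graph_layers n w k U) = graph_layers n w k U" for k
    proof (induction w arbitrary: k)
      case (Cons l w)
      have "\<eta> (level k v) = level k v" for v by (cases v) (simp_all add: \<eta>_def)
      then show ?case using Cons by (simp add: rename_rename)
    qed simp
    then show ?thesis unfolding rename_place by (simp add: \<eta>_def)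
  qed
  finally have eq: "rename \<psi> (graph_closure ?G) = graph_layers n w 0 U + ?K" .
  have inj: "inj_on \<psi> (nodes (graph_closure ?G))"
  proof (rule inj_onI)
    \<comment> \<open>On joints \<psi> agrees with \<open>place\<close> at the corresponding upper
      ends, so calling each joint by its upper end reduces injectivity to
      \<open>inj_place\<close>.\<close>
    define up where "up v = (case v of Low j \<Rightarrow> Up j | _ \<Rightarrow> v)" for v
    have up: "up v \<in> nodes ?G \<and> \<psi> v = ?e (up v)" "\<And>j. v \<noteq> Up j" if v: "v \<in> nodes (graph_closure ?G)" for v
    proof -
      obtain u where u: "u \<in> nodes ?G" "v = identify_ends u" using v by (auto simp: graph_closure_def)
      show "up v \<in> nodes ?G \<and> \<psi> v = ?e (up v)"
        using u open_graph_low[OF G] open_graph_up[OF G] by (cases u) (auto simp: up_def \<psi>_def)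
      show "v \<noteq> Up j" for j using u(2) by (cases u) auto
    qed
    fix x y assume xy: "x \<in> nodes (graph_closure ?G)" "y \<in> nodes (graph_closure ?G)" "\<psi> x = \<psi> y"
    then have "up x = up y" using up(1)[OF xy(1)] up(1)[OF xy(2)] inj_onD[OF inj_place[OF w]] by metis
    then show "x = y" using up(2)[OF xy(1)] up(2)[OF xy(2)] by (cases x; cases y) (auto simp: up_def)
  qed
  have sm: "smooths (state_graph (braid_closure n w) U) (graph_layers n w 0 U + ?K)"
    unfolding state_graph_braid_closure by (rule smooths_layers[OF w]) auto
  \<comment> \<open>Closedness is known for the closure of an open graph. It is carried over by the
    renaming and then backwards along the smoothing to the state graph.\<close>
  have "closed_web (graph_layers n w 0 U + ?K)"
    unfolding eq[symmetric] by (rule closed_web_rename[OF closed_web_graph_closure[OF G] inj])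
  then have "closed_web (state_graph (braid_closure n w) U)" using smooths_closed_web[OF sm] by simp
  from web_eval_smooths[OF sm this] show ?thesis
    unfolding eq[symmetric] by (simp add: web_eval_rename[OF inj])
qed

lemma bracket_eq_Trace:
  assumes "w \<in> bwords n" shows "bracket (braid_closure n w) = Trace (word_elt n w)"
  unfolding bracket_braid_closure Trace_graph_class word_comb_states[of n w 0]
  by (simp add: lin_ext_sum web_eval_state_graph[OF assms])

theorem mainTheorem10:
  fixes n :: nat
  assumes "n \<ge> 1"
  shows "(\<forall>x\<in>graph_combs n n.
            Trace (graph_class n n x) = lin_ext (\<lambda>G. web_eval (graph_closure G)) x) \<and>
         (\<exists>k Tr.
            graph_representation n k \<and>
            (\<forall>k'. graph_representation n k' \<longrightarrow> (\<forall>X\<in>carrier (VH n). k' X = k X)) \<and>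
            (\<forall>X\<in>carrier (VH n). Tr X = Trace (k X)) \<and>
            (\<forall>X\<in>carrier (VH n). \<forall>Y\<in>carrier (VH n). Tr (X \<oplus>\<^bsub>VH n\<^esub> Y) = Tr X + Tr Y) \<and>
            (\<forall>c. \<forall>X\<in>carrier (VH n). Tr (VH_scale n c X) = lscale c (Tr X)) \<and>
            (\<forall>X\<in>carrier (VH n). \<forall>Y\<in>carrier (VH n).
               Tr (X \<otimes>\<^bsub>VH n\<^esub> Y) = Tr (Y \<otimes>\<^bsub>VH n\<^esub> X)) \<and>
            (\<forall>b\<in>carrier (VB n). \<forall>w\<in>b.
               bracket (braid_closure n w) = Tr (VB_to_VH n b) \<and>
               Tr (VB_to_VH n b) = Trace (k (VB_to_VH n b))))"
proof (intro conjI)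
  show "\<forall>x\<in>graph_combs n n. Trace (graph_class n n x) = lin_ext (\<lambda>G. web_eval (graph_closure G)) x"
    by (simp add: Trace_graph_class)
next
  let ?k = "VH_rep n" and ?Tr = "\<lambda>X. Trace (VH_rep n X)"
  note k = graph_representation_VH_rep[of n]
  then have hom: "?k \<in> ring_hom (VH n) (GraphEnd n)"
    and scale: "\<And>c X. X \<in> carrier (VH n) \<Longrightarrow> ?k (VH_scale n c X) = gscale n c (?k X)"
    unfolding graph_representation_def by (auto dest: ring_hom_ring.homh)
  note cl = ring_hom_closed[OF hom]
  have 1: "\<forall>X\<in>carrier (VH n). \<forall>Y\<in>carrier (VH n). ?Tr (X \<oplus>\<^bsub>VH n\<^esub> Y) = ?Tr X + ?Tr Y"
    by (simp add: ring_hom_add[OF hom] Trace_add cl)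
  have 2: "\<forall>c. \<forall>X\<in>carrier (VH n). ?Tr (VH_scale n c X) = lscale c (?Tr X)"
    by (simp add: scale Trace_gscale cl)
  have 3: "\<forall>X\<in>carrier (VH n). \<forall>Y\<in>carrier (VH n). ?Tr (X \<otimes>\<^bsub>VH n\<^esub> Y) = ?Tr (Y \<otimes>\<^bsub>VH n\<^esub> X)"
    using Trace_mult_commute[OF cl cl] by (simp add: ring_hom_mult[OF hom])
  \<comment> \<open>The word ranges over the whole class \<open>b\<close>, so the bracket of the
    closure is seen to depend on the braid only.\<close>
  have 4: "bracket (braid_closure n w) = ?Tr (VB_to_VH n b)" if b: "b \<in> carrier (VB n)" "w \<in> b" for b w
  proof -
    have "Poly_Mapping.single b 1 \<in> carrier (ZVB n)" using b(1) by (simp add: group_algebra_simps)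
    then have "?k (VB_to_VH n b) = word_elt n w"
      unfolding VB_to_VH_def by (simp add: VH_rep_proj ZVB_rep_single[OF b])
    then show ?thesis using bracket_eq_Trace VB_member_bwords[OF b] by simp
  qed
  show "\<exists>k Tr.
            graph_representation n k \<and>
            (\<forall>k'. graph_representation n k' \<longrightarrow> (\<forall>X\<in>carrier (VH n). k' X = k X)) \<and>
            (\<forall>X\<in>carrier (VH n). Tr X = Trace (k X)) \<and>
            (\<forall>X\<in>carrier (VH n). \<forall>Y\<in>carrier (VH n). Tr (X \<oplus>\<^bsub>VH n\<^esub> Y) = Tr X + Tr Y) \<and>
            (\<forall>c. \<forall>X\<in>carrier (VH n). Tr (VH_scale n c X) = lscale c (Tr X)) \<and>
            (\<forall>X\<in>carrier (VH n). \<forall>Y\<in>carrier (VH n).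
               Tr (X \<otimes>\<^bsub>VH n\<^esub> Y) = Tr (Y \<otimes>\<^bsub>VH n\<^esub> X)) \<and>
            (\<forall>b\<in>carrier (VB n). \<forall>w\<in>b.
               bracket (braid_closure n w) = Tr (VB_to_VH n b) \<and>
               Tr (VB_to_VH n b) = Trace (k (VB_to_VH n b)))"
  proof (intro exI conjI allI ballI impI)
    show "graph_representation n ?k" by (rule k)
    show "k' X = ?k X" if "graph_representation n k'" "X \<in> carrier (VH n)" for k' X
      by (rule graph_representation_unique[OF k that])
  qed (use 1 2 3 4 in \<open>simp_all only: HOL.refl\<close>)
qed

end
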